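(* The Parikh coverability problem is undecidable for concurrent QDAS that use both synchronous and asynchronous dispatches.
   Context: A queue-dispatch asynchronous system (QDAS) $\mathcal A$ consists of: a finite data domain $\mathbb D$ with an initial value $d_0$; a finite set $\mathcal X$ of variables ranging over $\mathbb D$; disjoint finite sets $CQID$ (concurrent queues) and $SQID$ (serial queues); a finite set $\Gamma$ of blocks with a distinguished initial block $main$; and for each block $\gamma\in\Gamma$ a finite labelled transition system with state set $S_\gamma$, initial state $s^0_\gamma$, a distinguished final state $f_\gamma\in S_\gamma$, and transitions $\Delta_\gamma\subseteq S_\gamma\times\Sigma\times S_\gamma$. The state sets are pairwise disjoint and $S=\bigcup_\gamma S_\gamma$. The actions $\Sigma$ are: asynchronous dispatches $\mathrm{dispatch_a}(q,\gamma)$ and synchronous dispatches $\mathrm{dispatch_s}(q,\gamma)$ with $q\in CQID\cup SQID$, $\gamma\in\Gamma\setminus\{main\}$; guards (finite conjunctions of atoms $x=d$, $x\neq d$); and assignments $x\gets d$. A configuration is a pair $(G,\mathbf d)$ of a valuation $\mathbf d:\mathcal X\to\mathbb D$ and a call-task graph $G$: a finite set of vertices, each being either a call vertex (a dispatched block waiting in a queue) or a task vertex (a running instance of a block), each labelled with a block $\lambda(v)$, the queue it was dispatched to (or a special identifier for $main$), and a state $state(v)\in S_{\lambda(v)}$ (call vertices carry the initial state of their block); the call vertices of each queue are ordered FIFO; and wait edges, where a wait edge $v\to w$ means $v$ is blocked until $w$ is removed. A task vertex is unblocked if it has no outgoing wait edge. The initial configuration has a single task vertex for $main$ in $s^0_{main}$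 and all variables equal to $d_0$. Steps: an unblocked task vertex $v$ in state $s$ with $(s,a,s')\in\Delta_{\lambda(v)}$ moves to $s'$, where: a guard $a$ must be satisfied by $\mathbf d$; an assignment updates $\mathbf d$; $\mathrm{dispatch_a}(q,\gamma)$ appends a new call vertex for $\gamma$ at the end of queue $q$; $\mathrm{dispatch_s}(q,\gamma)$ does the same and adds a wait edge from $v$ to the new vertex. Scheduler steps: remove an unblocked task vertex $v$ with $state(v)=f_{\lambda(v)}$ (together with wait edges into it); turn the first call vertex of a concurrent queue into a task vertex; turn the first call vertex of a serial queue $q$ into a task vertex provided no task previously dequeued from $q$ is still present. A configuration is reachable if it is obtained from the initial one by finitely many steps. The Parikh image $\mathrm{Parikh}(G):S\to\mathbb N$ maps $s$ to the number of vertices $v$ of $G$ with $state(v)=s$. The Parikh coverability problem: given a QDAS $\mathcal A$ and $f:S\to\mathbb N$, decide whether some reachable $(G,\mathbf d)$ satisfies $f(s)\le\mathrm{Parikh}(G)(s)$ for all $s\in S$. A QDAS is concurrent if $SQID=\emptyset$ and $CQID\neq\emptyset$. *)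

theory Defs
  imports Main "HOL-Library.Nat_Bijection"
begin

section \<open>Queue-dispatch asynchronous systems\<close>

datatype ('x, 'd) atom = Eq 'x 'd | Neq 'x 'd

(* Guard as: the finite conjunction of the atoms in the list as. *)
datatype ('x, 'd, 'q, 'b) action =
    DispatchA 'q 'b
  | DispatchS 'q 'b
  | Guard "('x, 'd) atom list"
  | Assign 'x 'd

record ('x, 'd, 'q, 'b, 's) qdas =
  dom_of :: "'d set"
  init_val :: 'd
  vars :: "'x set"
  cqid :: "'q set"
  sqid :: "'q set"
  blocks :: "'b set"
  main :: 'b
  states :: "'b \<Rightarrow> 's set"
  init_state :: "'b \<Rightarrow> 's"
  final_state :: "'b \<Rightarrow> 's"
  trans_of :: "'b \<Rightarrow> ('s \<times> ('x, 'd, 'q, 'b) action \<times> 's) set"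

fun atom_ok :: "('x, 'd, 'q, 'b, 's) qdas \<Rightarrow> ('x, 'd) atom \<Rightarrow> bool" where
  "atom_ok A (Eq x d) \<longleftrightarrow> x \<in> vars A \<and> d \<in> dom_of A"
| "atom_ok A (Neq x d) \<longleftrightarrow> x \<in> vars A \<and> d \<in> dom_of A"

fun action_ok :: "('x, 'd, 'q, 'b, 's) qdas \<Rightarrow> ('x, 'd, 'q, 'b) action \<Rightarrow> bool" where
  "action_ok A (DispatchA q \<gamma>) \<longleftrightarrow> q \<in> cqid A \<union> sqid A \<and> \<gamma> \<in> blocks A - {main A}"
| "action_ok A (DispatchS q \<gamma>) \<longleftrightarrow> q \<in> cqid A \<union> sqid A \<and> \<gamma> \<in> blocks A - {main A}"
| "action_ok A (Guard as) \<longleftrightarrow> (\<forall>a \<in> set as. atom_ok A a)"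
| "action_ok A (Assign x d) \<longleftrightarrow> x \<in> vars A \<and> d \<in> dom_of A"

definition all_states :: "('x, 'd, 'q, 'b, 's) qdas \<Rightarrow> 's set" where
  "all_states A = (\<Union>\<gamma> \<in> blocks A. states A \<gamma>)"

definition qdas_wf :: "('x, 'd, 'q, 'b, 's) qdas \<Rightarrow> bool" where
  "qdas_wf A \<longleftrightarrow>
     finite (dom_of A) \<and> init_val A \<in> dom_of A \<and> finite (vars A) \<and>
     finite (cqid A) \<and> finite (sqid A) \<and> cqid A \<inter> sqid A = {} \<and>
     finite (blocks A) \<and> main A \<in> blocks A \<and>
     (\<forall>\<gamma> \<in> blocks A.
        finite (states A \<gamma>) \<and> init_state A \<gamma> \<in> states A \<gamma> \<and> final_state A \<gamma> \<in> states A \<gamma> \<and>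
        finite (trans_of A \<gamma>) \<and>
        (\<forall>(s, a, s') \<in> trans_of A \<gamma>. s \<in> states A \<gamma> \<and> action_ok A a \<and> s' \<in> states A \<gamma>)) \<and>
     (\<forall>\<gamma> \<in> blocks A. \<forall>\<gamma>' \<in> blocks A. \<gamma> \<noteq> \<gamma>' \<longrightarrow> states A \<gamma> \<inter> states A \<gamma>' = {})"

definition concurrent :: "('x, 'd, 'q, 'b, 's) qdas \<Rightarrow> bool" where
  "concurrent A \<longleftrightarrow> sqid A = {} \<and> cqid A \<noteq> {}"

definition uses_async :: "('x, 'd, 'q, 'b, 's) qdas \<Rightarrow> bool" where
  "uses_async A \<longleftrightarrow> (\<exists>\<gamma> \<in> blocks A. \<exists>s q \<gamma>' s'. (s, DispatchA q \<gamma>', s') \<in> trans_of A \<gamma>)"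

definition uses_sync :: "('x, 'd, 'q, 'b, 's) qdas \<Rightarrow> bool" where
  "uses_sync A \<longleftrightarrow> (\<exists>\<gamma> \<in> blocks A. \<exists>s q \<gamma>' s'. (s, DispatchS q \<gamma>', s') \<in> trans_of A \<gamma>)"


section \<open>Configurations and steps\<close>

(* Vertices are natural numbers. The call vertices are those listed in some fifo G q, first
   element at the front of the queue. queue_of G v = None is the special identifier for main.
   The functions queue_of, block_of and state_of are meaningful on the vertices only. *)
record ('q, 'b, 's) ctgraph =
  tasks :: "nat set"
  fifo :: "'q \<Rightarrow> nat list"
  block_of :: "nat \<Rightarrow> 'b"
  queue_of :: "nat \<Rightarrow> 'q option"
  state_of :: "nat \<Rightarrow> 's"
  waits :: "(nat \<times> nat) set"

definition calls :: "('q, 'b, 's) ctgraph \<Rightarrow> nat set" where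
  "calls G = (\<Union>q. set (fifo G q))"

definition verts :: "('q, 'b, 's) ctgraph \<Rightarrow> nat set" where
  "verts G = calls G \<union> tasks G"

definition unblocked_task :: "('q, 'b, 's) ctgraph \<Rightarrow> nat \<Rightarrow> bool" where
  "unblocked_task G v \<longleftrightarrow> v \<in> tasks G \<and> (\<forall>w. (v, w) \<notin> waits G)"

definition move :: "nat \<Rightarrow> 's \<Rightarrow> ('q, 'b, 's) ctgraph \<Rightarrow> ('q, 'b, 's) ctgraph" where
  "move v s G = G\<lparr>state_of := (state_of G)(v := s)\<rparr>"

definition enqueue ::
  "('x, 'd, 'q, 'b, 's) qdas \<Rightarrow> 'q \<Rightarrow> 'b \<Rightarrow> nat \<Rightarrow> ('q, 'b, 's) ctgraph \<Rightarrow> ('q, 'b, 's) ctgraph"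
where
  "enqueue A q \<gamma> w G = G\<lparr>
     fifo := (fifo G)(q := fifo G q @ [w]),
     block_of := (block_of G)(w := \<gamma>),
     queue_of := (queue_of G)(w := Some q),
     state_of := (state_of G)(w := init_state A \<gamma>)\<rparr>"

fun atom_holds :: "('x \<Rightarrow> 'd) \<Rightarrow> ('x, 'd) atom \<Rightarrow> bool" where
  "atom_holds val (Eq x d) \<longleftrightarrow> val x = d"
| "atom_holds val (Neq x d) \<longleftrightarrow> val x \<noteq> d"

type_synonym ('x, 'd, 'q, 'b, 's) config = "('q, 'b, 's) ctgraph \<times> ('x \<Rightarrow> 'd)"

definition init_config :: "('x, 'd, 'q, 'b, 's) qdas \<Rightarrow> ('x, 'd, 'q, 'b, 's) config" where
  "init_config A =
     (\<lparr>tasks = {0}, fifo = (\<lambda>_. []), block_of = (\<lambda>_. main A), queue_of = (\<lambda>_. None),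
       state_of = (\<lambda>_. init_state A (main A)), waits = {}\<rparr>,
      \<lambda>_. init_val A)"

inductive step ::
  "('x, 'd, 'q, 'b, 's) qdas \<Rightarrow>
   ('x, 'd, 'q, 'b, 's) config \<Rightarrow> ('x, 'd, 'q, 'b, 's) config \<Rightarrow> bool"
  for A where
  guard:
    "\<lbrakk>unblocked_task G v; (state_of G v, Guard as, s') \<in> trans_of A (block_of G v);
      \<forall>a \<in> set as. atom_holds val a\<rbrakk>
     \<Longrightarrow> step A (G, val) (move v s' G, val)"
| assign:
    "\<lbrakk>unblocked_task G v; (state_of G v, Assign x d, s') \<in> trans_of A (block_of G v)\<rbrakk>
     \<Longrightarrow> step A (G, val) (move v s' G, val(x := d))"
| dispatch_async:
    "\<lbrakk>unblocked_task G v; (state_of G v, DispatchA q \<gamma>, s') \<in> trans_of A (block_of G v);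
      w \<notin> verts G\<rbrakk>
     \<Longrightarrow> step A (G, val) (enqueue A q \<gamma> w (move v s' G), val)"
| dispatch_sync:
    "\<lbrakk>unblocked_task G v; (state_of G v, DispatchS q \<gamma>, s') \<in> trans_of A (block_of G v);
      w \<notin> verts G; G' = enqueue A q \<gamma> w (move v s' G)\<rbrakk>
     \<Longrightarrow> step A (G, val) (G'\<lparr>waits := insert (v, w) (waits G')\<rparr>, val)"
| terminate:
    "\<lbrakk>unblocked_task G v; state_of G v = final_state A (block_of G v)\<rbrakk>
     \<Longrightarrow> step A (G, val)
           (G\<lparr>tasks := tasks G - {v}, waits := {(u, w) \<in> waits G. w \<noteq> v}\<rparr>, val)"
| dequeue_concurrent:
    "\<lbrakk>q \<in> cqid A; fifo G q = w # ws\<rbrakk>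
     \<Longrightarrow> step A (G, val) (G\<lparr>tasks := insert w (tasks G), fifo := (fifo G)(q := ws)\<rparr>, val)"
| dequeue_serial:
    "\<lbrakk>q \<in> sqid A; fifo G q = w # ws; \<forall>v \<in> tasks G. queue_of G v \<noteq> Some q\<rbrakk>
     \<Longrightarrow> step A (G, val) (G\<lparr>tasks := insert w (tasks G), fifo := (fifo G)(q := ws)\<rparr>, val)"

definition reachable ::
  "('x, 'd, 'q, 'b, 's) qdas \<Rightarrow> ('x, 'd, 'q, 'b, 's) config \<Rightarrow> bool" where
  "reachable A c \<longleftrightarrow> (step A)\<^sup>*\<^sup>* (init_config A) c"

definition parikh :: "('q, 'b, 's) ctgraph \<Rightarrow> 's \<Rightarrow> nat" where
  "parikh G s = card {v \<in> verts G. state_of G v = s}"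

definition parikh_coverable :: "('x, 'd, 'q, 'b, 's) qdas \<Rightarrow> ('s \<Rightarrow> nat) \<Rightarrow> bool" where
  "parikh_coverable A f \<longleftrightarrow>
     (\<exists>G val. reachable A (G, val) \<and> (\<forall>s \<in> all_states A. f s \<le> parikh G s))"


section \<open>Decidability\<close>

(* Programs for the partial recursive functions. rec_eval p xs y: p halts on the arguments xs
   with result y. Mu minimises, and PrimRec recurses, over the first argument. *)
datatype recf =
    Zero
  | Succ
  | Proj nat
  | Comp recf "recf list"
  | PrimRec recf recf
  | Mu recf

inductive rec_eval :: "recf \<Rightarrow> nat list \<Rightarrow> nat \<Rightarrow> bool" where
  zero: "rec_eval Zero xs 0"
| succ: "rec_eval Succ [x] (Suc x)"
| proj: "i < length xs \<Longrightarrow> rec_eval (Proj i) xs (xs ! i)"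
| comp:
    "\<lbrakk>length ys = length gs; \<forall>i < length gs. rec_eval (gs ! i) xs (ys ! i); rec_eval f ys z\<rbrakk>
     \<Longrightarrow> rec_eval (Comp f gs) xs z"
| primrec_0: "rec_eval f xs y \<Longrightarrow> rec_eval (PrimRec f g) (0 # xs) y"
| primrec_Suc:
    "\<lbrakk>rec_eval (PrimRec f g) (n # xs) y; rec_eval g (n # y # xs) z\<rbrakk>
     \<Longrightarrow> rec_eval (PrimRec f g) (Suc n # xs) z"
| mu:
    "\<lbrakk>rec_eval f (n # xs) 0; \<forall>i < n. \<exists>y. rec_eval f (i # xs) (Suc y)\<rbrakk>
     \<Longrightarrow> rec_eval (Mu f) xs n"

lemma rec_eval_deterministic: "\<lbrakk>rec_eval p xs y; rec_eval p xs z\<rbrakk> \<Longrightarrow> y = z"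
proof (induction arbitrary: z rule: rec_eval.induct)
  case (zero xs)
  then show ?case by (cases rule: rec_eval.cases) simp
next
  case (succ x)
  then show ?case by (cases rule: rec_eval.cases) simp
next
  case (proj i xs)
  from proj.prems show ?case by (cases rule: rec_eval.cases) simp
next
  case (comp ys gs xs f y)
  from comp.prems obtain ys' where
    ys': "length ys' = length gs" "\<forall>i < length gs. rec_eval (gs ! i) xs (ys' ! i)" "rec_eval f ys' z"
    by (cases rule: rec_eval.cases) simp
  have "ys = ys'"
    using comp.hyps(1) comp.IH(1) ys'(1,2) by (intro nth_equalityI) simp_all
  then show ?case
    using comp.IH(2) ys'(3) by blast
next
  case (primrec_0 f xs y g)
  from primrec_0.prems have "rec_eval f xs z"
    by (cases rule: rec_eval.cases) simp
  then show ?case by (rule primrec_0.IH)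
next
  case (primrec_Suc f g n xs y z')
  from primrec_Suc.prems obtain y' where
    "rec_eval (PrimRec f g) (n # xs) y'" "rec_eval g (n # y' # xs) z"
    by (cases rule: rec_eval.cases) simp
  then show ?case
    using primrec_Suc.IH by blast
next
  case (mu f n xs)
  from mu.prems have
    z: "rec_eval f (z # xs) 0 \<and> (\<forall>i < z. \<exists>y. rec_eval f (i # xs) (Suc y))"
    by (cases rule: rec_eval.cases) simp
  have "\<not> n < z"
    using mu.IH(1) z by (metis nat.distinct(1))
  moreover have "\<not> z < n"
    using mu.IH(2) z by (metis nat.distinct(1))
  ultimately show ?case by simp
qed

(* The problem "given x in D, does P x hold?", the input x being presented as the number code x.
   The program may do anything on numbers that are not the code of an element of D. *)
definition decidable_problem :: "'a set \<Rightarrow> ('a \<Rightarrow> nat) \<Rightarrow> ('a \<Rightarrow> bool) \<Rightarrow> bool" where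
  "decidable_problem D code P \<longleftrightarrow>
     (\<exists>p. \<forall>x \<in> D. rec_eval p [code x] (if P x then 1 else 0))"


section \<open>Problem instances as natural numbers\<close>

(* The input of a decision procedure is a finite description, so here all names (of values,
   variables, queues, blocks, states) are natural numbers. *)
type_synonym nat_qdas = "(nat, nat, nat, nat, nat) qdas"

fun atom_code :: "(nat, nat) atom \<Rightarrow> nat" where
  "atom_code (Eq x d) = list_encode [0, x, d]"
| "atom_code (Neq x d) = list_encode [1, x, d]"

fun action_code :: "(nat, nat, nat, nat) action \<Rightarrow> nat" where
  "action_code (DispatchA q \<gamma>) = list_encode [0, q, \<gamma>]"
| "action_code (DispatchS q \<gamma>) = list_encode [1, q, \<gamma>]"
| "action_code (Guard as) = list_encode [2, list_encode (map atom_code as)]"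
| "action_code (Assign x d) = list_encode [3, x, d]"

fun transition_code :: "nat \<times> (nat, nat, nat, nat) action \<times> nat \<Rightarrow> nat" where
  "transition_code (s, a, s') = list_encode [s, action_code a, s']"

definition block_code :: "nat_qdas \<Rightarrow> nat \<Rightarrow> nat" where
  "block_code A \<gamma> = list_encode
     [\<gamma>, set_encode (states A \<gamma>), init_state A \<gamma>, final_state A \<gamma>,
      set_encode (transition_code ` trans_of A \<gamma>)]"

definition qdas_code :: "nat_qdas \<Rightarrow> nat" where
  "qdas_code A = list_encode
     [set_encode (dom_of A), init_val A, set_encode (vars A), set_encode (cqid A),
      set_encode (sqid A), main A, set_encode (block_code A ` blocks A)]"

definition instance_code :: "nat_qdas \<times> (nat \<Rightarrow> nat) \<Rightarrow> nat" where
  "instance_code = (\<lambda>(A, f).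
     list_encode [qdas_code A, set_encode ((\<lambda>s. prod_encode (s, f s)) ` all_states A)])"

lemma inj_atom_code: "inj atom_code"
proof (rule injI)
  show "a = b" if "atom_code a = atom_code b" for a b
    using that by (cases a; cases b) (simp_all del: list_encode.simps add: list_encode_eq)
qed

lemma inj_action_code: "inj action_code"
proof (rule injI)
  show "a = b" if "action_code a = action_code b" for a b
    using that by (cases a; cases b)
      (simp_all del: list_encode.simps add: list_encode_eq inj_map_eq_map[OF inj_atom_code])
qed

lemma inj_transition_code: "inj transition_code"
proof (rule injI)
  show "t = u" if "transition_code t = transition_code u" for t u
    using that by (cases t; cases u)
      (simp del: list_encode.simps add: list_encode_eq inj_eq[OF inj_action_code])
qed

(* The code determines the instance, up to the values of the functions outside blocks and
   states. *)
lemma instance_code_inject: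
  assumes "qdas_wf A" "qdas_wf B" and eq: "instance_code (A, f) = instance_code (B, g)"
  shows "dom_of A = dom_of B" "init_val A = init_val B" "vars A = vars B"
    "cqid A = cqid B" "sqid A = sqid B" "main A = main B" "blocks A = blocks B"
    "\<forall>\<gamma> \<in> blocks A. states A \<gamma> = states B \<gamma> \<and> init_state A \<gamma> = init_state B \<gamma> \<and>
       final_state A \<gamma> = final_state B \<gamma> \<and> trans_of A \<gamma> = trans_of B \<gamma>"
    "\<forall>s \<in> all_states A. f s = g s"
proof -
  note wfs = assms(1,2)[unfolded qdas_wf_def]
  have set_eq: "X = Y" if "set_encode X = set_encode Y" "finite X" "finite Y" for X Y
    using that inj_on_set_encode by (auto dest: inj_onD)
  note list_simps = list_encode_eq
  have q: "qdas_code A = qdas_code B" and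
    f: "set_encode ((\<lambda>s. prod_encode (s, f s)) ` all_states A) =
        set_encode ((\<lambda>s. prod_encode (s, g s)) ` all_states B)"
    using eq by (simp_all del: list_encode.simps add: instance_code_def list_simps)
  have fin_all: "finite (all_states A)" "finite (all_states B)"
    using wfs by (auto simp: all_states_def)
  show "dom_of A = dom_of B" "init_val A = init_val B" "vars A = vars B"
    "cqid A = cqid B" "sqid A = sqid B" "main A = main B"
    using q wfs
    by (simp_all del: list_encode.simps add: qdas_code_def list_simps set_eq)
  have "set_encode (block_code A ` blocks A) = set_encode (block_code B ` blocks B)"
    using q by (simp del: list_encode.simps add: qdas_code_def list_simps)
  then have img: "block_code A ` blocks A = block_code B ` blocks B"
    using wfs by (intro set_eq) auto
  have name: "\<gamma> = \<delta>" if "block_code A \<gamma> = block_code B \<delta>" for \<gamma> \<delta>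
    using that by (simp del: list_encode.simps add: block_code_def list_simps)
  have code: "\<gamma> \<in> blocks B \<and> block_code A \<gamma> = block_code B \<gamma>" if "\<gamma> \<in> blocks A" for \<gamma>
  proof -
    from that img obtain \<delta> where "\<delta> \<in> blocks B" "block_code A \<gamma> = block_code B \<delta>"
      by (metis imageE imageI)
    with name[of \<gamma> \<delta>] show ?thesis by simp
  qed
  have "\<gamma> \<in> blocks A" if "\<gamma> \<in> blocks B" for \<gamma>
  proof -
    from that img obtain \<delta> where "\<delta> \<in> blocks A" "block_code B \<gamma> = block_code A \<delta>"
      by (metis imageE imageI)
    with name[of \<delta> \<gamma>] show ?thesis by simp
  qed
  with code show blocks: "blocks A = blocks B" by blast
  show comps: "\<forall>\<gamma> \<in> blocks A. states A \<gamma> = states B \<gamma> \<and> init_state A \<gamma> = init_state B \<gamma> \<and>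
       final_state A \<gamma> = final_state B \<gamma> \<and> trans_of A \<gamma> = trans_of B \<gamma>"
  proof
    fix \<gamma> assume "\<gamma> \<in> blocks A"
    with code blocks have \<gamma>: "\<gamma> \<in> blocks A" "\<gamma> \<in> blocks B" "block_code A \<gamma> = block_code B \<gamma>"
      by auto
    have fin: "finite (states A \<gamma>)" "finite (states B \<gamma>)" "finite (trans_of A \<gamma>)"
      "finite (trans_of B \<gamma>)"
      using \<gamma>(1,2) wfs by auto
    have *: "set_encode (states A \<gamma>) = set_encode (states B \<gamma>)"
      "init_state A \<gamma> = init_state B \<gamma>" "final_state A \<gamma> = final_state B \<gamma>"
      "set_encode (transition_code ` trans_of A \<gamma>) = set_encode (transition_code ` trans_of B \<gamma>)"
      using \<gamma>(3) by (simp_all del: list_encode.simps add: block_code_def list_simps)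
    have "transition_code ` trans_of A \<gamma> = transition_code ` trans_of B \<gamma>"
      using *(4) fin by (intro set_eq) auto
    then have "trans_of A \<gamma> = trans_of B \<gamma>"
      by (simp add: inj_image_eq_iff[OF inj_transition_code])
    moreover have "states A \<gamma> = states B \<gamma>"
      using *(1) fin by (intro set_eq)
    ultimately show "states A \<gamma> = states B \<gamma> \<and> init_state A \<gamma> = init_state B \<gamma> \<and>
       final_state A \<gamma> = final_state B \<gamma> \<and> trans_of A \<gamma> = trans_of B \<gamma>"
      using *(2,3) by blast
  qed
  have fimg: "(\<lambda>s. prod_encode (s, f s)) ` all_states A = (\<lambda>s. prod_encode (s, g s)) ` all_states B"
    using f fin_all by (intro set_eq) auto
  show "\<forall>s \<in> all_states A. f s = g s"
  proof
    fix s assume "s \<in> all_states A"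
    then have "prod_encode (s, f s) \<in> (\<lambda>s. prod_encode (s, g s)) ` all_states B"
      using fimg by blast
    then show "f s = g s" by (auto simp: prod_encode_eq)
  qed
qed

end

theory Submission
  imports Defs "HOL-Library.Countable"
begin

text \<open>
  Synchronous dispatches turn a task into a stack: a chain of waiting tasks of length \<open>v\<close> represents the
  value \<open>v\<close> of a register, a call pushes, a termination pops, and the bottom task knows that it is the
  bottom one, which gives a zero test. Asynchronous dispatches provide one such chain per register,
  and a shared variable holding the current label makes the chains act in turn. So concurrent QDAS
  simulate counter machines, and the halting label is visible as the coverage of a single state.

  Undecidability then follows by diagonalisation. The input \<open>n\<close> is loaded by a chain of \<open>n\<close> synchronous
  dispatches in the main block, and nothing else in the automaton depends on \<open>n\<close>. Hence the code of the
  instance is a recursive function of \<open>n\<close> and three numbers describing the machine. Given a decision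
  procedure, take the machine that reads these three numbers off its input \<open>n\<close>, computes the code of
  the instance with input \<open>n\<close>, and halts iff the procedure answers no. Run on the numbers that describe
  itself, it halts iff it does not.
\<close>


section \<open>Closure properties of the recursive functions\<close>

text \<open>Two demands conflict: the input must be part of the instance, and the code of the
  instance must be a computable function of the input. \<open>set_encode\<close> is a sum of powers
  of 2, hence additive over disjoint sets. The states \<open>Ctl j\<close> of \<open>main\<close>
  get the even codes \<open>2 * j\<close>, all others odd codes, and block codes differ because they
  contain the block's name; so every set code that depends on \<open>n\<close> is an explicit
  expression in \<open>n\<close>, possibly plus a constant of the machine. The program is fixed
  before these constants exist: it receives them through its input instead of containing them, which
  reduces self-reference to the choice of the input. The delicate direction of the simulation is
  that coverage implies halting, since threads interleave freely. The interleaving is harmless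
  because the variable names one label, hence at most one register whose chain can leave its idle
  shape, and because it changes only when no instruction remains half done.\<close>

definition recfun :: "nat \<Rightarrow> (nat list \<Rightarrow> nat) \<Rightarrow> bool" where
  "recfun k f \<longleftrightarrow> (\<exists>p. \<forall>xs. length xs = k \<longrightarrow> rec_eval p xs (f xs))"

lemma recfun_cong:
  assumes "recfun k f" "\<And>xs. length xs = k \<Longrightarrow> f xs = g xs"
  shows "recfun k g"
  using assms unfolding recfun_def by fastforce

lemma recfun_proj: "i < k \<Longrightarrow> recfun k (\<lambda>xs. xs ! i)"
  unfolding recfun_def by (metis rec_eval.proj)

lemma recfun_comp:
  assumes f: "recfun (length gs) f" and gs: "\<forall>g \<in> set gs. recfun k g"
  shows "recfun k (\<lambda>xs. f (map (\<lambda>g. g xs) gs))"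
proof -
  obtain p where p: "\<And>xs. length xs = length gs \<Longrightarrow> rec_eval p xs (f xs)"
    using f unfolding recfun_def by auto
  obtain h where h: "\<forall>g \<in> set gs. \<forall>xs. length xs = k \<longrightarrow> rec_eval (h g) xs (g xs)"
    using gs unfolding recfun_def by metis
  have "rec_eval (Comp p (map h gs)) xs (f (map (\<lambda>g. g xs) gs))" if "length xs = k" for xs
    by (rule rec_eval.comp[where ys = "map (\<lambda>g. g xs) gs"]) (use h that p in auto)
  then show ?thesis unfolding recfun_def by blast
qed

lemma recfun_Suc:
  assumes "recfun k f" shows "recfun k (\<lambda>xs. Suc (f xs))"
proof -
  have "recfun (length [f]) (\<lambda>xs. Suc (xs ! 0))"
    unfolding recfun_def
    by (rule exI[of _ Succ]) (auto simp: length_Suc_conv intro: rec_eval.succ)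
  from recfun_comp[OF this] assms show ?thesis by simp
qed

lemma recfun_const: "recfun k (\<lambda>_. c)"
proof (induction c)
  case 0
  show ?case unfolding recfun_def by (blast intro: rec_eval.zero)
qed (rule recfun_Suc)

text \<open>\<open>PrimRec\<close> takes its counter as the first argument. Composition with
  \<open>h\<close> followed by all projections lets the counter be computed from the
  parameters.\<close>

lemma recfun_rec:
  assumes f: "recfun k f" and g: "recfun (Suc (Suc k)) g" and h: "recfun k h"
  shows "recfun k (\<lambda>xs. rec_nat (f xs) (\<lambda>n y. g (n # y # xs)) (h xs))"
proof -
  obtain p where p: "\<And>xs. length xs = k \<Longrightarrow> rec_eval p xs (f xs)"
    using f unfolding recfun_def by auto
  obtain q where q: "\<And>xs. length xs = Suc (Suc k) \<Longrightarrow> rec_eval q xs (g xs)"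
    using g unfolding recfun_def by auto
  let ?gs = "h # map (\<lambda>i xs. xs ! i) [0..<k]"
  have rec: "rec_eval (PrimRec p q) (n # xs) (rec_nat (f xs) (\<lambda>n y. g (n # y # xs)) n)"
    if "length xs = k" for n xs
    using that by (induction n) (auto intro!: rec_eval.primrec_0 p rec_eval.primrec_Suc q)
  have "recfun (length ?gs) (\<lambda>zs. rec_nat (f (tl zs)) (\<lambda>n y. g (n # y # tl zs)) (hd zs))"
    unfolding recfun_def by (rule exI[of _ "PrimRec p q"]) (auto simp: length_Suc_conv intro: rec)
  moreover have "\<forall>g' \<in> set ?gs. recfun k g'"
    using h by (auto intro: recfun_proj)
  ultimately show ?thesis
  proof (rule recfun_cong[OF recfun_comp])
    fix xs :: "nat list" assume "length xs = k"
    then have "map (\<lambda>g'. g' xs) ?gs = h xs # xs"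
      using map_nth[of xs] by (simp add: comp_def)
    then show "rec_nat (f (tl (map (\<lambda>g'. g' xs) ?gs))) (\<lambda>n y. g (n # y # tl (map (\<lambda>g'. g' xs) ?gs)))
        (hd (map (\<lambda>g'. g' xs) ?gs)) = rec_nat (f xs) (\<lambda>n y. g (n # y # xs)) (h xs)"
      by (simp only: list.sel)
  qed
qed

lemma recfun_add:
  assumes "recfun k f" "recfun k g"
  shows "recfun k (\<lambda>xs. f xs + g xs)"
proof -
  have "recfun (Suc (Suc k)) (\<lambda>zs. Suc (zs ! 1))"
    by (intro recfun_Suc recfun_proj) simp
  from recfun_rec[OF assms(1) this assms(2)] show ?thesis
  proof (rule recfun_cong)
    have "rec_nat m (\<lambda>n y. Suc y) j = m + j" for m j by (induction j) auto
    then show "rec_nat (f xs) (\<lambda>n y. Suc ((n # y # xs) ! 1)) (g xs) = f xs + g xs" for xs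
      by simp
  qed
qed

lemma recfun_diff:
  assumes "recfun k f" "recfun k g"
  shows "recfun k (\<lambda>xs. f xs - g xs)"
proof -
  \<comment> \<open>A recursion whose step returns the counter and ignores the previous value is the
    predecessor; iterating it gives truncated subtraction.\<close>
  have pred: "recfun k (\<lambda>xs. h xs - 1)" if h: "recfun k h" for h k
  proof -
    have "recfun (Suc (Suc k)) (\<lambda>zs. zs ! 0)"
      by (intro recfun_proj) simp
    from recfun_rec[OF recfun_const[of k 0] this h] show ?thesis
    proof (rule recfun_cong)
      have "rec_nat 0 (\<lambda>n y. n) j = j - 1" for j :: nat by (cases j) auto
      then show "rec_nat 0 (\<lambda>n y. (n # y # xs) ! 0) (h xs) = h xs - 1" for xs
        by simp
    qed
  qed
  have "recfun (Suc (Suc k)) (\<lambda>zs. zs ! 1 - 1)"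
    by (intro pred recfun_proj) simp
  from recfun_rec[OF assms(1) this assms(2)] show ?thesis
  proof (rule recfun_cong)
    have "rec_nat m (\<lambda>n y. y - 1) j = m - j" for m j :: nat by (induction j) auto
    then show "rec_nat (f xs) (\<lambda>n y. (n # y # xs) ! 1 - 1) (g xs) = f xs - g xs" for xs
      by simp
  qed
qed

lemma recfun_power2:
  assumes "recfun k f"
  shows "recfun k (\<lambda>xs. 2 ^ f xs)"
proof -
  have "recfun (Suc (Suc k)) (\<lambda>zs. zs ! 1 + zs ! 1)"
    by (intro recfun_add recfun_proj) simp_all
  from recfun_rec[OF recfun_const[of k 1] this assms] show ?thesis
  proof (rule recfun_cong)
    have "rec_nat 1 (\<lambda>n y. y + y) j = (2::nat) ^ j" for j :: nat by (induction j) auto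
    then show "rec_nat 1 (\<lambda>n y. (n # y # xs) ! 1 + (n # y # xs) ! 1) (f xs) = 2 ^ f xs" for xs
      by simp
  qed
qed

lemma recfun_sum:
  assumes f: "recfun 1 (\<lambda>xs. f (xs ! 0))" and h: "recfun k h"
  shows "recfun k (\<lambda>xs. \<Sum>j<h xs. f j)"
proof -
  have "recfun (Suc (Suc k)) (\<lambda>zs. zs ! 1 + f (zs ! 0))"
    using recfun_comp[of "[\<lambda>zs. zs ! 0]" "\<lambda>xs. f (xs ! 0)" "Suc (Suc k)"] f
    by (intro recfun_add recfun_proj) (simp_all add: recfun_proj)
  from recfun_rec[OF recfun_const[of k 0] this h] show ?thesis
  proof (rule recfun_cong)
    have "rec_nat 0 (\<lambda>n y. y + f n) j = sum f {..<j}" for j :: nat by (induction j) auto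
    then show "rec_nat 0 (\<lambda>n y. (n # y # xs) ! 1 + f ((n # y # xs) ! 0)) (h xs) = sum f {..<h xs}" for xs
      by simp
  qed
qed

lemma recfun_triangle:
  assumes "recfun k f"
  shows "recfun k (\<lambda>xs. triangle (f xs))"
proof -
  have "recfun 1 (\<lambda>xs. Suc (xs ! 0))"
    by (intro recfun_Suc recfun_proj) simp
  from recfun_sum[OF this assms] show ?thesis
  proof (rule recfun_cong)
    have "(\<Sum>j<n. Suc j) = triangle n" for n by (induction n) auto
    then show "(\<Sum>j<f xs. Suc j) = triangle (f xs)" for xs .
  qed
qed

lemma recfun_prod_encode:
  assumes "recfun k f" "recfun k g"
  shows "recfun k (\<lambda>xs. prod_encode (f xs, g xs))"
  using assms unfolding prod_encode_def prod.case by (intro recfun_add recfun_triangle)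

section \<open>Minimisation and the inverse of the pairing function\<close>

lemma recfun_Least:
  assumes f: "recfun (Suc k) f" and ex: "\<And>xs. length xs = k \<Longrightarrow> \<exists>n. f (n # xs) = 0"
  shows "recfun k (\<lambda>xs. LEAST n. f (n # xs) = 0)"
proof -
  obtain p where p: "\<And>xs. length xs = Suc k \<Longrightarrow> rec_eval p xs (f xs)"
    using f unfolding recfun_def by auto
  have "rec_eval (Mu p) xs (LEAST n. f (n # xs) = 0)" if xs: "length xs = k" for xs
  proof (rule rec_eval.mu)
    show "rec_eval p ((LEAST n. f (n # xs) = 0) # xs) 0"
      using p[of "(LEAST n. f (n # xs) = 0) # xs"] LeastI_ex[OF ex[OF xs]] xs by simp
    show "\<forall>i < LEAST n. f (n # xs) = 0. \<exists>y. rec_eval p (i # xs) (Suc y)"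
    proof (intro allI impI)
      fix i assume "i < (LEAST n. f (n # xs) = 0)"
      then have "f (i # xs) \<noteq> 0" by (rule not_less_Least)
      then obtain y where "f (i # xs) = Suc y" using not0_implies_Suc by blast
      with p[of "i # xs"] xs show "\<exists>y. rec_eval p (i # xs) (Suc y)" by auto
    qed
  qed
  then show ?thesis unfolding recfun_def by blast
qed

lemma triangle_mono: "m \<le> n \<Longrightarrow> triangle m \<le> triangle n"
  by (induction rule: dec_induct) auto

text \<open>\<open>prod_encode (a, b)\<close> is \<open>triangle (a + b) + a\<close>, which lies
  below \<open>triangle (Suc (a + b))\<close>. So \<open>a + b\<close> is the least \<open>s\<close>
  whose next triangular number exceeds the code. Truncated subtraction turns this inequality into an
  equation with 0, the form that \<open>Mu\<close> searches for.\<close>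

lemma Least_triangle: "(LEAST s. Suc (prod_encode (a, b)) - triangle (Suc s) = 0) = a + b"
proof (rule Least_equality)
  show "Suc (prod_encode (a, b)) - triangle (Suc (a + b)) = 0"
    by (simp add: prod_encode_def)
  show "a + b \<le> s" if "Suc (prod_encode (a, b)) - triangle (Suc s) = 0" for s
  proof (rule ccontr)
    assume "\<not> a + b \<le> s"
    then have "triangle (Suc s) \<le> triangle (a + b)" by (intro triangle_mono) simp
    with that show False by (simp add: prod_encode_def)
  qed
qed

text \<open>Once \<open>a + b\<close> is known, removing its triangular number leaves
  \<open>a\<close>, and \<open>b\<close> is the rest of the sum.\<close>

lemma
  assumes f: "recfun k f"
  shows recfun_fst_prod_decode: "recfun k (\<lambda>xs. fst (prod_decode (f xs)))"
    and recfun_snd_prod_decode: "recfun k (\<lambda>xs. snd (prod_decode (f xs)))"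
proof -
  define s where "s n = (LEAST s. Suc n - triangle (Suc s) = 0)" for n
  have ex: "\<exists>s. Suc n - triangle (Suc s) = 0" for n
  proof -
    obtain a b where "n = prod_encode (a, b)"
      by (metis prod_decode_inverse surj_pair)
    then have "Suc n - triangle (Suc (a + b)) = 0"
      by (simp add: prod_encode_def)
    then show ?thesis ..
  qed
  have "recfun (Suc 1) (\<lambda>zs. Suc (zs ! 1) - triangle (Suc (zs ! 0)))"
    by (intro recfun_diff recfun_Suc recfun_triangle recfun_proj) simp_all
  from recfun_Least[OF this] ex have "recfun 1 (\<lambda>xs. s (xs ! 0))"
    unfolding s_def by simp
  with recfun_comp[of "[f]" "\<lambda>xs. s (xs ! 0)" k] f have s: "recfun k (\<lambda>xs. s (f xs))"
    by simp
  have s_eq: "s (prod_encode (a, b)) = a + b" for a b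
    unfolding s_def by (rule Least_triangle)
  have eq: "fst (prod_decode n) = n - triangle (s n)"
    "snd (prod_decode n) = s n - (n - triangle (s n))" for n
  proof -
    obtain a b where n: "n = prod_encode (a, b)"
      by (metis prod_decode_inverse surj_pair)
    show "fst (prod_decode n) = n - triangle (s n)" "snd (prod_decode n) = s n - (n - triangle (s n))"
      unfolding n s_eq prod_encode_inverse by (simp_all add: prod_encode_def)
  qed
  show "recfun k (\<lambda>xs. fst (prod_decode (f xs)))" "recfun k (\<lambda>xs. snd (prod_decode (f xs)))"
    unfolding eq by (intro recfun_diff recfun_triangle f s)+
qed

lemma recfun_list_encode_Nil: "recfun k (\<lambda>_. list_encode [])"
  by (rule recfun_const)

lemma recfun_list_encode_Cons:
  assumes "recfun k f" "recfun k (\<lambda>xs. list_encode (g xs))"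
  shows "recfun k (\<lambda>xs. list_encode (f xs # g xs))"
  using assms by (simp add: recfun_Suc recfun_prod_encode)

lemmas recfun_intros = recfun_list_encode_Nil recfun_list_encode_Cons recfun_const recfun_Suc
  recfun_add recfun_diff recfun_power2 recfun_prod_encode recfun_fst_prod_decode
  recfun_snd_prod_decode

section \<open>Loop programs\<close>

text \<open>\<open>CLoop r P\<close> repeats: stop if \<open>r\<close> is 0, otherwise decrement
  \<open>r\<close> and run \<open>P\<close>. Test and decrement form one step, so that each step is
  a single counter machine instruction.\<close>

datatype com = CInc nat | CLoop nat "com list"

inductive cstep :: "com list \<times> (nat \<Rightarrow> nat) \<Rightarrow> com list \<times> (nat \<Rightarrow> nat) \<Rightarrow> bool" where
  inc: "cstep (CInc r # K, \<sigma>) (K, \<sigma>(r := Suc (\<sigma> r)))"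
| exit: "\<sigma> r = 0 \<Longrightarrow> cstep (CLoop r P # K, \<sigma>) (K, \<sigma>)"
| enter: "\<sigma> r = Suc m \<Longrightarrow> cstep (CLoop r P # K, \<sigma>) (P @ CLoop r P # K, \<sigma>(r := m))"

text \<open>Quantifying over the continuation \<open>K\<close> makes the relation
  compositional.\<close>

definition runs :: "com list \<Rightarrow> (nat \<Rightarrow> nat) \<Rightarrow> (nat \<Rightarrow> nat) \<Rightarrow> bool" where
  "runs P \<sigma> \<sigma>' \<longleftrightarrow> (\<forall>K. cstep\<^sup>*\<^sup>* (P @ K, \<sigma>) (K, \<sigma>'))"

lemma runs_Nil: "runs [] \<sigma> \<sigma>"
  by (simp add: runs_def)

lemma runs_append: "runs P \<sigma> \<sigma>' \<Longrightarrow> runs Q \<sigma>' \<sigma>'' \<Longrightarrow> runs (P @ Q) \<sigma> \<sigma>''"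
  unfolding runs_def append_assoc by (meson rtranclp_trans)

lemma runs_Cons: "runs [c] \<sigma> \<sigma>' \<Longrightarrow> runs Q \<sigma>' \<sigma>'' \<Longrightarrow> runs (c # Q) \<sigma> \<sigma>''"
  using runs_append[of "[c]"] by simp

lemma runs_inc: "runs [CInc r] \<sigma> (\<sigma>(r := Suc (\<sigma> r)))"
  by (simp add: runs_def cstep.inc r_into_rtranclp)

lemma runs_exit: "\<sigma> r = 0 \<Longrightarrow> runs [CLoop r P] \<sigma> \<sigma>"
  by (simp add: runs_def cstep.exit r_into_rtranclp)

lemma runs_enter:
  assumes "\<sigma> r = Suc m" "runs P (\<sigma>(r := m)) \<sigma>'" "runs [CLoop r P] \<sigma>' \<sigma>''"
  shows "runs [CLoop r P] \<sigma> \<sigma>''"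
  unfolding runs_def
proof
  fix K
  have "cstep ([CLoop r P] @ K, \<sigma>) (P @ CLoop r P # K, \<sigma>(r := m))"
    using assms(1) by (simp add: cstep.enter)
  also have "cstep\<^sup>*\<^sup>* \<dots> (CLoop r P # K, \<sigma>')"
    using assms(2) by (simp add: runs_def)
  also have "cstep\<^sup>*\<^sup>* \<dots> (K, \<sigma>'')"
    using assms(3) by (simp add: runs_def)
  finally show "cstep\<^sup>*\<^sup>* ([CLoop r P] @ K, \<sigma>) (K, \<sigma>'')" .
qed

text \<open>\<open>s i\<close> is the register contents before round \<open>i\<close>. The body
  starts with \<open>r\<close> already decremented, hence \<open>n - Suc i\<close>.\<close>

lemma runs_loop:
  assumes "\<And>i. i < n \<Longrightarrow> s i r = n - i" "s n r = 0"
    and body: "\<And>i. i < n \<Longrightarrow> runs P ((s i)(r := n - Suc i)) (s (Suc i))"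
  shows "runs [CLoop r P] (s 0) (s n)"
proof -
  have "runs [CLoop r P] (s i) (s n)" if "i \<le> n" for i
    using that
  proof (induction rule: inc_induct)
    case base
    show ?case using assms(2) by (rule runs_exit)
  next
    case (step i)
    show ?case
      by (rule runs_enter[OF _ body[OF step.hyps(2)] step.IH])
        (use assms(1)[OF step.hyps(2)] step.hyps(2) in auto)
  qed
  then show ?thesis by simp
qed

section \<open>Clearing, moving and copying registers\<close>

lemma runs_clear: "runs [CLoop r []] \<sigma> (\<sigma>(r := 0))"
  using runs_loop[of "\<sigma> r" "\<lambda>i. \<sigma>(r := \<sigma> r - i)" r "[]"] by (simp add: runs_Nil)

lemma runs_clears: "runs (map (\<lambda>r. CLoop r []) rs) \<sigma> (\<lambda>r. if r \<in> set rs then 0 else \<sigma> r)"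
proof (induction rs arbitrary: \<sigma>)
  case (Cons r rs)
  show ?case
    by (simp, rule runs_Cons[OF runs_clear], rule back_subst[of "runs _ _", OF Cons.IH]) auto
qed (simp add: runs_Nil)

lemma runs_move:
  assumes "i \<noteq> out"
  shows "runs [CLoop i [CInc out]] \<sigma> (\<sigma>(out := \<sigma> out + \<sigma> i, i := 0))"
proof -
  have "runs [CLoop i [CInc out]] (\<sigma>(out := \<sigma> out + 0, i := \<sigma> i - 0))
    (\<sigma>(out := \<sigma> out + \<sigma> i, i := \<sigma> i - \<sigma> i))"
    by (rule runs_loop[of "\<sigma> i" "\<lambda>j. \<sigma>(out := \<sigma> out + j, i := \<sigma> i - j)"])
      (use assms in \<open>auto intro!: back_subst[of "runs _ _", OF runs_inc]\<close>)
  then show ?thesis by simp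
qed

text \<open>Reading a register destroys it, so its value goes to both \<open>out\<close> and
  \<open>t\<close> and is then restored from \<open>t\<close>.\<close>

definition copy :: "nat \<Rightarrow> nat \<Rightarrow> nat \<Rightarrow> com list" where
  "copy i out t = [CLoop i [CInc out, CInc t], CLoop t [CInc i]]"

lemma runs_copy:
  assumes "i \<noteq> out" "i \<noteq> t" "out \<noteq> t" "\<sigma> out = 0" "\<sigma> t = 0"
  shows "runs (copy i out t) \<sigma> (\<sigma>(out := \<sigma> i))"
proof -
  have "runs [CLoop i [CInc out, CInc t]] (\<sigma>(out := 0, t := 0, i := \<sigma> i - 0))
    (\<sigma>(out := \<sigma> i, t := \<sigma> i, i := \<sigma> i - \<sigma> i))"
    by (rule runs_loop[of "\<sigma> i" "\<lambda>j. \<sigma>(out := j, t := j, i := \<sigma> i - j)"])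
      (use assms in \<open>auto intro!: runs_Cons[OF runs_inc] back_subst[of "runs _ _", OF runs_inc]\<close>)
  then have 1: "runs [CLoop i [CInc out, CInc t]] \<sigma> (\<sigma>(out := \<sigma> i, t := \<sigma> i, i := 0))"
    using assms by (simp add: fun_upd_idem)
  have 2: "runs [CLoop t [CInc i]] (\<sigma>(out := \<sigma> i, t := \<sigma> i, i := 0)) (\<sigma>(out := \<sigma> i))"
    by (rule back_subst[of "runs _ _", OF runs_move]) (use assms in auto)
  show ?thesis
    unfolding copy_def using runs_Cons[OF 1 2] .
qed

section \<open>Compilation of recursive functions into loop programs\<close>

text \<open>The registers from \<open>b\<close> on are scratch space. They start at 0, and since
  nothing but \<open>out\<close> changes in total, a subprogram returns them cleared to the next
  one. Nothing is claimed where \<open>p\<close> has no value.\<close>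

definition computes :: "recf \<Rightarrow> nat list \<Rightarrow> nat \<Rightarrow> nat \<Rightarrow> com list \<Rightarrow> bool" where
  "computes p ins out b P \<longleftrightarrow>
     (\<forall>\<sigma> y. rec_eval p (map \<sigma> ins) y \<longrightarrow> (\<forall>r \<ge> b. \<sigma> r = 0) \<longrightarrow> \<sigma> out = 0 \<longrightarrow> runs P \<sigma> (\<sigma>(out := y)))"

lemma computesD:
  "\<lbrakk>computes p ins out b P; rec_eval p (map \<sigma> ins) y; \<forall>r \<ge> b. \<sigma> r = 0; \<sigma> out = 0; \<sigma>' = \<sigma>(out := y)\<rbrakk>
    \<Longrightarrow> runs P \<sigma> \<sigma>'"
  unfolding computes_def by blast

text \<open>The trace \<open>Y\<close> of a primitive recursion supplies the loop invariant of its
  compilation.\<close>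

lemma rec_eval_PrimRec_values:
  assumes "rec_eval (PrimRec f g) (n # xs) y"
  shows "\<exists>Y. rec_eval f xs (Y 0) \<and> Y n = y \<and> (\<forall>j < n. rec_eval g (j # Y j # xs) (Y (Suc j)))"
  using assms
proof (induction n arbitrary: y)
  case 0
  then have "rec_eval f xs y" by (cases rule: rec_eval.cases) simp
  then show ?case by (intro exI[of _ "\<lambda>_. y"]) simp
next
  case (Suc n)
  from Suc.prems obtain z where z: "rec_eval (PrimRec f g) (n # xs) z" "rec_eval g (n # z # xs) y"
    by (cases rule: rec_eval.cases) simp
  from Suc.IH[OF z(1)] obtain Y where
    "rec_eval f xs (Y 0)" "Y n = z" "\<forall>j < n. rec_eval g (j # Y j # xs) (Y (Suc j))"
    by blast
  with z(2) show ?case by (intro exI[of _ "Y(Suc n := y)"]) (auto simp: less_Suc_eq)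
qed

text \<open>The arguments go to the registers from \<open>c\<close> on, and the scratch space starts
  at \<open>b\<close> beyond the last of them, so evaluating a later argument spares the earlier
  results.\<close>

lemma computes_args:
  assumes gs: "\<And>g ins out b. \<lbrakk>g \<in> set gs; set ins \<subseteq> {..<b}; out < b; out \<notin> set ins\<rbrakk>
      \<Longrightarrow> \<exists>P. computes g ins out b P"
    and ins: "set ins \<subseteq> {..<c}" and c: "c + length gs \<le> b"
  shows "\<exists>P. \<forall>\<sigma> ys. length ys = length gs \<longrightarrow>
    (\<forall>i < length gs. rec_eval (gs ! i) (map \<sigma> ins) (ys ! i)) \<longrightarrow>
    (\<forall>r \<ge> c. \<sigma> r = 0) \<longrightarrow>
    runs P \<sigma> (\<lambda>r. if c \<le> r \<and> r < c + length gs then ys ! (r - c) else \<sigma> r)"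
  using gs c
proof (induction gs rule: rev_induct)
  case Nil
  have "(\<lambda>r. if c \<le> r \<and> r < c then [] ! (r - c) else \<sigma> r) = \<sigma>" for \<sigma> :: "nat \<Rightarrow> nat"
    by auto
  then show ?case by (auto intro!: exI[of _ "[]"] runs_Nil simp: fun_eq_iff cong: if_cong)
next
  case (snoc g gs)
  let ?m = "length gs"
  obtain P where P: "\<And>\<sigma> ys. \<lbrakk>length ys = ?m; \<forall>i < ?m. rec_eval (gs ! i) (map \<sigma> ins) (ys ! i);
      \<forall>r \<ge> c. \<sigma> r = 0\<rbrakk> \<Longrightarrow> runs P \<sigma> (\<lambda>r. if c \<le> r \<and> r < c + ?m then ys ! (r - c) else \<sigma> r)"
    using snoc.IH snoc.prems by auto
  have "\<exists>Q. computes g ins (c + ?m) b Q"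
    by (rule snoc.prems(1)) (use snoc.prems(2) ins in auto)
  then obtain Q where Q: "computes g ins (c + ?m) b Q" ..
  show ?case
  proof (intro exI[of _ "P @ Q"] allI impI)
    fix \<sigma> :: "nat \<Rightarrow> nat" and ys
    assume ys: "length ys = length (gs @ [g])"
      and ev: "\<forall>i < length (gs @ [g]). rec_eval ((gs @ [g]) ! i) (map \<sigma> ins) (ys ! i)"
      and zero: "\<forall>r \<ge> c. \<sigma> r = 0"
    let ?\<sigma>1 = "\<lambda>r. if c \<le> r \<and> r < c + ?m then butlast ys ! (r - c) else \<sigma> r"
    have 1: "runs P \<sigma> ?\<sigma>1"
    proof (rule P)
      show "\<forall>i < ?m. rec_eval (gs ! i) (map \<sigma> ins) (butlast ys ! i)"
        using ev ys by (auto simp: nth_butlast nth_append all_conj_distrib less_Suc_eq)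
    qed (use ys zero in auto)
    have ins1: "map ?\<sigma>1 ins = map \<sigma> ins"
      using ins by auto
    have 2: "runs Q ?\<sigma>1 (?\<sigma>1(c + ?m := ys ! ?m))"
      by (rule computesD[OF Q]) (use ev[rule_format, of ?m] zero snoc.prems(2) in \<open>simp_all add: ins1\<close>)
    have "?\<sigma>1(c + ?m := ys ! ?m) = (\<lambda>r. if c \<le> r \<and> r < c + length (gs @ [g]) then ys ! (r - c) else \<sigma> r)"
      using ys by (auto simp: fun_eq_iff nth_butlast)
    with runs_append[OF 1 2] show "runs (P @ Q) \<sigma> \<dots>" by simp
  qed
qed

text \<open>Induction on the function: each case takes the fresh registers it needs from
  \<open>b\<close> on and compiles its subfunctions with a larger \<open>b\<close>.\<close>

lemma computes_ex:
  "\<lbrakk>set ins \<subseteq> {..<b}; out < b; out \<notin> set ins\<rbrakk> \<Longrightarrow> \<exists>P. computes p ins out b P"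
proof (induction p arbitrary: ins out b)
  case Zero
  have "computes Zero ins out b []"
    by (auto simp: computes_def fun_upd_idem runs_Nil elim!: rec_eval.cases)
  then show ?case ..
next
  case Succ
  \<comment> \<open>\<open>Succ\<close> has a value on singletons only, so \<open>hd ins\<close> is
    the right register whenever there is something to compute.\<close>
  have "computes Succ ins out b (copy (hd ins) out b @ [CInc out])"
    unfolding computes_def
  proof (intro allI impI)
    fix \<sigma> :: "nat \<Rightarrow> nat" and y
    assume "rec_eval Succ (map \<sigma> ins) y" and zero: "\<forall>r \<ge> b. \<sigma> r = 0" "\<sigma> out = 0"
    then obtain i where i: "ins = [i]" "y = Suc (\<sigma> i)"
      by (auto elim!: rec_eval.cases)
    have "runs (copy i out b) \<sigma> (\<sigma>(out := \<sigma> i))"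
      using Succ.prems i zero by (intro runs_copy) auto
    from runs_append[OF this runs_inc[of out]]
    show "runs (copy (hd ins) out b @ [CInc out]) \<sigma> (\<sigma>(out := y))"
      using i by simp
  qed
  then show ?case ..
next
  case (Proj j)
  have "computes (Proj j) ins out b (copy (ins ! j) out b)"
    unfolding computes_def
  proof (intro allI impI)
    fix \<sigma> :: "nat \<Rightarrow> nat" and y
    assume "rec_eval (Proj j) (map \<sigma> ins) y" and zero: "\<forall>r \<ge> b. \<sigma> r = 0" "\<sigma> out = 0"
    then have j: "j < length ins" "y = \<sigma> (ins ! j)"
      by (auto elim!: rec_eval.cases)
    then have "ins ! j \<in> set ins" by simp
    with Proj.prems have "ins ! j < b" "ins ! j \<noteq> out" by auto
    with Proj.prems j zero show "runs (copy (ins ! j) out b) \<sigma> (\<sigma>(out := y))"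
      unfolding j(2) by (intro runs_copy) auto
  qed
  then show ?case ..
next
  case (Comp f gs)
  let ?m = "length gs"
  let ?ts = "[b..<b + ?m]"
  have "\<exists>P. computes g ins out b P" if "g \<in> set gs" "set ins \<subseteq> {..<b}" "out < b" "out \<notin> set ins"
    for g ins out b
    using Comp.IH(2) that by blast
  from computes_args[of gs ins b "b + ?m", OF this Comp.prems(1) order_refl] obtain P where
    P: "\<And>\<sigma> ys. \<lbrakk>length ys = ?m; \<forall>i < ?m. rec_eval (gs ! i) (map \<sigma> ins) (ys ! i);
      \<forall>r \<ge> b. \<sigma> r = 0\<rbrakk> \<Longrightarrow> runs P \<sigma> (\<lambda>r. if b \<le> r \<and> r < b + ?m then ys ! (r - b) else \<sigma> r)"
    by auto
  have "\<exists>Q. computes f ?ts out (b + ?m) Q"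
    by (rule Comp.IH(1)) (use Comp.prems in auto)
  then obtain Q where Q: "computes f ?ts out (b + ?m) Q" ..
  have "computes (Comp f gs) ins out b (P @ Q @ map (\<lambda>r. CLoop r []) ?ts)"
    unfolding computes_def
  proof (intro allI impI)
    fix \<sigma> :: "nat \<Rightarrow> nat" and y
    assume ev: "rec_eval (Comp f gs) (map \<sigma> ins) y" and zero: "\<forall>r \<ge> b. \<sigma> r = 0" "\<sigma> out = 0"
    from ev obtain ys where ys: "length ys = ?m"
      "\<forall>i < ?m. rec_eval (gs ! i) (map \<sigma> ins) (ys ! i)" "rec_eval f ys y"
      by (cases rule: rec_eval.cases) simp
    let ?\<sigma>1 = "\<lambda>r. if b \<le> r \<and> r < b + ?m then ys ! (r - b) else \<sigma> r"
    have map: "map ?\<sigma>1 ?ts = ys"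
      using ys(1) by (intro nth_equalityI) auto
    have 2: "runs Q ?\<sigma>1 (?\<sigma>1(out := y))"
    proof (rule computesD[OF Q])
      show "rec_eval f (map ?\<sigma>1 ?ts) y" unfolding map by (rule ys)
    qed (use zero Comp.prems in auto)
    have eq: "(\<lambda>r. if r \<in> set ?ts then 0 else (?\<sigma>1(out := y)) r) = \<sigma>(out := y)"
      using zero Comp.prems by (auto simp: fun_eq_iff)
    show "runs (P @ Q @ map (\<lambda>r. CLoop r []) ?ts) \<sigma> (\<sigma>(out := y))"
      using runs_append[OF P[OF ys(1,2) zero(1)] runs_append[OF 2 runs_clears[of ?ts]]]
      unfolding eq .
  qed
  then show ?case ..
next
  case (PrimRec f g)
  show ?case
  proof (cases ins)
    case Nil
    \<comment> \<open>\<open>PrimRec\<close> has no value on the empty argument list, so any program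
      qualifies.\<close>
    then have "computes (PrimRec f g) ins out b []"
      by (auto simp: computes_def elim!: rec_eval.cases)
    then show ?thesis ..
  next
    case (Cons i js)
    \<comment> \<open>register \<open>b\<close> counts down, \<open>b + 1\<close> counts up, \<open>b + 2\<close> receives the next value\<close>
    have "\<exists>P. computes f js out (b + 3) P"
      by (rule PrimRec.IH(1)) (use PrimRec.prems Cons in auto)
    then obtain P where P: "computes f js out (b + 3) P" ..
    have "\<exists>Q. computes g ((b + 1) # out # js) (b + 2) (b + 3) Q"
      by (rule PrimRec.IH(2)) (use PrimRec.prems Cons in auto)
    then obtain Q where Q: "computes g ((b + 1) # out # js) (b + 2) (b + 3) Q" ..
    \<comment> \<open>\<open>g\<close> still reads the old value in \<open>out\<close>, so the new
      one is computed elsewhere and replaces it afterwards.\<close>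
    let ?body = "Q @ [CLoop out [], CLoop (b + 2) [CInc out], CInc (b + 1)]"
    let ?P = "P @ copy i b (b + 1) @ [CLoop b ?body, CLoop (b + 1) []]"
    have "computes (PrimRec f g) ins out b ?P"
      unfolding computes_def
    proof (intro allI impI)
      fix \<sigma> :: "nat \<Rightarrow> nat" and y
      assume ev: "rec_eval (PrimRec f g) (map \<sigma> ins) y" and zero: "\<forall>r \<ge> b. \<sigma> r = 0" "\<sigma> out = 0"
      let ?n = "\<sigma> i"
      from ev Cons obtain Y where Y: "rec_eval f (map \<sigma> js) (Y 0)" "Y ?n = y"
        "\<And>j. j < ?n \<Longrightarrow> rec_eval g (j # Y j # map \<sigma> js) (Y (Suc j))"
        using rec_eval_PrimRec_values[of f g "\<sigma> i" "map \<sigma> js" y] by auto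
      have i: "i < b" "i \<noteq> out" "out < b" "out \<notin> set js" "set js \<subseteq> {..<b}"
        using PrimRec.prems Cons by auto
      define s where "s j = \<sigma>(out := Y j, b := ?n - j, b + 1 := j)" for j
      have 1: "runs P \<sigma> (\<sigma>(out := Y 0))"
        by (rule computesD[OF P]) (use Y zero in auto)
      have "runs (copy i b (b + 1)) (\<sigma>(out := Y 0)) ((\<sigma>(out := Y 0))(b := (\<sigma>(out := Y 0)) i))"
        by (rule runs_copy) (use i zero in auto)
      moreover have "(\<sigma>(out := Y 0))(b := (\<sigma>(out := Y 0)) i) = s 0"
        using i zero by (auto simp: s_def fun_eq_iff)
      ultimately have 2: "runs (copy i b (b + 1)) (\<sigma>(out := Y 0)) (s 0)"
        by (simp only:)
      have 3: "runs [CLoop b ?body] (s 0) (s ?n)"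
      proof (rule runs_loop)
        fix j assume j: "j < ?n"
        let ?s = "(s j)(b := ?n - Suc j)"
        have m: "map ?s ((b + 1) # out # js) = j # Y j # map \<sigma> js"
          using i by (auto simp: s_def)
        have a: "runs Q ?s (?s(b + 2 := Y (Suc j)))"
        proof (rule computesD[OF Q])
          show "rec_eval g (map ?s ((b + 1) # out # js)) (Y (Suc j))"
            unfolding m by (rule Y(3)[OF j])
        qed (use zero i in \<open>auto simp: s_def\<close>)
        have "runs [CLoop out [], CLoop (b + 2) [CInc out], CInc (b + 1)]
          (?s(b + 2 := Y (Suc j))) (s (Suc j))"
          by (rule runs_Cons[OF runs_clear], rule runs_Cons[OF runs_move],
              use i in simp, rule back_subst[of "runs _ _", OF runs_inc])
            (use zero i in \<open>auto simp: s_def fun_eq_iff\<close>)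
        with a show "runs ?body ?s (s (Suc j))" by (rule runs_append)
      qed (use i in \<open>auto simp: s_def\<close>)
      have 4: "runs [CLoop (b + 1) []] (s ?n) (\<sigma>(out := y))"
        by (rule back_subst[of "runs _ _", OF runs_clear])
          (use zero i Y(2) in \<open>auto simp: s_def fun_eq_iff\<close>)
      show "runs ?P \<sigma> (\<sigma>(out := y))"
        by (rule runs_append[OF 1], rule runs_append[OF 2], rule runs_Cons[OF 3 4])
    qed
    then show ?thesis ..
  qed
next
  case (Mu f)
  have "\<exists>P. computes f (out # ins) b (b + 1) P"
    by (rule Mu.IH) (use Mu.prems in auto)
  then obtain P where P: "computes f (out # ins) b (b + 1) P" ..
  \<comment> \<open>\<open>out\<close> itself is the current candidate and \<open>b\<close> receives
    the value of \<open>f\<close> there. If that is nonzero, what the loop head left of it is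
    cleared and the next candidate is evaluated.\<close>
  let ?body = "CLoop b [] # CInc out # P"
  have "computes (Mu f) ins out b (P @ [CLoop b ?body])"
    unfolding computes_def
  proof (intro allI impI)
    fix \<sigma> :: "nat \<Rightarrow> nat" and n
    assume ev: "rec_eval (Mu f) (map \<sigma> ins) n" and zero: "\<forall>r \<ge> b. \<sigma> r = 0" "\<sigma> out = 0"
    from ev have "rec_eval f (n # map \<sigma> ins) 0 \<and> (\<forall>i < n. \<exists>y. rec_eval f (i # map \<sigma> ins) (Suc y))"
      by (cases rule: rec_eval.cases) simp
    then have n: "rec_eval f (n # map \<sigma> ins) 0"
      and less: "\<forall>i < n. \<exists>y. rec_eval f (i # map \<sigma> ins) (Suc y)"
      by auto
    have halts: "\<exists>z. rec_eval f (j # map \<sigma> ins) z" if "j \<le> n" for j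
      using n less that by (cases "j = n") (blast, metis le_neq_implies_less)
    have run: "runs P (\<sigma>(out := j)) (\<sigma>(out := j, b := z))" if "rec_eval f (j # map \<sigma> ins) z" for j z
    proof (rule computesD[OF P])
      have "map (\<sigma>(out := j)) (out # ins) = j # map \<sigma> ins"
        using Mu.prems by auto
      with that show "rec_eval f (map (\<sigma>(out := j)) (out # ins)) z"
        by (simp only:)
    qed (use zero Mu.prems in auto)
    \<comment> \<open>Induction from the result \<open>n\<close> downwards: below \<open>n\<close>
      the value is a successor, so the loop is entered once more.\<close>
    have loop: "runs [CLoop b ?body] (\<sigma>(out := j, b := z)) (\<sigma>(out := n))"
      if "j \<le> n" "rec_eval f (j # map \<sigma> ins) z" for j z
      using that
    proof (induction arbitrary: z rule: inc_induct)
      case base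
      then have "z = 0" using n rec_eval_deterministic by blast
      then have eq: "\<sigma>(out := n, b := z) = \<sigma>(out := n)"
        using zero Mu.prems by (auto simp: fun_eq_iff)
      show ?case
        unfolding eq by (rule runs_exit) (use zero Mu.prems in simp)
    next
      case (step j)
      from less step.hyps obtain y where "rec_eval f (j # map \<sigma> ins) (Suc y)" by blast
      with step.prems have z: "z = Suc y" using rec_eval_deterministic by blast
      obtain z' where z': "rec_eval f (Suc j # map \<sigma> ins) z'"
        using halts[of "Suc j"] step.hyps by auto
      have "\<sigma>(out := j, b := y, b := 0, out := Suc j) = \<sigma>(out := Suc j)"
        using zero Mu.prems by (auto simp: fun_eq_iff)
      then have "runs [CLoop b [], CInc out] (\<sigma>(out := j, b := y)) (\<sigma>(out := Suc j))"
        using runs_Cons[OF runs_clear[of b "\<sigma>(out := j, b := y)"] runs_inc[of out]] Mu.prems by simp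
      from runs_append[OF this run[OF z']]
      have body: "runs ?body (\<sigma>(out := j, b := y)) (\<sigma>(out := Suc j, b := z'))"
        by simp
      show ?case
        unfolding z
      proof (rule runs_enter)
        show "(\<sigma>(out := j, b := Suc y)) b = Suc y" by simp
        show "runs ?body ((\<sigma>(out := j, b := Suc y))(b := y)) (\<sigma>(out := Suc j, b := z'))"
          using body by (simp only: fun_upd_upd)
      qed (rule step.IH[OF z'])
    qed
    obtain z where z: "rec_eval f (0 # map \<sigma> ins) z"
      using halts by blast
    from runs_append[OF run[OF z] loop[OF le0 z]] zero
    show "runs (P @ [CLoop b ?body]) \<sigma> (\<sigma>(out := n))"
      by (simp add: fun_upd_idem)
  qed
  then show ?case ..
qed

section \<open>Threads of a configuration\<close>

text \<open>A thread is a chain of tasks each waiting for its predecessor, the running one at the front; only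
  the states are recorded. A queued call is treated like a task in its initial state, which the Parikh
  image does not distinguish.\<close>

inductive tstep ::
  "('x, 'd, 'q, 'b, 's) qdas \<Rightarrow> 's list list \<times> ('x \<Rightarrow> 'd) \<Rightarrow> 's list list \<times> ('x \<Rightarrow> 'd) \<Rightarrow> bool"
  for A where
  guard:
    "\<lbrakk>\<gamma> \<in> blocks A; (s, Guard as, s') \<in> trans_of A \<gamma>; \<forall>a \<in> set as. atom_holds val a\<rbrakk>
     \<Longrightarrow> tstep A (T1 @ (s # t) # T2, val) (T1 @ (s' # t) # T2, val)"
| assign:
    "\<lbrakk>\<gamma> \<in> blocks A; (s, Assign x d, s') \<in> trans_of A \<gamma>\<rbrakk>
     \<Longrightarrow> tstep A (T1 @ (s # t) # T2, val) (T1 @ (s' # t) # T2, val(x := d))"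
| async:
    "\<lbrakk>\<gamma> \<in> blocks A; (s, DispatchA q \<delta>, s') \<in> trans_of A \<gamma>\<rbrakk>
     \<Longrightarrow> tstep A (T1 @ (s # t) # T2, val) (T1 @ (s' # t) # T2 @ [[init_state A \<delta>]], val)"
| sync:
    "\<lbrakk>\<gamma> \<in> blocks A; (s, DispatchS q \<delta>, s') \<in> trans_of A \<gamma>\<rbrakk>
     \<Longrightarrow> tstep A (T1 @ (s # t) # T2, val) (T1 @ (init_state A \<delta> # s' # t) # T2, val)"
| finish:
    "\<gamma> \<in> blocks A \<Longrightarrow> tstep A (T1 @ (final_state A \<gamma> # t) # T2, val) (T1 @ t # T2, val)"

section \<open>Decomposition of the wait graph into chains\<close>

abbreviation links :: "nat list \<Rightarrow> (nat \<times> nat) set" where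
  "links vs \<equiv> set (zip (tl vs) vs)"

lemma links_subset: "(v, w) \<in> links vs \<Longrightarrow> v \<in> set (tl vs) \<and> w \<in> set vs"
  by (auto dest: set_zip_leftD set_zip_rightD)

lemma waiting_has_link:
  assumes "v \<in> set (tl vs)" shows "\<exists>w. (v, w) \<in> links vs"
  using assms by (cases vs) (auto simp: in_set_conv_nth set_zip)

text \<open>Guarantees that a terminating task really disappears: its vertex is not listed in a
  queue as well.\<close>

definition fifo_ok :: "('q, 'b, 's) ctgraph \<Rightarrow> bool" where
  "fifo_ok G \<longleftrightarrow> (\<forall>q. distinct (fifo G q) \<and> set (fifo G q) \<inter> tasks G = {}) \<and>
     (\<forall>q q'. q \<noteq> q' \<longrightarrow> set (fifo G q) \<inter> set (fifo G q') = {})"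

text \<open>A synchronous dispatch adds an edge from a vertex without outgoing edges to a fresh
  vertex, so the wait graph remains a disjoint union of paths. \<open>V\<close> lists these
  paths.\<close>

definition decomposes ::
  "('x, 'd, 'q, 'b, 's) qdas \<Rightarrow> ('q, 'b, 's) ctgraph \<Rightarrow> nat list list \<Rightarrow> bool" where
  "decomposes A G V \<longleftrightarrow> distinct (concat V) \<and> set (concat V) = verts G \<and>
     waits G = (\<Union>vs \<in> set V. links vs) \<and>
     (\<forall>v \<in> verts G. block_of G v \<in> blocks A \<and> state_of G v \<in> states A (block_of G v))"

text \<open>Every vertex of a chain except the first has an edge to its predecessor.\<close>

lemma decomposes_unblocked:
  assumes V: "decomposes A G V" and v: "unblocked_task G v"
  obtains V1 vs V2 where "V = V1 @ (v # vs) # V2" "block_of G v \<in> blocks A"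
    "state_of G v \<in> states A (block_of G v)"
proof -
  have vG: "v \<in> verts G" using v by (simp add: unblocked_task_def verts_def)
  then obtain us where us: "us \<in> set V" "v \<in> set us"
    using V unfolding decomposes_def by force
  have "v \<notin> set (tl us)"
    using waiting_has_link[of v us] us V v unfolding decomposes_def unblocked_task_def by auto
  then obtain vs where "us = v # vs" using us by (cases us) auto
  moreover obtain V1 V2 where "V = V1 @ us # V2" using us by (meson split_list)
  ultimately show thesis using that V vG unfolding decomposes_def by blast
qed

lemma unblocked_if_top:
  assumes V: "decomposes A G (V1 @ (v # vs) # V2)" and "v \<in> tasks G"
  shows "unblocked_task G v"
  unfolding unblocked_task_def
proof (intro conjI allI notI)
  fix w assume "(v, w) \<in> waits G"
  then obtain us where us: "us \<in> set (V1 @ (v # vs) # V2)" "(v, w) \<in> links us"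
    using V unfolding decomposes_def by blast
  have "distinct (concat (V1 @ (v # vs) # V2))"
    using V unfolding decomposes_def by blast
  then have "v \<notin> set vs" "us \<notin> set V1 \<union> set V2 \<or> v \<notin> set us"
    using us(1) by auto
  moreover have "v \<in> set (tl us)" using links_subset[OF us(2)] by simp
  moreover from this have "v \<in> set us" by (cases us) auto
  ultimately show False using us(1) by auto
qed fact

lemma verts_move: "verts (move v s G) = verts G"
  by (simp add: move_def verts_def calls_def)

lemma decomposes_move:
  assumes "decomposes A G V" "s \<in> states A (block_of G v)"
  shows "decomposes A (move v s G) V"
  using assms unfolding decomposes_def verts_move by (auto simp: move_def)

lemma verts_enqueue: "verts (enqueue A q \<gamma> w G) = insert w (verts G)"
  by (auto simp: enqueue_def verts_def calls_def split: if_splits)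

lemma calls_disjoint_tasks: "fifo_ok G \<Longrightarrow> calls G \<inter> tasks G = {}"
  by (auto simp: fifo_ok_def calls_def)

lemma fifo_ok_enqueue: "fifo_ok G \<Longrightarrow> w \<notin> verts G \<Longrightarrow> fifo_ok (enqueue A q \<gamma> w G)"
  unfolding fifo_ok_def verts_def calls_def enqueue_def by auto

lemma dequeue_verts:
  assumes "fifo G q = w # ws"
  shows "verts (G\<lparr>tasks := insert w (tasks G), fifo := (fifo G)(q := ws)\<rparr>) = verts G"
proof -
  have "calls G = set (w # ws) \<union> (\<Union>q' \<in> - {q}. set (fifo G q'))"
    unfolding calls_def assms[symmetric] by blast
  moreover have "calls (G\<lparr>tasks := insert w (tasks G), fifo := (fifo G)(q := ws)\<rparr>) =
      set ws \<union> (\<Union>q' \<in> - {q}. set (fifo G q'))"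
    unfolding calls_def by (auto split: if_splits)
  ultimately show ?thesis unfolding verts_def by auto
qed

text \<open>Dequeuing turns a call into a task but changes neither vertices nor edges, so threads do
  not notice it.\<close>

lemma decomposes_dequeue:
  assumes "decomposes A G V" "fifo G q = w # ws"
  shows "decomposes A (G\<lparr>tasks := insert w (tasks G), fifo := (fifo G)(q := ws)\<rparr>) V"
  using assms unfolding decomposes_def dequeue_verts[OF assms(2)] by simp

lemma fifo_ok_dequeue:
  assumes "fifo_ok G" "fifo G q = w # ws"
  shows "fifo_ok (G\<lparr>tasks := insert w (tasks G), fifo := (fifo G)(q := ws)\<rparr>)"
proof -
  have "distinct (w # ws)" "set (w # ws) \<inter> tasks G = {}"
    using assms unfolding fifo_ok_def by metis+
  moreover have "set (w # ws) \<inter> set (fifo G q') = {}" if "q' \<noteq> q" for q'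
    using assms that unfolding fifo_ok_def by metis
  ultimately show ?thesis
    using assms(1) unfolding fifo_ok_def by (auto split: if_splits)
qed

lemma decomposes_async:
  assumes V: "decomposes A G (V1 @ (v # vs) # V2)" and s': "s' \<in> states A (block_of G v)"
    and w: "w \<notin> verts G" and \<delta>: "\<delta> \<in> blocks A" "init_state A \<delta> \<in> states A \<delta>"
  shows "decomposes A (enqueue A q \<delta> w (move v s' G)) (V1 @ (v # vs) # V2 @ [[w]])"
    "map (map (state_of (enqueue A q \<delta> w (move v s' G)))) (V1 @ (v # vs) # V2 @ [[w]]) =
     map (map (state_of G)) V1 @ (s' # map (state_of G) vs) # map (map (state_of G)) V2 @ [[init_state A \<delta>]]"
proof -
  have V': "distinct (concat (V1 @ (v # vs) # V2))" "set (concat (V1 @ (v # vs) # V2)) = verts G"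
    using V unfolding decomposes_def by blast+
  then have notin: "w \<notin> set (concat (V1 @ (v # vs) # V2))" using w by blast
  show "decomposes A (enqueue A q \<delta> w (move v s' G)) (V1 @ (v # vs) # V2 @ [[w]])"
    using V s' w \<delta> notin unfolding decomposes_def verts_enqueue verts_move
    by (auto simp: enqueue_def move_def)
  show "map (map (state_of (enqueue A q \<delta> w (move v s' G)))) (V1 @ (v # vs) # V2 @ [[w]]) =
     map (map (state_of G)) V1 @ (s' # map (state_of G) vs) # map (map (state_of G)) V2 @ [[init_state A \<delta>]]"
    using V' notin by (auto simp: enqueue_def move_def)
qed

lemma decomposes_sync:
  assumes V: "decomposes A G (V1 @ (v # vs) # V2)" and s': "s' \<in> states A (block_of G v)"
    and w: "w \<notin> verts G" and \<delta>: "\<delta> \<in> blocks A" "init_state A \<delta> \<in> states A \<delta>"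
    and G': "G' = enqueue A q \<delta> w (move v s' G)"
  shows "decomposes A (G'\<lparr>waits := insert (v, w) (waits G')\<rparr>) (V1 @ (w # v # vs) # V2)"
    "map (map (state_of G')) (V1 @ (w # v # vs) # V2) =
     map (map (state_of G)) V1 @ (init_state A \<delta> # s' # map (state_of G) vs) # map (map (state_of G)) V2"
proof -
  have V': "distinct (concat (V1 @ (v # vs) # V2))" "set (concat (V1 @ (v # vs) # V2)) = verts G"
    using V unfolding decomposes_def by blast+
  then have notin: "w \<notin> set (concat (V1 @ (v # vs) # V2))" using w by blast
  have "verts (G'\<lparr>waits := insert (v, w) (waits G')\<rparr>) = insert w (verts G)"
  proof -
    have "verts (G'\<lparr>waits := W\<rparr>) = verts G'" for W by (simp add: verts_def calls_def)
    then show ?thesis by (simp add: G' verts_enqueue verts_move)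
  qed
  then show "decomposes A (G'\<lparr>waits := insert (v, w) (waits G')\<rparr>) (V1 @ (w # v # vs) # V2)"
    using V s' w \<delta> notin unfolding decomposes_def
    by (auto simp: G' enqueue_def move_def)
  show "map (map (state_of G')) (V1 @ (w # v # vs) # V2) =
     map (map (state_of G)) V1 @ (init_state A \<delta> # s' # map (state_of G) vs) # map (map (state_of G)) V2"
    using V' notin by (auto simp: G' enqueue_def move_def)
qed

text \<open>The only edge into the top of a chain comes from the task after it, which becomes the
  new top. A chain of a single task leaves an empty list behind.\<close>

lemma decomposes_finish:
  assumes V: "decomposes A G (V1 @ (v # vs) # V2)" and G: "fifo_ok G" "v \<in> tasks G"
    and G': "G' = G\<lparr>tasks := tasks G - {v}, waits := {(u, w) \<in> waits G. w \<noteq> v}\<rparr>"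
  shows "decomposes A G' (V1 @ vs # V2)"
proof -
  have V': "distinct (concat (V1 @ (v # vs) # V2))" "set (concat (V1 @ (v # vs) # V2)) = verts G"
    "waits G = (\<Union>us \<in> set (V1 @ (v # vs) # V2). links us)"
    using V unfolding decomposes_def by blast+
  have "v \<notin> calls G"
    using calls_disjoint_tasks[OF G(1)] G(2) by blast
  then have verts: "verts G' = verts G - {v}"
    by (auto simp: G' verts_def calls_def)
  have "{(u, w) \<in> links (v # vs). w \<noteq> v} = links vs"
    using V'(1) by (cases vs) (auto dest: links_subset set_zip_rightD)
  moreover have "{(u, w) \<in> links us. w \<noteq> v} = links us" if "us \<in> set V1 \<union> set V2" for us
  proof -
    have "v \<notin> set us" using V'(1) that by auto
    then show ?thesis by (auto dest: set_zip_rightD)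
  qed
  moreover have "waits G' = (\<Union>us \<in> set (V1 @ (v # vs) # V2). {(u, w) \<in> links us. w \<noteq> v})"
    using V'(3) by (auto simp: G')
  ultimately have waits: "waits G' = (\<Union>us \<in> set (V1 @ vs # V2). links us)"
    by simp
  show ?thesis
    using V V' unfolding decomposes_def verts waits by (auto simp: G')
qed

definition init_threads :: "('x, 'd, 'q, 'b, 's) qdas \<Rightarrow> 's list list \<times> ('x \<Rightarrow> 'd)" where
  "init_threads A = ([[init_state A (main A)]], \<lambda>_. init_val A)"

lemma qdas_wfD:
  assumes "qdas_wf A" "\<gamma> \<in> blocks A"
  shows "init_state A \<gamma> \<in> states A \<gamma>" "final_state A \<gamma> \<in> states A \<gamma>"
    "(s, a, s') \<in> trans_of A \<gamma> \<Longrightarrow> s \<in> states A \<gamma> \<and> s' \<in> states A \<gamma> \<and> action_ok A a"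
    "\<gamma>' \<in> blocks A \<Longrightarrow> s \<in> states A \<gamma> \<Longrightarrow> s \<in> states A \<gamma>' \<Longrightarrow> \<gamma>' = \<gamma>"
  using assms unfolding qdas_wf_def by blast+

lemma verts_init: "verts (fst (init_config A)) = {0}"
  by (simp add: init_config_def verts_def calls_def)

lemma decomposes_init:
  assumes "qdas_wf A"
  shows "decomposes A (fst (init_config A)) [[0]]"
  using assms qdas_wfD(1)[OF assms, of "main A"] unfolding decomposes_def verts_init
  by (simp add: init_config_def qdas_wf_def)

text \<open>Dequeuing is matched by no thread step, every other step by exactly one.\<close>

lemma step_threads:
  assumes wf: "qdas_wf A" and "step A (G, val) (G', val')"
    and V: "decomposes A G V" and G: "fifo_ok G"
  obtains V' where "decomposes A G' V'" "fifo_ok G'"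
    "(tstep A)\<^sup>*\<^sup>* (map (map (state_of G)) V, val) (map (map (state_of G')) V', val')"
  using assms(2)
proof (cases rule: step.cases)
  case (guard v as s')
  then obtain V1 vs V2 where 1: "V = V1 @ (v # vs) # V2" "block_of G v \<in> blocks A"
    using decomposes_unblocked[OF V] by blast
  have s': "s' \<in> states A (block_of G v)" using qdas_wfD(3)[OF wf 1(2) guard(4)] by simp
  show thesis
  proof (rule that)
    show "decomposes A G' V" unfolding guard using decomposes_move[OF V s'] .
    show "fifo_ok G'" using G unfolding guard by (simp add: fifo_ok_def move_def)
    have "distinct (concat V)" using V unfolding decomposes_def by blast
    then have T': "map (map (state_of G')) V =
        map (map (state_of G)) V1 @ (s' # map (state_of G) vs) # map (map (state_of G)) V2"
      unfolding guard 1 by (auto simp: move_def)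
    have "tstep A (map (map (state_of G)) V, val) (map (map (state_of G')) V, val')"
      using tstep.guard[OF 1(2) guard(4,5), of "map (map (state_of G)) V1" "map (state_of G) vs"]
      unfolding T' unfolding guard(2) 1(1) by simp
    then show "(tstep A)\<^sup>*\<^sup>* (map (map (state_of G)) V, val) (map (map (state_of G')) V, val')" ..
  qed
next
  case (assign v x d s')
  then obtain V1 vs V2 where 1: "V = V1 @ (v # vs) # V2" "block_of G v \<in> blocks A"
    using decomposes_unblocked[OF V] by blast
  have s': "s' \<in> states A (block_of G v)" using qdas_wfD(3)[OF wf 1(2) assign(4)] by simp
  show thesis
  proof (rule that)
    show "decomposes A G' V" unfolding assign using decomposes_move[OF V s'] .
    show "fifo_ok G'" using G unfolding assign by (simp add: fifo_ok_def move_def)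
    have "distinct (concat V)" using V unfolding decomposes_def by blast
    then have T': "map (map (state_of G')) V =
        map (map (state_of G)) V1 @ (s' # map (state_of G) vs) # map (map (state_of G)) V2"
      unfolding assign 1 by (auto simp: move_def)
    have "tstep A (map (map (state_of G)) V, val) (map (map (state_of G')) V, val')"
      using tstep.assign[OF 1(2) assign(4), of "map (map (state_of G)) V1" "map (state_of G) vs"]
      unfolding T' unfolding assign(2) 1(1) by simp
    then show "(tstep A)\<^sup>*\<^sup>* (map (map (state_of G)) V, val) (map (map (state_of G')) V, val')" ..
  qed
next
  case (dispatch_async v q \<delta> s' w)
  then obtain V1 vs V2 where 1: "V = V1 @ (v # vs) # V2" "block_of G v \<in> blocks A"
    using decomposes_unblocked[OF V] by blast
  note t = qdas_wfD(3)[OF wf 1(2) dispatch_async(4)]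
  have \<delta>: "\<delta> \<in> blocks A" "init_state A \<delta> \<in> states A \<delta>" using t qdas_wfD(1)[OF wf] by auto
  have s': "s' \<in> states A (block_of G v)" using t by simp
  note d = decomposes_async[OF V[unfolded 1] s' dispatch_async(5) \<delta>, of q]
  show thesis
  proof (rule that)
    show "decomposes A G' (V1 @ (v # vs) # V2 @ [[w]])"
      unfolding dispatch_async by (rule d(1))
    show "fifo_ok G'"
      unfolding dispatch_async
      by (rule fifo_ok_enqueue) (use G dispatch_async in \<open>simp_all add: verts_move, simp_all add: fifo_ok_def move_def\<close>)
    show "(tstep A)\<^sup>*\<^sup>* (map (map (state_of G)) V, val)
        (map (map (state_of G')) (V1 @ (v # vs) # V2 @ [[w]]), val')"
      using tstep.async[OF 1(2) dispatch_async(4), of "map (map (state_of G)) V1" "map (state_of G) vs"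
          "map (map (state_of G)) V2" val]
      unfolding dispatch_async(1,2) 1(1) d(2) by (simp add: r_into_rtranclp)
  qed
next
  case (dispatch_sync v q \<delta> s' w G'')
  then obtain V1 vs V2 where 1: "V = V1 @ (v # vs) # V2" "block_of G v \<in> blocks A"
    using decomposes_unblocked[OF V] by blast
  note t = qdas_wfD(3)[OF wf 1(2) dispatch_sync(4)]
  have \<delta>: "\<delta> \<in> blocks A" "init_state A \<delta> \<in> states A \<delta>" using t qdas_wfD(1)[OF wf] by auto
  have s': "s' \<in> states A (block_of G v)" using t by simp
  note d = decomposes_sync[OF V[unfolded 1] s' dispatch_sync(5) \<delta> dispatch_sync(6)]
  show thesis
  proof (rule that)
    show "decomposes A G' (V1 @ (w # v # vs) # V2)"
      unfolding dispatch_sync(1) by (rule d(1))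
    have "fifo_ok G''"
      unfolding dispatch_sync(6)
      by (rule fifo_ok_enqueue) (use G dispatch_sync in \<open>simp_all add: verts_move, simp_all add: fifo_ok_def move_def\<close>)
    then show "fifo_ok G'" unfolding dispatch_sync(1) by (simp add: fifo_ok_def)
    have T': "map (map (state_of G')) (V1 @ (w # v # vs) # V2) =
        map (map (state_of G)) V1 @ (init_state A \<delta> # s' # map (state_of G) vs) # map (map (state_of G)) V2"
      unfolding dispatch_sync(1) using d(2) by simp
    show "(tstep A)\<^sup>*\<^sup>* (map (map (state_of G)) V, val)
        (map (map (state_of G')) (V1 @ (w # v # vs) # V2), val')"
      using tstep.sync[OF 1(2) dispatch_sync(4), of "map (map (state_of G)) V1" "map (state_of G) vs"
          "map (map (state_of G)) V2" val]
      unfolding T' unfolding dispatch_sync(2) 1(1) by (simp add: r_into_rtranclp)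
  qed
next
  case (terminate v)
  then obtain V1 vs V2 where 1: "V = V1 @ (v # vs) # V2" "block_of G v \<in> blocks A"
    using decomposes_unblocked[OF V] by blast
  show thesis
  proof (rule that)
    show "decomposes A G' (V1 @ vs # V2)"
      using decomposes_finish[OF V[unfolded 1] G _ terminate(1)] terminate(3)
      by (simp add: unblocked_task_def)
    show "fifo_ok G'" using G unfolding terminate(1) by (auto simp: fifo_ok_def)
    show "(tstep A)\<^sup>*\<^sup>* (map (map (state_of G)) V, val) (map (map (state_of G')) (V1 @ vs # V2), val')"
      unfolding terminate(1,2) using tstep.finish[OF 1(2)] terminate(4) 1(1) by auto
  qed
next
  case (dequeue_concurrent q w ws)
  show thesis
    by (rule that[of V])
      (use decomposes_dequeue[OF V] fifo_ok_dequeue[OF G] dequeue_concurrent in auto)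
next
  case (dequeue_serial q w ws)
  show thesis
    by (rule that[of V])
      (use decomposes_dequeue[OF V] fifo_ok_dequeue[OF G] dequeue_serial in auto)
qed

lemma reachable_threads:
  assumes wf: "qdas_wf A" and "reachable A (G, val)"
  obtains V where "decomposes A G V"
    "(tstep A)\<^sup>*\<^sup>* (init_threads A) (map (map (state_of G)) V, val)"
proof -
  have "(step A)\<^sup>*\<^sup>* (init_config A) c \<Longrightarrow> \<exists>V. decomposes A (fst c) V \<and> fifo_ok (fst c) \<and>
    (tstep A)\<^sup>*\<^sup>* (init_threads A) (map (map (state_of (fst c))) V, snd c)" for c
  proof (induction rule: rtranclp_induct)
    case base
    show ?case
      by (rule exI[of _ "[[0]]"], use decomposes_init[OF wf] in simp)
         (simp add: init_config_def init_threads_def fifo_ok_def)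
  next
    case (step c c')
    obtain G val G' val' where c: "c = (G, val)" "c' = (G', val')" by fastforce
    from step.IH obtain V where V: "decomposes A G V" "fifo_ok G"
      "(tstep A)\<^sup>*\<^sup>* (init_threads A) (map (map (state_of G)) V, val)" unfolding c by auto
    from step_threads[OF wf step.hyps(2)[unfolded c] V(1,2)] obtain V' where
      "decomposes A G' V'" "fifo_ok G'"
      "(tstep A)\<^sup>*\<^sup>* (map (map (state_of G)) V, val) (map (map (state_of G')) V', val')" .
    with V(3) show ?case
      unfolding c fst_conv snd_conv by (blast intro: rtranclp_trans)
  qed
  from this[of "(G, val)"] assms(2) that show thesis
    unfolding reachable_def by auto
qed

text \<open>With only concurrent queues, dequeuing every call at once keeps all queues empty.\<close>

lemma tstep_realised:
  assumes wf: "qdas_wf A" and conc: "concurrent A"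
    and "tstep A (T, val) (T', val')"
    and V: "decomposes A G V" "T = map (map (state_of G)) V" and G: "\<forall>q. fifo G q = []"
  obtains G' V' where "(step A)\<^sup>*\<^sup>* (G, val) (G', val')" "decomposes A G' V'"
    "T' = map (map (state_of G')) V'" "\<forall>q. fifo G' q = []"
proof -
  have calls: "calls G = {}" using G by (simp add: calls_def)
  have ok: "fifo_ok G" using G by (simp add: fifo_ok_def)
  have dV: "distinct (concat V)" "set (concat V) = verts G"
    using V(1) unfolding decomposes_def by blast+
  then have fin: "finite (verts G)" by (metis List.finite_set)
  obtain w where w: "w \<notin> verts G" using ex_new_if_finite[OF infinite_UNIV_nat fin] by blast
  \<comment> \<open>Without calls every vertex is a task, so the head of a chain is an unblocked
    task; and as the state sets are disjoint, its state identifies its block, which makes the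
    transitions of \<open>\<gamma>\<close> available to it.\<close>
  have split: "\<exists>V1 v vs V2. V = V1 @ (v # vs) # V2 \<and> T1 = map (map (state_of G)) V1 \<and>
      s = state_of G v \<and> t = map (state_of G) vs \<and> T2 = map (map (state_of G)) V2 \<and>
      unblocked_task G v \<and> block_of G v = \<gamma> \<and> v \<in> tasks G"
    if eq: "T = T1 @ (s # t) # T2" and \<gamma>: "\<gamma> \<in> blocks A" "s \<in> states A \<gamma>" for T1 s t T2 \<gamma>
  proof -
    obtain V1 v vs V2 where V': "V = V1 @ (v # vs) # V2" "T1 = map (map (state_of G)) V1"
      "s = state_of G v" "t = map (state_of G) vs" "T2 = map (map (state_of G)) V2"
      using eq V(2) by (auto simp: map_eq_append_conv map_eq_Cons_conv)
    have v: "v \<in> verts G" using dV(2) unfolding V'(1) by auto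
    then have "v \<in> tasks G" using calls unfolding verts_def by blast
    moreover from this have "unblocked_task G v" using unblocked_if_top V(1) unfolding V'(1) by blast
    moreover have "block_of G v = \<gamma>"
      using qdas_wfD(4)[OF wf \<gamma>(1)] \<gamma> v V(1) unfolding V'(3) decomposes_def by blast
    ultimately show ?thesis using V' by blast
  qed
  have empty: "fifo ((enqueue A q \<delta> w (move v s' G))) q' = (if q' = q then [w] else [])" for q q' \<delta> v s'
    using G by (simp add: enqueue_def move_def)
  have cq: "q \<in> cqid A" if "action_ok A (DispatchA q \<delta>) \<or> action_ok A (DispatchS q \<delta>)" for q \<delta>
    using that conc by (auto simp: concurrent_def)
  from assms(3) show thesis
  proof (cases rule: tstep.cases)
    case (guard \<gamma> s as s' T1 t T2)
    note tr = qdas_wfD(3)[OF wf guard(4,5)]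
    from split[OF guard(1,4)] tr obtain V1 v vs V2 where V': "V = V1 @ (v # vs) # V2"
      "T1 = map (map (state_of G)) V1" "s = state_of G v" "t = map (state_of G) vs"
      "T2 = map (map (state_of G)) V2" "unblocked_task G v" "block_of G v = \<gamma>" by blast
    have s': "s' \<in> states A (block_of G v)" using tr V' by simp
    show thesis
    proof (rule that)
      show "(step A)\<^sup>*\<^sup>* (G, val) (move v s' G, val')"
        using step.guard[of G v as s' A val] V' guard by auto
      show "decomposes A (move v s' G) V" using decomposes_move[OF V(1) s'] .
      show "T' = map (map (state_of (move v s' G))) V"
        unfolding guard V' using dV(1)[unfolded V'(1)] by (auto simp: move_def)
    qed (use G in \<open>simp add: move_def\<close>)
  next
    case (assign \<gamma> s x d s' T1 t T2)
    note tr = qdas_wfD(3)[OF wf assign(4,5)]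
    from split[OF assign(1,4)] tr obtain V1 v vs V2 where V': "V = V1 @ (v # vs) # V2"
      "T1 = map (map (state_of G)) V1" "s = state_of G v" "t = map (state_of G) vs"
      "T2 = map (map (state_of G)) V2" "unblocked_task G v" "block_of G v = \<gamma>" by blast
    have s': "s' \<in> states A (block_of G v)" using tr V' by simp
    show thesis
    proof (rule that)
      show "(step A)\<^sup>*\<^sup>* (G, val) (move v s' G, val')"
        using step.assign[of G v x d s' A val] V' assign by auto
      show "decomposes A (move v s' G) V" using decomposes_move[OF V(1) s'] .
      show "T' = map (map (state_of (move v s' G))) V"
        unfolding assign V' using dV(1)[unfolded V'(1)] by (auto simp: move_def)
    qed (use G in \<open>simp add: move_def\<close>)
  next
    case (async \<gamma> s q \<delta> s' T1 t T2)
    note tr = qdas_wfD(3)[OF wf async(4,5)]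
    from split[OF async(1,4)] tr obtain V1 v vs V2 where V': "V = V1 @ (v # vs) # V2"
      "T1 = map (map (state_of G)) V1" "s = state_of G v" "t = map (state_of G) vs"
      "T2 = map (map (state_of G)) V2" "unblocked_task G v" "block_of G v = \<gamma>" by blast
    have \<delta>: "\<delta> \<in> blocks A" "init_state A \<delta> \<in> states A \<delta>" using tr qdas_wfD(1)[OF wf] by auto
    have s': "s' \<in> states A (block_of G v)" using tr V' by simp
    note d = decomposes_async[OF V(1)[unfolded V'(1)] s' w \<delta>, of q]
    let ?G = "enqueue A q \<delta> w (move v s' G)"
    have q: "fifo ?G q = w # []" "q \<in> cqid A" using empty cq[of q \<delta>] tr by simp_all
    let ?G' = "?G\<lparr>tasks := insert w (tasks ?G), fifo := (fifo ?G)(q := [])\<rparr>"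
    show thesis
    proof (rule that)
      have "(step A)\<^sup>*\<^sup>* (G, val) (?G, val')"
        using step.dispatch_async[of G v q \<delta> s' A w val] V' w async by (simp add: r_into_rtranclp)
      also have "step A (?G, val') (?G', val')"
        using q by (intro step.dequeue_concurrent)
      finally show "(step A)\<^sup>*\<^sup>* (G, val) (?G', val')" .
      show "decomposes A ?G' (V1 @ (v # vs) # V2 @ [[w]])"
        using decomposes_dequeue[OF d(1) q(1)] .
      show "T' = map (map (state_of ?G')) (V1 @ (v # vs) # V2 @ [[w]])"
        using d(2) unfolding async V' by simp
    qed (simp add: empty)
  next
    case (sync \<gamma> s q \<delta> s' T1 t T2)
    note tr = qdas_wfD(3)[OF wf sync(4,5)]
    from split[OF sync(1,4)] tr obtain V1 v vs V2 where V': "V = V1 @ (v # vs) # V2"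
      "T1 = map (map (state_of G)) V1" "s = state_of G v" "t = map (state_of G) vs"
      "T2 = map (map (state_of G)) V2" "unblocked_task G v" "block_of G v = \<gamma>" by blast
    have \<delta>: "\<delta> \<in> blocks A" "init_state A \<delta> \<in> states A \<delta>" using tr qdas_wfD(1)[OF wf] by auto
    have s': "s' \<in> states A (block_of G v)" using tr V' by simp
    define G0 where "G0 = enqueue A q \<delta> w (move v s' G)"
    note d = decomposes_sync[OF V(1)[unfolded V'(1)] s' w \<delta> G0_def]
    let ?G = "G0\<lparr>waits := insert (v, w) (waits G0)\<rparr>"
    have q: "fifo ?G q = w # []" "q \<in> cqid A" using empty cq[of q \<delta>] tr by (simp_all add: G0_def)
    let ?G' = "?G\<lparr>tasks := insert w (tasks ?G), fifo := (fifo ?G)(q := [])\<rparr>"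
    show thesis
    proof (rule that)
      have "(step A)\<^sup>*\<^sup>* (G, val) (?G, val')"
        using step.dispatch_sync[of G v q \<delta> s' A w G0 val] V' w sync
        by (simp add: G0_def r_into_rtranclp)
      also have "step A (?G, val') (?G', val')"
        using q by (intro step.dequeue_concurrent)
      finally show "(step A)\<^sup>*\<^sup>* (G, val) (?G', val')" .
      show "decomposes A ?G' (V1 @ (w # v # vs) # V2)"
        using decomposes_dequeue[OF d(1) q(1)] .
      show "T' = map (map (state_of ?G')) (V1 @ (w # v # vs) # V2)"
        using d(2) unfolding sync V' by simp
    qed (simp add: empty G0_def)
  next
    case (finish \<gamma> T1 t T2)
    from split[OF finish(1,4)] qdas_wfD(2)[OF wf finish(4)] obtain V1 v vs V2 where
      V': "V = V1 @ (v # vs) # V2" "T1 = map (map (state_of G)) V1"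
      "final_state A \<gamma> = state_of G v" "t = map (state_of G) vs"
      "T2 = map (map (state_of G)) V2" "unblocked_task G v" "block_of G v = \<gamma>" "v \<in> tasks G" by blast
    let ?G = "G\<lparr>tasks := tasks G - {v}, waits := {(u, w) \<in> waits G. w \<noteq> v}\<rparr>"
    show thesis
    proof (rule that)
      show "(step A)\<^sup>*\<^sup>* (G, val) (?G, val')"
        using step.terminate[of G v A val] V' finish by auto
      show "decomposes A ?G (V1 @ vs # V2)"
        using decomposes_finish[OF V(1)[unfolded V'(1)] ok V'(8)] by simp
      show "T' = map (map (state_of ?G)) (V1 @ vs # V2)"
        unfolding finish V' by simp
    qed (use G in simp)
  qed
qed

lemma threads_realised:
  assumes wf: "qdas_wf A" and conc: "concurrent A"
    and "(tstep A)\<^sup>*\<^sup>* (init_threads A) (T, val)"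
  obtains G V where "reachable A (G, val)" "decomposes A G V" "T = map (map (state_of G)) V"
proof -
  have "(tstep A)\<^sup>*\<^sup>* (init_threads A) c \<Longrightarrow> \<exists>G V. reachable A (G, snd c) \<and> decomposes A G V \<and>
     fst c = map (map (state_of G)) V \<and> (\<forall>q. fifo G q = [])" for c
  proof (induction rule: rtranclp_induct)
    case base
    show ?case
      by (rule exI[of _ "fst (init_config A)"], rule exI[of _ "[[0]]"])
        (use decomposes_init[OF wf] in
          \<open>simp add: reachable_def init_config_def init_threads_def\<close>)
  next
    case (step c c')
    from step.IH obtain G V where GV: "reachable A (G, snd c)" "decomposes A G V"
      "fst c = map (map (state_of G)) V" "\<forall>q. fifo G q = []" by blast
    have "tstep A (fst c, snd c) (fst c', snd c')" using step.hyps by simp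
    from tstep_realised[OF wf conc this GV(2,3,4)] obtain G' V' where
      "(step A)\<^sup>*\<^sup>* (G, snd c) (G', snd c')" "decomposes A G' V'"
      "fst c' = map (map (state_of G')) V'" "\<forall>q. fifo G' q = []" .
    with GV(1) show ?case unfolding reachable_def by (blast intro: rtranclp_trans)
  qed
  from this[OF assms(3)] that show thesis by auto
qed

text \<open>A demand of 1 at a single state asks only whether that state occurs, and threads record
  all states that occur.\<close>

lemma parikh_coverable_single_iff:
  assumes wf: "qdas_wf A" and conc: "concurrent A" and h: "h \<in> all_states A"
  shows "parikh_coverable A (\<lambda>s. if s = h then 1 else 0) \<longleftrightarrow>
    (\<exists>T val. (tstep A)\<^sup>*\<^sup>* (init_threads A) (T, val) \<and> h \<in> set (concat T))"
proof -
  have *: "h \<in> set (concat (map (map (state_of G)) V)) \<longleftrightarrow> 1 \<le> parikh G h"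
    if "decomposes A G V" for G V
  proof -
    have V: "set (concat V) = verts G" using that unfolding decomposes_def by blast
    \<comment> \<open>\<open>card\<close> is 0 on infinite sets, so finiteness is what makes an
      occurrence count.\<close>
    have "finite (verts G)" unfolding V[symmetric] by simp
    then have "finite {v \<in> verts G. state_of G v = h}" by simp
    then have "1 \<le> parikh G h \<longleftrightarrow> (\<exists>v \<in> verts G. state_of G v = h)"
      unfolding parikh_def by (auto simp: Suc_le_eq card_gt_0_iff)
    also have "\<dots> \<longleftrightarrow> h \<in> state_of G ` set (concat V)"
      unfolding V by blast
    finally show ?thesis by auto
  qed
  have "parikh_coverable A (\<lambda>s. if s = h then 1 else 0) \<longleftrightarrow>
      (\<exists>G val. reachable A (G, val) \<and> 1 \<le> parikh G h)"
    unfolding parikh_coverable_def using h by (metis (full_types) le0)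
  also have "\<dots> \<longleftrightarrow> (\<exists>T val. (tstep A)\<^sup>*\<^sup>* (init_threads A) (T, val) \<and> h \<in> set (concat T))"
  proof
    assume "\<exists>G val. reachable A (G, val) \<and> 1 \<le> parikh G h"
    then obtain G val where G: "reachable A (G, val)" "1 \<le> parikh G h" by blast
    from reachable_threads[OF wf G(1)] obtain V where "decomposes A G V"
      "(tstep A)\<^sup>*\<^sup>* (init_threads A) (map (map (state_of G)) V, val)" .
    with G(2) * show "\<exists>T val. (tstep A)\<^sup>*\<^sup>* (init_threads A) (T, val) \<and> h \<in> set (concat T)"
      by blast
  next
    assume "\<exists>T val. (tstep A)\<^sup>*\<^sup>* (init_threads A) (T, val) \<and> h \<in> set (concat T)"
    then obtain T val where T: "(tstep A)\<^sup>*\<^sup>* (init_threads A) (T, val)" "h \<in> set (concat T)" by blast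
    from threads_realised[OF wf conc T(1)] obtain G V where
      "reachable A (G, val)" "decomposes A G V" "T = map (map (state_of G)) V" .
    with T(2) * show "\<exists>G val. reachable A (G, val) \<and> 1 \<le> parikh G h" by blast
  qed
  finally show ?thesis .
qed

section \<open>The automaton of a counter machine\<close>

datatype instr = IInc nat nat | IDec nat nat nat

inductive mstep ::
  "(nat \<Rightarrow> instr option) \<Rightarrow> nat \<times> (nat \<Rightarrow> nat) \<Rightarrow> nat \<times> (nat \<Rightarrow> nat) \<Rightarrow> bool" for prog where
  inc: "prog l = Some (IInc r l') \<Longrightarrow> mstep prog (l, \<sigma>) (l', \<sigma>(r := Suc (\<sigma> r)))"
| dec: "\<lbrakk>prog l = Some (IDec r l1 l2); \<sigma> r = Suc v\<rbrakk> \<Longrightarrow> mstep prog (l, \<sigma>) (l1, \<sigma>(r := v))"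
| zero: "\<lbrakk>prog l = Some (IDec r l1 l2); \<sigma> r = 0\<rbrakk> \<Longrightarrow> mstep prog (l, \<sigma>) (l2, \<sigma>)"

text \<open>Variable 0 holds the label of the current instruction, where label 1 starts and label 2 halts the
  machine, label 3 requests one increment of register 0 during the loading of the input, and label 0
  is the idle value in that phase. The value \<open>v\<close> of a register is the number of tasks above the bottom
  task in the thread of that register; the first argument of \<open>Idle\<close> to \<open>Fin\<close> marks the bottom task.
  A task in \<open>Ret\<close> becomes active again when the task above it has been popped.\<close>

datatype st =
    Ctl nat | Boot nat | LoadInit | LoadWait | LoadFin
  | Idle bool nat | Push bool nat | Ret bool nat | Goto bool nat nat | Call nat | Fin bool nat

instance st :: countable by countable_datatype

text \<open>The number of states of \<open>main\<close> grows with \<open>n\<close>, so their codes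
  must be given by a formula. The other states depend on the machine alone and may have arbitrary
  codes, here odd ones to keep the two kinds apart.\<close>

fun st_code :: "st \<Rightarrow> nat" where
  "st_code (Ctl j) = 2 * j"
| "st_code s = Suc (2 * to_nat s)"

lemma inj_st_code: "inj st_code"
proof (rule injI)
  have other: "st_code s = Suc (2 * to_nat s)" if "\<forall>j. s \<noteq> Ctl j" for s
    using that by (cases s) auto
  show "s = t" if "st_code s = st_code t" for s t
  proof (cases "(\<exists>j. s = Ctl j) \<or> (\<exists>j. t = Ctl j)")
    case True
    have "even (st_code u) \<longleftrightarrow> (\<exists>j. u = Ctl j)" for u
      by (cases u) auto
    with True that obtain i j where "s = Ctl i" "t = Ctl j" by metis
    with that show ?thesis by simp
  next
    case False
    then have "to_nat s = to_nat t" using that other by auto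
    then show ?thesis by simp
  qed
qed

lemma st_code_eq_iff [simp]: "st_code s = st_code t \<longleftrightarrow> s = t"
  using inj_st_code by (simp add: inj_eq)

declare st_code.simps [simp del]

text \<open>Blocks 0, 1 and 2 are the main block, the one that spawns the registers and the one that
  loads a unit of input. From 3 on, odd numbers are bottom tasks and even numbers the tasks pushed
  above them.\<close>

definition blk :: "bool \<Rightarrow> nat \<Rightarrow> nat" where
  "blk bottom r = 2 * r + (if bottom then 3 else 4)"

lemma blk_neq [simp]: "blk b r \<noteq> 0" "blk b r \<noteq> Suc 0" "blk b r \<noteq> 2" "0 < blk b r"
  by (auto simp: blk_def)

lemma blk_cases:
  fixes \<gamma> :: nat
  obtains "\<gamma> = 0" | "\<gamma> = 1" | "\<gamma> = 2" | b r where "\<gamma> = blk b r"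
proof -
  have "\<gamma> = blk (odd \<gamma>) ((\<gamma> - 3) div 2)" if "\<gamma> > 2"
    using that unfolding blk_def by (cases "odd \<gamma>") (simp, presburger)+
  moreover have "\<gamma> = 0 \<or> \<gamma> = 1 \<or> \<gamma> = 2" if "\<not> \<gamma> > 2"
    using that by auto
  ultimately show thesis using that by blast
qed

lemma blk_eq_iff [simp]: "blk b r = blk b' r' \<longleftrightarrow> b = b' \<and> r = r'"
  unfolding blk_def by (cases b; cases b') (simp_all, presburger+)

lemma blk_less_iff [simp]: "blk b r < 2 * k + 3 \<longleftrightarrow> r < k"
  by (auto simp: blk_def)

fun block_of_st :: "st \<Rightarrow> nat" where
  "block_of_st (Ctl _) = 0"
| "block_of_st (Boot _) = 1"
| "block_of_st LoadInit = 2"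
| "block_of_st LoadWait = 2"
| "block_of_st LoadFin = 2"
| "block_of_st (Idle b r) = blk b r"
| "block_of_st (Push b r) = blk b r"
| "block_of_st (Ret b r) = blk b r"
| "block_of_st (Goto b r _) = blk b r"
| "block_of_st (Call r) = blk False r"
| "block_of_st (Fin b r) = blk b r"

text \<open>In \<open>main\<close>, \<open>Ctl (n + 3)\<close> boots, \<open>Ctl 0\<close> to
  \<open>Ctl n\<close> count the units loaded so far, \<open>Ctl (n + 1)\<close> waits for the
  halting label and \<open>Ctl (n + 2)\<close> is the state to be covered.\<close>

definition init_st :: "nat \<Rightarrow> nat \<Rightarrow> st" where
  "init_st n \<gamma> = (if \<gamma> = 0 then Ctl (n + 3) else if \<gamma> = 1 then Boot 0 else if \<gamma> = 2 then LoadInit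
     else if odd \<gamma> then Idle True ((\<gamma> - 3) div 2) else Call ((\<gamma> - 4) div 2))"

definition final_st :: "nat \<Rightarrow> nat \<Rightarrow> nat \<Rightarrow> st" where
  "final_st k n \<gamma> = (if \<gamma> = 0 then Ctl (n + 2) else if \<gamma> = 1 then Boot k else if \<gamma> = 2 then LoadFin
     else if odd \<gamma> then Fin True ((\<gamma> - 3) div 2) else Fin False ((\<gamma> - 4) div 2))"

lemma init_st_simps [simp]:
  "init_st n 0 = Ctl (n + 3)" "init_st n (Suc 0) = Boot 0" "init_st n 2 = LoadInit"
  "init_st n (blk b r) = (if b then Idle True r else Call r)"
  by (simp_all add: init_st_def blk_def)

lemma final_st_simps [simp]:
  "final_st k n 0 = Ctl (n + 2)" "final_st k n (Suc 0) = Boot k" "final_st k n 2 = LoadFin"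
  "final_st k n (blk b r) = Fin b r"
  by (simp_all add: final_st_def blk_def)

fun is_final :: "nat \<Rightarrow> nat \<Rightarrow> st \<Rightarrow> bool" where
  "is_final k n (Ctl j) \<longleftrightarrow> j = n + 2"
| "is_final k n (Boot j) \<longleftrightarrow> j = k"
| "is_final k n LoadFin \<longleftrightarrow> True"
| "is_final k n (Fin b r) \<longleftrightarrow> r < k"
| "is_final k n _ \<longleftrightarrow> False"

lemma is_final_iff: "is_final k n s \<longleftrightarrow> (\<exists>\<gamma> < 2 * k + 3. s = final_st k n \<gamma>)"
proof
  show "\<exists>\<gamma> < 2 * k + 3. s = final_st k n \<gamma>" if "is_final k n s"
    by (rule exI[of _ "block_of_st s"]) (use that in \<open>cases s; auto\<close>)
  assume "\<exists>\<gamma> < 2 * k + 3. s = final_st k n \<gamma>"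
  then obtain \<gamma> where "\<gamma> < 2 * k + 3" "s = final_st k n \<gamma>" by blast
  then show "is_final k n s" by (cases \<gamma> rule: blk_cases) auto
qed

text \<open>The \<open>v\<close> waiting tasks under the running one, the last of which is the
  bottom task.\<close>

fun below :: "nat \<Rightarrow> nat \<Rightarrow> st list" where
  "below r 0 = []"
| "below r (Suc v) = Ret (v = 0) r # below r v"

definition idle :: "(nat \<Rightarrow> nat) \<Rightarrow> nat \<Rightarrow> st list" where
  "idle \<sigma> r = Idle (\<sigma> r = 0) r # below r (\<sigma> r)"

definition input :: "nat \<Rightarrow> nat \<Rightarrow> nat" where
  "input m = (\<lambda>_. 0)(0 := m)"

text \<open>Loading is an ordinary instruction: label 3 increments register 0 and returns to the
  idle label 0, so one simulation serves loading and running. Labels 0 and 2 carry no instruction,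
  hence all chains stand still there. \<open>L\<close> becomes the data domain.\<close>

locale counter_machine =
  fixes prog :: "nat \<Rightarrow> instr option" and k :: nat and L :: "nat set"
  assumes finite_L: "finite L" and const_L: "0 \<in> L" "1 \<in> L" "2 \<in> L" "3 \<in> L" and k_pos: "0 < k"
    and inc_ok: "prog l = Some (IInc r l') \<Longrightarrow> l \<in> L \<and> l' \<in> L \<and> r < k"
    and dec_ok: "prog l = Some (IDec r l1 l2) \<Longrightarrow> l \<in> L \<and> l1 \<in> L \<and> l2 \<in> L \<and> r < k"
    and prog_0: "prog 0 = None" and prog_2: "prog 2 = None" and prog_3: "prog 3 = Some (IInc 0 0)"
begin

fun ok_st :: "nat \<Rightarrow> st \<Rightarrow> bool" where
  "ok_st n (Ctl j) \<longleftrightarrow> j \<le> n + 3"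
| "ok_st n (Boot j) \<longleftrightarrow> j \<le> k"
| "ok_st n (Idle b r) \<longleftrightarrow> r < k"
| "ok_st n (Push b r) \<longleftrightarrow> r < k"
| "ok_st n (Ret b r) \<longleftrightarrow> r < k"
| "ok_st n (Goto b r l) \<longleftrightarrow> r < k \<and> l \<in> L"
| "ok_st n (Call r) \<longleftrightarrow> r < k"
| "ok_st n (Fin b r) \<longleftrightarrow> r < k"
| "ok_st n _ \<longleftrightarrow> True"

text \<open>A dispatched task receives no argument and a terminated one returns no result.
  \<open>Call\<close> and \<open>Ret\<close> therefore learn the next label by testing the variable,
  which still holds the label of the current instruction. Only the assignment of
  \<open>Goto\<close>, the last action of an instruction, passes the turn on. \<open>Push\<close> is
  a separate state because a test and a dispatch are two actions.\<close>

inductive edge :: "nat \<Rightarrow> st \<Rightarrow> (nat, nat, nat, nat) action \<Rightarrow> st \<Rightarrow> bool" for n where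
  boot: "edge n (Ctl (n + 3)) (DispatchS 0 1) (Ctl 0)"
| load: "j < n \<Longrightarrow> edge n (Ctl j) (DispatchS 0 2) (Ctl (Suc j))"
| start: "edge n (Ctl n) (Assign 0 1) (Ctl (Suc n))"
| halt: "edge n (Ctl (Suc n)) (Guard [Eq 0 2]) (Ctl (n + 2))"
| spawn: "r < k \<Longrightarrow> edge n (Boot r) (DispatchA 0 (blk True r)) (Boot (Suc r))"
| load_request: "edge n LoadInit (Assign 0 3) LoadWait"
| load_done: "edge n LoadWait (Guard [Eq 0 0]) LoadFin"
| inc: "prog l = Some (IInc r l') \<Longrightarrow> edge n (Idle b r) (Guard [Eq 0 l]) (Push b r)"
| push: "r < k \<Longrightarrow> edge n (Push b r) (DispatchS 0 (blk False r)) (Ret b r)"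
| inc_next: "prog l = Some (IInc r l') \<Longrightarrow> edge n (Call r) (Guard [Eq 0 l]) (Goto False r l')"
| dec: "prog l = Some (IDec r l1 l2) \<Longrightarrow> edge n (Idle False r) (Guard [Eq 0 l]) (Fin False r)"
| dec_next: "prog l = Some (IDec r l1 l2) \<Longrightarrow> edge n (Ret b r) (Guard [Eq 0 l]) (Goto b r l1)"
| zero_next: "prog l = Some (IDec r l1 l2) \<Longrightarrow> edge n (Idle True r) (Guard [Eq 0 l]) (Goto True r l2)"
| goto: "r < k \<Longrightarrow> l \<in> L \<Longrightarrow> edge n (Goto b r l) (Assign 0 l) (Idle b r)"

inductive_cases edge_stE [elim!]:
  "edge n (Ctl j) a s'" "edge n (Boot r) a s'" "edge n LoadInit a s'" "edge n LoadWait a s'"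
  "edge n LoadFin a s'" "edge n (Idle b r) a s'" "edge n (Push b r) a s'" "edge n (Ret b r) a s'"
  "edge n (Call r) a s'" "edge n (Goto b r l) a s'" "edge n (Fin b r) a s'"

inductive_cases edge_DispatchAE: "edge n s (DispatchA q \<gamma>) s'"

definition automaton :: "nat \<Rightarrow> nat_qdas" where
  "automaton n = \<lparr>dom_of = L, init_val = 0, vars = {0}, cqid = {0}, sqid = {},
     blocks = {..<2 * k + 3}, main = 0,
     states = (\<lambda>\<gamma>. st_code ` {s. ok_st n s \<and> block_of_st s = \<gamma>}),
     init_state = (\<lambda>\<gamma>. st_code (init_st n \<gamma>)),
     final_state = (\<lambda>\<gamma>. st_code (final_st k n \<gamma>)),
     trans_of = (\<lambda>\<gamma>. {(st_code s, a, st_code s') |s a s'. edge n s a s' \<and> block_of_st s = \<gamma>})\<rparr>"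

lemma trans_of_automaton:
  "(st_code s, a, st_code s') \<in> trans_of (automaton n) \<gamma> \<longleftrightarrow> edge n s a s' \<and> block_of_st s = \<gamma>"
  by (auto simp: automaton_def)

lemma edge_ok:
  assumes "edge n s a s'"
  shows "ok_st n s \<and> ok_st n s' \<and> block_of_st s' = block_of_st s \<and> action_ok (automaton n) a"
  using assms
  by cases (use k_pos const_L inc_ok dec_ok in \<open>auto simp: automaton_def dest!: inc_ok dec_ok\<close>)

lemma finite_ok_st: "finite {s. ok_st n s}"
proof (rule finite_subset)
  show "{s. ok_st n s} \<subseteq> Ctl ` {..n + 3} \<union> Boot ` {..k} \<union> {LoadInit, LoadWait, LoadFin} \<union>
      (\<Union>r < k. \<Union>b. {Idle b r, Push b r, Ret b r, Call r, Fin b r} \<union> Goto b r ` L)"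
    (is "_ \<subseteq> ?S")
  proof
    fix s assume "s \<in> {s. ok_st n s}"
    then show "s \<in> ?S" by (cases s) (auto simp: image_iff)
  qed
  show "finite ?S" using finite_L by simp
qed

lemma finite_edges: "finite {(s, a, s'). edge n s a s'}"
proof (rule finite_subset)
  let ?B = "{..<2 * k + 3}"
  let ?acts = "DispatchA 0 ` ?B \<union> DispatchS 0 ` ?B \<union> (\<lambda>l. Guard [Eq 0 l]) ` L \<union> Assign 0 ` L"
  show "{(s, a, s'). edge n s a s'} \<subseteq> {s. ok_st n s} \<times> ?acts \<times> {s. ok_st n s}"
  proof clarify
    fix s a s' assume e: "edge n s a s'"
    then have "a \<in> ?acts"
      by cases (use k_pos const_L in \<open>auto dest: inc_ok dec_ok\<close>)
    with edge_ok[OF e] show "s \<in> {s. ok_st n s} \<and> (a, s') \<in> ?acts \<times> {s. ok_st n s}"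
      by blast
  qed
  show "finite ({s. ok_st n s} \<times> ?acts \<times> {s. ok_st n s})"
    using finite_L finite_ok_st by simp
qed

lemma automaton_wf: "qdas_wf (automaton n)"
  unfolding qdas_wf_def
proof (intro conjI ballI impI)
  fix \<gamma> assume \<gamma>: "\<gamma> \<in> blocks (automaton n)"
  show "init_state (automaton n) \<gamma> \<in> states (automaton n) \<gamma>"
    using \<gamma> by (cases \<gamma> rule: blk_cases) (auto simp: automaton_def)
  show "final_state (automaton n) \<gamma> \<in> states (automaton n) \<gamma>"
    using \<gamma> by (cases \<gamma> rule: blk_cases) (auto simp: automaton_def)
  show "finite (states (automaton n) \<gamma>)"
    using finite_ok_st[of n] by (simp add: automaton_def)
  have "trans_of (automaton n) \<gamma> \<subseteq> (\<lambda>(s, a, s'). (st_code s, a, st_code s')) ` {(s, a, s'). edge n s a s'}"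
    by (force simp: automaton_def)
  then show "finite (trans_of (automaton n) \<gamma>)"
    using finite_edges finite_subset by blast
  show "case t of (s, a, s') \<Rightarrow> s \<in> states (automaton n) \<gamma> \<and> action_ok (automaton n) a \<and>
      s' \<in> states (automaton n) \<gamma>" if "t \<in> trans_of (automaton n) \<gamma>" for t
    using that by (auto simp: automaton_def dest!: edge_ok)
next
  fix \<gamma> \<gamma>' :: nat assume "\<gamma> \<noteq> \<gamma>'"
  then show "states (automaton n) \<gamma> \<inter> states (automaton n) \<gamma>' = {}"
    by (auto simp: automaton_def)
qed (use finite_L const_L in \<open>auto simp: automaton_def\<close>)

lemma automaton_concurrent: "concurrent (automaton n)"
  by (simp add: concurrent_def automaton_def)

lemma automaton_uses_sync: "uses_sync (automaton n)"
  unfolding uses_sync_def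
proof (intro bexI exI)
  show "(st_code (Ctl (n + 3)), DispatchS 0 1, st_code (Ctl 0)) \<in> trans_of (automaton n) 0"
    unfolding trans_of_automaton using edge.boot[of n] by simp
qed (simp add: automaton_def)

lemma automaton_uses_async: "uses_async (automaton n)"
  unfolding uses_async_def
proof (intro bexI exI)
  show "(st_code (Boot 0), DispatchA 0 (blk True 0), st_code (Boot (Suc 0))) \<in> trans_of (automaton n) 1"
    unfolding trans_of_automaton by (simp add: edge.spawn k_pos)
qed (simp add: automaton_def)

section \<open>Threads with decoded states and a single variable\<close>

inductive lstep :: "nat \<Rightarrow> st list \<times> nat \<Rightarrow> st list \<times> nat \<Rightarrow> bool" for n where
  guard: "edge n s (Guard [Eq 0 x]) s' \<Longrightarrow> lstep n (s # t, x) (s' # t, x)"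
| assign: "edge n s (Assign 0 d) s' \<Longrightarrow> lstep n (s # t, x) (s' # t, d)"
| sync: "edge n s (DispatchS 0 \<gamma>) s' \<Longrightarrow> lstep n (s # t, x) (init_st n \<gamma> # s' # t, x)"
| finish: "is_final k n s \<Longrightarrow> lstep n (s # t, x) (t, x)"

inductive sstep :: "nat \<Rightarrow> st list list \<times> nat \<Rightarrow> st list list \<times> nat \<Rightarrow> bool" for n where
  local: "lstep n (X, x) (X', x') \<Longrightarrow> sstep n (T1 @ X # T2, x) (T1 @ X' # T2, x')"
| async: "edge n s (DispatchA 0 \<gamma>) s' \<Longrightarrow>
    sstep n (T1 @ (s # t) # T2, x) (T1 @ (s' # t) # T2 @ [[init_st n \<gamma>]], x)"

lemma trans_automaton:
  "(\<exists>\<gamma> \<in> blocks (automaton n). (u, a, u') \<in> trans_of (automaton n) \<gamma>) \<longleftrightarrow>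
    (\<exists>s s'. u = st_code s \<and> u' = st_code s' \<and> edge n s a s')"
proof -
  have "block_of_st s < 2 * k + 3" if "ok_st n s" for s
    using that k_pos by (cases s) auto
  then show ?thesis using edge_ok by (fastforce simp: automaton_def)
qed

lemma edge_shape:
  assumes "edge n s a s'"
  shows "(\<exists>\<gamma>. a = DispatchA 0 \<gamma> \<or> a = DispatchS 0 \<gamma>) \<or> (\<exists>l. a = Guard [Eq 0 l] \<or> a = Assign 0 l)"
  using assms by cases auto

lemma sstep_if_tstep:
  assumes "tstep (automaton n) (map (map st_code) S, val) (T', val')"
  shows "\<exists>S'. T' = map (map st_code) S' \<and> sstep n (S, val 0) (S', val' 0)"
  using assms
proof (cases rule: tstep.cases)
  case (guard \<gamma> u as u' T1 t T2)
  then obtain s s' where s: "u = st_code s" "u' = st_code s'" "edge n s (Guard as) s'"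
    using trans_automaton by blast
  obtain l where l: "as = [Eq 0 l]" using edge_shape[OF s(3)] by auto
  obtain S1 X S2 where S: "S = S1 @ (s # X) # S2" "T1 = map (map st_code) S1" "t = map st_code X"
    "T2 = map (map st_code) S2"
    using guard(1) s(1) by (auto simp: map_eq_append_conv map_eq_Cons_conv)
  have "sstep n (S, val 0) (S1 @ (s' # X) # S2, val 0)"
    unfolding S using s(3) guard(6) by (auto simp: l intro!: sstep.local lstep.guard)
  then show ?thesis
    by (intro exI[of _ "S1 @ (s' # X) # S2"]) (use guard S s in auto)
next
  case (assign \<gamma> u x d u' T1 t T2)
  then obtain s s' where s: "u = st_code s" "u' = st_code s'" "edge n s (Assign x d) s'"
    using trans_automaton by blast
  have x: "x = 0" using edge_shape[OF s(3)] by auto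
  obtain S1 X S2 where S: "S = S1 @ (s # X) # S2" "T1 = map (map st_code) S1" "t = map st_code X"
    "T2 = map (map st_code) S2"
    using assign(1) s(1) by (auto simp: map_eq_append_conv map_eq_Cons_conv)
  have "sstep n (S, val 0) (S1 @ (s' # X) # S2, d)"
    unfolding S using s(3) by (auto simp: x intro!: sstep.local lstep.assign)
  then show ?thesis
    by (intro exI[of _ "S1 @ (s' # X) # S2"]) (use assign S s x in auto)
next
  case (async \<gamma> u q \<delta> u' T1 t T2)
  then obtain s s' where s: "u = st_code s" "u' = st_code s'" "edge n s (DispatchA q \<delta>) s'"
    using trans_automaton by blast
  have q: "q = 0" using edge_shape[OF s(3)] by auto
  obtain S1 X S2 where S: "S = S1 @ (s # X) # S2" "T1 = map (map st_code) S1" "t = map st_code X"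
    "T2 = map (map st_code) S2"
    using async(1) s(1) by (auto simp: map_eq_append_conv map_eq_Cons_conv)
  have "sstep n (S, val 0) (S1 @ (s' # X) # S2 @ [[init_st n \<delta>]], val 0)"
    unfolding S using s(3) by (auto simp: q intro!: sstep.async)
  then show ?thesis
    by (intro exI[of _ "S1 @ (s' # X) # S2 @ [[init_st n \<delta>]]"])
      (use async S s in \<open>auto simp: automaton_def\<close>)
next
  case (sync \<gamma> u q \<delta> u' T1 t T2)
  then obtain s s' where s: "u = st_code s" "u' = st_code s'" "edge n s (DispatchS q \<delta>) s'"
    using trans_automaton by blast
  have q: "q = 0" using edge_shape[OF s(3)] by auto
  obtain S1 X S2 where S: "S = S1 @ (s # X) # S2" "T1 = map (map st_code) S1" "t = map st_code X"
    "T2 = map (map st_code) S2"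
    using sync(1) s(1) by (auto simp: map_eq_append_conv map_eq_Cons_conv)
  have "sstep n (S, val 0) (S1 @ (init_st n \<delta> # s' # X) # S2, val 0)"
    unfolding S using s(3) by (auto simp: q intro!: sstep.local lstep.sync)
  then show ?thesis
    by (intro exI[of _ "S1 @ (init_st n \<delta> # s' # X) # S2"])
      (use sync S s in \<open>auto simp: automaton_def\<close>)
next
  case (finish \<gamma> T1 t T2)
  have f: "final_state (automaton n) \<gamma> = st_code (final_st k n \<gamma>)" "\<gamma> < 2 * k + 3"
    using finish(4) by (auto simp: automaton_def)
  obtain S1 X S2 where S: "S = S1 @ (final_st k n \<gamma> # X) # S2" "T1 = map (map st_code) S1"
    "t = map st_code X" "T2 = map (map st_code) S2"
    using finish(1) f(1) by (auto simp: map_eq_append_conv map_eq_Cons_conv)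
  have "sstep n (S, val 0) (S1 @ X # S2, val 0)"
    unfolding S using f(2) is_final_iff by (auto intro!: sstep.local lstep.finish)
  then show ?thesis
    by (intro exI[of _ "S1 @ X # S2"]) (use finish S in auto)
qed

lemma tstep_if_sstep:
  assumes "sstep n (S, x) (S', x')" "val 0 = x"
  shows "tstep (automaton n) (map (map st_code) S, val) (map (map st_code) S', val(0 := x'))"
  using assms(1)
proof cases
  case (local X X' T1 T2)
  from local(3) show ?thesis
  proof cases
    case (guard s s' t)
    then obtain \<gamma> where "\<gamma> \<in> blocks (automaton n)"
      "(st_code s, Guard [Eq 0 x], st_code s') \<in> trans_of (automaton n) \<gamma>"
      using trans_automaton by blast
    from tstep.guard[OF this] show ?thesis using local guard assms(2) by (simp add: fun_upd_idem)
  next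
    case (assign s s' t)
    then obtain \<gamma> where "\<gamma> \<in> blocks (automaton n)"
      "(st_code s, Assign 0 x', st_code s') \<in> trans_of (automaton n) \<gamma>"
      using trans_automaton by blast
    from tstep.assign[OF this] show ?thesis using local assign by simp
  next
    case (sync s \<delta> s' t)
    then obtain \<gamma> where "\<gamma> \<in> blocks (automaton n)"
      "(st_code s, DispatchS 0 \<delta>, st_code s') \<in> trans_of (automaton n) \<gamma>"
      using trans_automaton by blast
    moreover have "init_state (automaton n) \<delta> = st_code (init_st n \<delta>)" by (simp add: automaton_def)
    ultimately show ?thesis
      using tstep.sync[of _ "automaton n" "st_code s" 0 \<delta> "st_code s'"] local sync assms(2)
      by (simp add: fun_upd_idem)
  next
    case (finish s)
    then obtain \<gamma> where \<gamma>: "\<gamma> < 2 * k + 3" "s = final_st k n \<gamma>" using is_final_iff by blast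
    then have "\<gamma> \<in> blocks (automaton n)" "final_state (automaton n) \<gamma> = st_code s"
      by (simp_all add: automaton_def)
    then show ?thesis
      using tstep.finish[of \<gamma> "automaton n"] local finish assms(2) by (simp add: fun_upd_idem)
  qed
next
  case (async s \<delta> s' T1 t T2)
  then obtain \<gamma> where "\<gamma> \<in> blocks (automaton n)"
    "(st_code s, DispatchA 0 \<delta>, st_code s') \<in> trans_of (automaton n) \<gamma>"
    using trans_automaton by blast
  moreover have "init_state (automaton n) \<delta> = st_code (init_st n \<delta>)" by (simp add: automaton_def)
  ultimately show ?thesis
    using tstep.async[of _ "automaton n" "st_code s" 0 \<delta> "st_code s'"] async assms(2)
    by (simp add: fun_upd_idem)
qed

lemma tsteps_iff_ssteps:
  "(\<exists>T val. (tstep (automaton n))\<^sup>*\<^sup>* (init_threads (automaton n)) (T, val) \<and> st_code s \<in> set (concat T)) \<longleftrightarrow>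
   (\<exists>S x. (sstep n)\<^sup>*\<^sup>* ([[Ctl (n + 3)]], 0) (S, x) \<and> s \<in> set (concat S))"
proof -
  have init: "init_threads (automaton n) = (map (map st_code) [[Ctl (n + 3)]], \<lambda>_. 0)"
    by (simp add: init_threads_def automaton_def)
  have 1: "\<exists>S. fst c = map (map st_code) S \<and> (sstep n)\<^sup>*\<^sup>* ([[Ctl (n + 3)]], 0) (S, snd c 0)"
    if "(tstep (automaton n))\<^sup>*\<^sup>* (init_threads (automaton n)) c" for c
    using that
  proof (induction rule: rtranclp_induct)
    case base
    show ?case by (rule exI[of _ "[[Ctl (n + 3)]]"]) (simp add: init)
  next
    case (step c c')
    then obtain S where S: "fst c = map (map st_code) S"
      "(sstep n)\<^sup>*\<^sup>* ([[Ctl (n + 3)]], 0) (S, snd c 0)" by blast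
    have "tstep (automaton n) (map (map st_code) S, snd c) (fst c', snd c')"
      using step.hyps(2) by (simp flip: S(1))
    from sstep_if_tstep[OF this] S(2) show ?case by (meson rtranclp.rtrancl_into_rtrancl)
  qed
  have 2: "\<exists>val. val 0 = snd d \<and> (tstep (automaton n))\<^sup>*\<^sup>* (init_threads (automaton n)) (map (map st_code) (fst d), val)"
    if "(sstep n)\<^sup>*\<^sup>* ([[Ctl (n + 3)]], 0) d" for d
    using that
  proof (induction rule: rtranclp_induct)
    case base
    show ?case by (rule exI[of _ "\<lambda>_. 0"]) (simp add: init)
  next
    case (step d d')
    then obtain val where val: "val 0 = snd d"
      "(tstep (automaton n))\<^sup>*\<^sup>* (init_threads (automaton n)) (map (map st_code) (fst d), val)" by blast
    have "sstep n (fst d, snd d) (fst d', snd d')" using step.hyps(2) by simp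
    from tstep_if_sstep[of n "fst d" "snd d" "fst d'" "snd d'" val, OF this val(1)] val(2)
    have "(tstep (automaton n))\<^sup>*\<^sup>* (init_threads (automaton n)) (map (map st_code) (fst d'), val(0 := snd d'))"
      by simp
    moreover have "(val(0 := snd d')) 0 = snd d'" by simp
    ultimately show ?case by blast
  qed
  show ?thesis
  proof
    assume "\<exists>T val. (tstep (automaton n))\<^sup>*\<^sup>* (init_threads (automaton n)) (T, val) \<and> st_code s \<in> set (concat T)"
    with 1 show "\<exists>S x. (sstep n)\<^sup>*\<^sup>* ([[Ctl (n + 3)]], 0) (S, x) \<and> s \<in> set (concat S)" by fastforce
  next
    assume "\<exists>S x. (sstep n)\<^sup>*\<^sup>* ([[Ctl (n + 3)]], 0) (S, x) \<and> s \<in> set (concat S)"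
    with 2 show "\<exists>T val. (tstep (automaton n))\<^sup>*\<^sup>* (init_threads (automaton n)) (T, val) \<and> st_code s \<in> set (concat T)"
      by fastforce
  qed
qed

text \<open>The shapes of the thread of register \<open>r\<close> while it executes the instruction with label \<open>l\<close>, the
  variable still being \<open>l\<close>; \<open>\<sigma>\<close> is the register contents before the instruction.\<close>

inductive executing :: "nat \<Rightarrow> (nat \<Rightarrow> nat) \<Rightarrow> nat \<Rightarrow> st list \<Rightarrow> bool" for l \<sigma> where
  "prog l = Some (IInc r l') \<Longrightarrow> executing l \<sigma> r (Push (\<sigma> r = 0) r # below r (\<sigma> r))"
| "prog l = Some (IInc r l') \<Longrightarrow> executing l \<sigma> r (Call r # below r (Suc (\<sigma> r)))"
| "prog l = Some (IInc r l') \<Longrightarrow> executing l \<sigma> r (Goto False r l' # below r (Suc (\<sigma> r)))"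
| "prog l = Some (IDec r l1 l2) \<Longrightarrow> \<sigma> r = 0 \<Longrightarrow> executing l \<sigma> r [Goto True r l2]"
| "prog l = Some (IDec r l1 l2) \<Longrightarrow> \<sigma> r = Suc v \<Longrightarrow> executing l \<sigma> r (Fin False r # below r (Suc v))"
| "prog l = Some (IDec r l1 l2) \<Longrightarrow> \<sigma> r = Suc v \<Longrightarrow> executing l \<sigma> r (below r (Suc v))"
| "prog l = Some (IDec r l1 l2) \<Longrightarrow> \<sigma> r = Suc v \<Longrightarrow> executing l \<sigma> r (Goto (v = 0) r l1 # below r v)"

text \<open>An idle chain can only pass a test for a label whose instruction acts on its own
  register.\<close>

lemma idle_lstep:
  assumes "lstep n (idle \<sigma> r, l) (X', x')"
  shows "x' = l \<and> executing l \<sigma> r X'"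
  using assms
proof cases
  case (guard s s' t)
  then show ?thesis
    by (cases "\<sigma> r") (auto simp: idle_def intro: executing.intros(4) executing.intros(5)[unfolded below.simps]
        dest: executing.intros(1)[where l = l and r = r and \<sigma> = \<sigma>])
qed (auto simp: idle_def)

text \<open>Each shape permits only the next move of the protocol. The assignment of
  \<open>Goto\<close> alone leaves the list of shapes, and at that moment the whole machine step
  takes effect.\<close>

lemma executing_lstep:
  assumes "executing l \<sigma> r X" "lstep n (X, l) (X', x')"
  shows "x' = l \<and> executing l \<sigma> r X' \<or>
    (\<exists>\<sigma>'. mstep prog (l, \<sigma>) (x', \<sigma>') \<and> X' = idle \<sigma>' r \<and> (\<forall>r'. r' \<noteq> r \<longrightarrow> \<sigma>' r' = \<sigma> r'))"
  using assms(1)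
proof cases
  case (1 l')
  from assms(2) show ?thesis
    unfolding 1(1) by cases (use executing.intros(2)[OF 1(2), of \<sigma>] in auto)
next
  case (2 l')
  from assms(2) show ?thesis
    unfolding 2(1) by cases (use 2 in \<open>auto intro: executing.intros simp del: below.simps\<close>)
next
  case (3 l')
  have "mstep prog (l, \<sigma>) (l', \<sigma>(r := Suc (\<sigma> r)))" using 3(2) by (rule mstep.inc)
  with assms(2) show ?thesis
    unfolding 3(1) by cases (auto simp: idle_def intro!: exI[of _ "\<sigma>(r := Suc (\<sigma> r))"])
next
  case (4 l1 l2)
  have "mstep prog (l, \<sigma>) (l2, \<sigma>)" using 4(2,3) by (rule mstep.zero)
  with assms(2) 4(3) show ?thesis
    unfolding 4(1) by cases (auto simp: idle_def)
next
  case (5 l1 l2 v)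
  from assms(2) show ?thesis
    unfolding 5(1)
    by cases (use executing.intros(6)[of l r l1 l2 \<sigma> v] 5 in \<open>auto\<close>)
next
  case (6 l1 l2 v)
  from assms(2) show ?thesis
    unfolding 6(1) below.simps
    by cases (use 6 in \<open>auto intro: executing.intros(7)\<close>)
next
  case (7 l1 l2 v)
  have "mstep prog (l, \<sigma>) (l1, \<sigma>(r := v))" using 7(2,3) by (rule mstep.dec)
  with assms(2) show ?thesis
    unfolding 7(1) by cases (auto simp: idle_def intro!: exI[of _ "\<sigma>(r := v)"])
qed

lemma executing_register: "executing l \<sigma> r X \<Longrightarrow> executing l \<sigma> r' X' \<Longrightarrow> r = r'"
  by (auto elim!: executing.cases)

text \<open>Mutual exclusion: at most one chain is away from its idle shape, and that chain is
  executing the current label.\<close>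

definition core :: "nat \<Rightarrow> (nat \<Rightarrow> nat) \<Rightarrow> (nat \<Rightarrow> st list) \<Rightarrow> bool" where
  "core l \<sigma> ch \<longleftrightarrow> (\<forall>r < k. ch r = idle \<sigma> r) \<or>
     (\<exists>r < k. executing l \<sigma> r (ch r) \<and> (\<forall>r' < k. r' \<noteq> r \<longrightarrow> ch r' = idle \<sigma> r'))"

text \<open>If a chain leaves its idle shape, its register is the one named by the instruction at
  \<open>l\<close>, so no other chain can be executing.\<close>

lemma core_lstep:
  assumes core: "core l \<sigma> ch" and r: "r < k" and step: "lstep n (ch r, l) (X', x')"
  shows "\<exists>\<sigma>'. ((x', \<sigma>') = (l, \<sigma>) \<or> mstep prog (l, \<sigma>) (x', \<sigma>')) \<and> core x' \<sigma>' (ch(r := X'))"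
proof (cases "ch r = idle \<sigma> r")
  case True
  with step have m: "x' = l" "executing l \<sigma> r X'" using idle_lstep by auto
  from core have "\<forall>r' < k. r' \<noteq> r \<longrightarrow> ch r' = idle \<sigma> r'"
    unfolding core_def using executing_register[OF m(2)] by blast
  then have "core l \<sigma> (ch(r := X'))" using m r unfolding core_def by auto
  with m(1) show ?thesis by blast
next
  case False
  with core r have m: "executing l \<sigma> r (ch r)" "\<forall>r' < k. r' \<noteq> r \<longrightarrow> ch r' = idle \<sigma> r'"
    unfolding core_def by blast+
  from executing_lstep[OF m(1) step] show ?thesis
  proof
    assume "x' = l \<and> executing l \<sigma> r X'"
    then have "x' = l" "core l \<sigma> (ch(r := X'))" using m(2) r unfolding core_def by auto
    then show ?thesis by blast
  next
    assume "\<exists>\<sigma>'. mstep prog (l, \<sigma>) (x', \<sigma>') \<and> X' = idle \<sigma>' r \<and> (\<forall>r'. r' \<noteq> r \<longrightarrow> \<sigma>' r' = \<sigma> r')"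
    then obtain \<sigma>' where \<sigma>': "mstep prog (l, \<sigma>) (x', \<sigma>')" "X' = idle \<sigma>' r"
      "\<forall>r'. r' \<noteq> r \<longrightarrow> \<sigma>' r' = \<sigma> r'" by blast
    have "(ch(r := X')) r' = idle \<sigma>' r'" if "r' < k" for r'
      using that m(2) \<sigma>'(2,3) by (cases "r' = r") (auto simp: idle_def)
    then have "core x' \<sigma>' (ch(r := X'))" unfolding core_def by blast
    with \<sigma>'(1) show ?thesis by blast
  qed
qed

text \<open>At a label without instruction all chains are idle, which is when the main thread may
  change the variable safely.\<close>

lemma core_stuck: "core l \<sigma> ch \<Longrightarrow> prog l = None \<Longrightarrow> r < k \<Longrightarrow> ch r = idle \<sigma> r"
  unfolding core_def by (auto elim: executing.cases)

lemma core_idle: "(\<And>r. r < k \<Longrightarrow> ch r = idle \<sigma> r) \<Longrightarrow> core l \<sigma> ch"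
  unfolding core_def by blast

section \<open>The phases of the main thread\<close>

lemma threads_split:
  assumes "ms # map ch [0..<j] = T1 @ X # T2"
  shows "T1 = [] \<and> X = ms \<and> T2 = map ch [0..<j] \<or>
    (\<exists>r < j. X = ch r \<and> (\<forall>X'. T1 @ X' # T2 = ms # map (ch(r := X')) [0..<j]))"
proof (cases T1)
  case (Cons m T)
  then have eq: "map ch [0..<j] = T @ X # T2" "m = ms" using assms by auto
  let ?r = "length T"
  have r: "?r < j" using arg_cong[OF eq(1), of length] by simp
  then have "X = ch ?r" using arg_cong[OF eq(1), of "\<lambda>xs. xs ! ?r"] by simp
  moreover have "T @ X' # T2 = map (ch(?r := X')) [0..<j]" for X'
  proof -
    have "T @ X' # T2 = (map ch [0..<j])[?r := X']" unfolding eq(1) by simp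
    also have "\<dots> = map (ch(?r := X')) [0..<j]"
      by (intro nth_equalityI) (auto simp: nth_list_update)
    finally show ?thesis .
  qed
  ultimately show ?thesis using r Cons eq(2) by auto
qed (use assms in auto)

text \<open>\<open>Ctl (n + 2)\<close> occurs in no phase, so covering it means leaving the
  invariant. While \<open>LoadWait\<close> is on top, the requested increment is either pending
  (label 3) or served (label 0).\<close>

inductive thread_inv :: "nat \<Rightarrow> st list list \<times> nat \<Rightarrow> bool" for n where
  start: "thread_inv n ([[Ctl (n + 3)]], 0)"
| boot: "j \<le> k \<Longrightarrow> thread_inv n ([Boot j, Ctl 0] # map (idle (\<lambda>_. 0)) [0..<j], 0)"
| load: "m \<le> n \<Longrightarrow> core 0 (input m) ch \<Longrightarrow> thread_inv n ([Ctl m] # map ch [0..<k], 0)"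
| load_init: "m < n \<Longrightarrow> core 0 (input m) ch \<Longrightarrow> thread_inv n ([LoadInit, Ctl (Suc m)] # map ch [0..<k], 0)"
| load_wait: "m < n \<Longrightarrow> core l \<sigma> ch \<Longrightarrow> (l, \<sigma>) \<in> {(3, input m), (0, input (Suc m))} \<Longrightarrow>
    thread_inv n ([LoadWait, Ctl (Suc m)] # map ch [0..<k], l)"
| load_fin: "m < n \<Longrightarrow> core 0 (input (Suc m)) ch \<Longrightarrow> thread_inv n ([LoadFin, Ctl (Suc m)] # map ch [0..<k], 0)"
| run: "(mstep prog)\<^sup>*\<^sup>* (1, input n) (l, \<sigma>) \<Longrightarrow> core l \<sigma> ch \<Longrightarrow> thread_inv n ([Ctl (Suc n)] # map ch [0..<k], l)"

lemma mstep_prog_None: "mstep prog (l, \<sigma>) c \<Longrightarrow> prog l \<noteq> None"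
  by (auto elim: mstep.cases)

lemma mstep_load: "mstep prog (3, input m) (l, \<sigma>) \<Longrightarrow> l = 0 \<and> \<sigma> = input (Suc m)"
  using prog_3 by (auto elim!: mstep.cases simp: input_def)

text \<open>Only \<open>Boot\<close> dispatches asynchronously, and it never occurs in the chain of
  a register.\<close>

lemma no_async_from_chain:
  assumes "core l \<sigma> ch" "r < k" "ch r = s # t"
  shows "\<not> edge n s (DispatchA q \<gamma>) s'"
proof -
  have "\<nexists>j. s = Boot j"
    using assms unfolding core_def by (fastforce simp: idle_def elim!: executing.cases)
  then show ?thesis by (auto elim: edge_DispatchAE)
qed

lemma sstep_threads_cases:
  assumes "sstep n (ms # map ch [0..<k], x) (S', x')" and core: "core x \<sigma> ch"
    and no_async: "\<And>s t q \<gamma> s'. ms = s # t \<Longrightarrow> \<not> edge n s (DispatchA q \<gamma>) s'"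
  obtains (main) ms' where "lstep n (ms, x) (ms', x')" "S' = ms' # map ch [0..<k]"
  | (chain) ch' \<sigma>' where "S' = ms # map ch' [0..<k]" "core x' \<sigma>' ch'"
      "(x', \<sigma>') = (x, \<sigma>) \<or> mstep prog (x, \<sigma>) (x', \<sigma>')"
  using assms(1)
proof cases
  case (local X X' T1 T2)
  from threads_split[OF local(1)] show thesis
  proof
    assume "T1 = [] \<and> X = ms \<and> T2 = map ch [0..<k]"
    with local main show thesis by simp
  next
    assume "\<exists>r < k. X = ch r \<and> (\<forall>X'. T1 @ X' # T2 = ms # map (ch(r := X')) [0..<k])"
    then obtain r where r: "r < k" "X = ch r" "\<And>X'. T1 @ X' # T2 = ms # map (ch(r := X')) [0..<k]"
      by blast
    from core_lstep[OF core r(1)] local(3) r(2) obtain \<sigma>' where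
      "(x', \<sigma>') = (x, \<sigma>) \<or> mstep prog (x, \<sigma>) (x', \<sigma>')" "core x' \<sigma>' (ch(r := X'))" by blast
    with chain r(3) local(2) show thesis by metis
  qed
next
  case (async s \<gamma> s' T1 t T2)
  from threads_split[OF async(1)] no_async no_async_from_chain[OF core] async(4) show thesis
    by metis
qed

text \<open>The second alternative absorbs the halting edge of \<open>main\<close>, the only way out
  of the invariant.\<close>

lemma thread_inv_sstep:
  assumes "thread_inv n (S, x)" and step: "sstep n (S, x) (S', x')"
  shows "thread_inv n (S', x') \<or> (\<exists>\<sigma>. (mstep prog)\<^sup>*\<^sup>* (1, input n) (2, \<sigma>))"
  using assms(1)
proof cases
  case start
  from step have "thread_inv n (S', x')"
    unfolding start
  proof cases
    case (local X X' T1 T2)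
    then have X: "X = [Ctl (n + 3)]" "T1 = []" "T2 = []" by (auto simp: Cons_eq_append_conv)
    from local(3) show ?thesis
      unfolding X(1) local(2) X(2,3)
      by cases (use thread_inv.boot[of 0 n] in auto)
  next
    case (async s \<gamma> s' T1 t T2)
    then show ?thesis by (auto simp: Cons_eq_append_conv)
  qed
  then show ?thesis ..
next
  case (boot j)
  have split: "X = [Boot j, Ctl 0] \<and> T1 = [] \<and> T2 = map (idle (\<lambda>_. 0)) [0..<j] \<or> (\<exists>r. X = idle (\<lambda>_. 0) r)"
    if "S = T1 @ X # T2" for T1 X T2
    using threads_split[OF that[unfolded boot(1)]] by blast
  \<comment> \<open>During booting the variable is 0, a label without instruction, so the chains
    spawned so far cannot move.\<close>
  have stuck: "\<not> lstep n (idle (\<lambda>_. 0) r, 0) c" for r c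
  proof
    assume "lstep n (idle (\<lambda>_. 0) r, 0) c"
    then have "executing 0 (\<lambda>_. 0) r (fst c)" using idle_lstep[of n _ r 0 "fst c" "snd c"] by simp
    then show False using prog_0 by (auto elim: executing.cases)
  qed
  from step have "thread_inv n (S', x')"
  proof cases
    case (local X X' T1 T2)
    have "X \<noteq> idle (\<lambda>_. 0) r" for r
      using stuck local(3) boot(2) by blast
    with split[OF local(1)]
    have X: "X = [Boot j, Ctl 0]" "T1 = []" "T2 = map (idle (\<lambda>_. 0)) [0..<j]" by simp_all
    have "core 0 (input 0) (idle (\<lambda>_. 0))"
      by (intro core_idle) (simp add: input_def idle_def)
    from local(3) thread_inv.load[of 0 n, OF _ this] show ?thesis
      unfolding X local(2) by cases (use boot in auto)
  next
    case (async s \<gamma> s' T1 t T2)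
    have "s # t \<noteq> idle (\<lambda>_. 0) r" for r
      using async(4) by (auto simp: idle_def)
    with split[OF async(1)] have X: "s # t = [Boot j, Ctl 0]" "T1 = []"
      "T2 = map (idle (\<lambda>_. 0)) [0..<j]" by simp_all
    with async(4) have "j < k" "s' = Boot (Suc j)" "\<gamma> = blk True j" by auto
    then show ?thesis
      using thread_inv.boot[of "Suc j" n] X boot(2) async(2,3) by (simp add: idle_def)
  qed
  then show ?thesis ..
next
  case (load m ch)
  note idle = core_stuck[OF load(4) prog_0]
  from step[unfolded load(1,2)] load(4) show ?thesis
  proof (rule sstep_threads_cases, goal_cases no_async main chain)
    case no_async
    then show ?case by auto
  next
    case (main ms')
    from main(1) have "thread_inv n (S', x')"
      unfolding main(2)
    proof cases
      case assign
      then have "m = n" "ms' = [Ctl (Suc n)]" "x' = 1" by auto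
      then show "thread_inv n (ms' # map ch [0..<k], x')"
        using thread_inv.run[of n 1 "input n" ch] core_idle[of ch "input n" 1] idle by simp
    qed (use load(3,4) in \<open>auto intro: thread_inv.load_init\<close>)
    then show ?case ..
  next
    case (chain ch' \<sigma>')
    then have "x' = 0" "\<sigma>' = input m" using mstep_prog_None prog_0 by blast+
    then show ?case using chain thread_inv.load[OF load(3)] by simp
  qed
next
  case (load_init m ch)
  note idle = core_stuck[OF load_init(4) prog_0]
  from step[unfolded load_init(1,2)] load_init(4) show ?thesis
  proof (rule sstep_threads_cases, goal_cases no_async main chain)
    case no_async
    then show ?case by auto
  next
    case (main ms')
    \<comment> \<open>All chains are idle, so the invariant survives the change of label by the main
      thread.\<close>
    have "core 3 (input m) ch" using idle by (intro core_idle)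
    note wait = thread_inv.load_wait[OF load_init(3) this]
    from main(1) have "thread_inv n (S', x')"
      unfolding main(2) by cases (use wait in auto)
    then show ?case ..
  next
    case (chain ch' \<sigma>')
    then have "x' = 0" "\<sigma>' = input m" using mstep_prog_None prog_0 by blast+
    then show ?case using chain thread_inv.load_init[OF load_init(3)] by simp
  qed
next
  case (load_wait m \<sigma> ch)
  from step[unfolded load_wait(1)] load_wait(3) show ?thesis
  proof (rule sstep_threads_cases, goal_cases no_async main chain)
    case no_async
    then show ?case by auto
  next
    case (main ms')
    from main(1) have "thread_inv n (S', x')"
      unfolding main(2) by cases (use load_wait thread_inv.load_fin[of m n ch] in auto)
    then show ?case ..
  next
    case (chain ch' \<sigma>')
    have "(x', \<sigma>') \<in> {(3, input m), (0, input (Suc m))}"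
      using chain(3) load_wait(4) mstep_load mstep_prog_None prog_0 by blast
    then show ?case using chain thread_inv.load_wait[OF load_wait(2)] by simp
  qed
next
  case (load_fin m ch)
  from step[unfolded load_fin(1,2)] load_fin(4) show ?thesis
  proof (rule sstep_threads_cases, goal_cases no_async main chain)
    case no_async
    then show ?case by auto
  next
    case (main ms')
    from main(1) have "thread_inv n (S', x')"
      unfolding main(2) by cases (use load_fin thread_inv.load[of "Suc m" n ch] in auto)
    then show ?case ..
  next
    case (chain ch' \<sigma>')
    then have "x' = 0" "\<sigma>' = input (Suc m)" using mstep_prog_None prog_0 by blast+
    then show ?case using chain thread_inv.load_fin[OF load_fin(3)] by simp
  qed
next
  case (run \<sigma> ch)
  from step[unfolded run(1)] run(3) show ?thesis
  proof (rule sstep_threads_cases, goal_cases no_async main chain)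
    case no_async
    then show ?case by auto
  next
    case (main ms')
    \<comment> \<open>The only edge out of \<open>Ctl (Suc n)\<close> tests for the halting
      label.\<close>
    from main(1) have "x = 2" by cases auto
    then show ?case using run(2) by blast
  next
    case (chain ch' \<sigma>')
    then have "(mstep prog)\<^sup>*\<^sup>* (1, input n) (x', \<sigma>')"
      using run(2) by (metis rtranclp.rtrancl_into_rtrancl)
    then show ?case using chain thread_inv.run by simp
  qed
qed

lemma halts_if_covered:
  assumes "(sstep n)\<^sup>*\<^sup>* ([[Ctl (n + 3)]], 0) (S, x)" "Ctl (n + 2) \<in> set (concat S)"
  shows "\<exists>\<sigma>. (mstep prog)\<^sup>*\<^sup>* (1, input n) (2, \<sigma>)"
proof -
  have "(sstep n)\<^sup>*\<^sup>* ([[Ctl (n + 3)]], 0) c \<Longrightarrow>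
      thread_inv n c \<or> (\<exists>\<sigma>. (mstep prog)\<^sup>*\<^sup>* (1, input n) (2, \<sigma>))" for c
  proof (induction rule: rtranclp_induct)
    case (step c c')
    then show ?case using thread_inv_sstep[of n "fst c" "snd c" "fst c'" "snd c'"] by auto
  qed (simp add: thread_inv.start[simplified])
  moreover have "\<not> thread_inv n (S, x)"
  proof
    have below: "Ctl j \<notin> set (below r v)" for j r v by (induction v) auto
    have idle: "Ctl j \<notin> set (idle \<sigma> r)" for j \<sigma> r by (simp add: idle_def below)
    have mid: "Ctl j \<notin> set X" if "executing l \<sigma> r X" for j l \<sigma> r X
      using that by cases (auto simp: below)
    have core: "Ctl j \<notin> set (ch r)" if "core l \<sigma> ch" "r < k" for j l \<sigma> ch r
      using that idle mid unfolding core_def by metis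
    assume "thread_inv n (S, x)"
    then show False
      using assms(2) by cases (auto simp: idle dest: core)
  qed
  ultimately show ?thesis using assms(1) by blast
qed

section \<open>From a halting run of the machine to a covering run\<close>

lemma lsteps_idle:
  assumes "mstep prog (l, \<sigma>) (l', \<sigma>')"
  shows "\<exists>r < k. (lstep n)\<^sup>*\<^sup>* (idle \<sigma> r, l) (idle \<sigma>' r, l') \<and> (\<forall>r'. r' \<noteq> r \<longrightarrow> \<sigma>' r' = \<sigma> r')"
  using assms
proof cases
  case (inc r)
  have r: "r < k" "l' \<in> L" using inc_ok[OF inc(2)] by auto
  have "(lstep n)\<^sup>*\<^sup>* (idle \<sigma> r, l) (Push (\<sigma> r = 0) r # below r (\<sigma> r), l)"
    unfolding idle_def by (intro r_into_rtranclp lstep.guard) (rule edge.inc[OF inc(2)])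
  also have "lstep n \<dots> (Call r # below r (Suc (\<sigma> r)), l)"
    using lstep.sync[OF edge.push[OF r(1)]] by simp
  also have "lstep n \<dots> (Goto False r l' # below r (Suc (\<sigma> r)), l)"
    by (rule lstep.guard) (rule edge.inc_next[OF inc(2)])
  also have "lstep n \<dots> (idle \<sigma>' r, l')"
    using lstep.assign[OF edge.goto[OF r]] by (simp add: inc(1) idle_def)
  finally show ?thesis using r inc(1) by auto
next
  case (dec r l2 v)
  have r: "r < k" "l' \<in> L" using dec_ok[OF dec(2)] by auto
  have "(lstep n)\<^sup>*\<^sup>* (idle \<sigma> r, l) (Fin False r # below r (Suc v), l)"
    unfolding idle_def dec(3) using edge.dec[OF dec(2)] by (simp add: lstep.guard r_into_rtranclp)
  also have "lstep n \<dots> (Ret (v = 0) r # below r v, l)"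
    using lstep.finish[of n "Fin False r"] r by simp
  also have "lstep n \<dots> (Goto (v = 0) r l' # below r v, l)"
    by (rule lstep.guard) (rule edge.dec_next[OF dec(2)])
  also have "lstep n \<dots> (idle \<sigma>' r, l')"
    using lstep.assign[OF edge.goto[OF r]] by (simp add: dec(1) idle_def)
  finally show ?thesis using r dec(1) by auto
next
  case (zero r l1)
  have r: "r < k" "l' \<in> L" using dec_ok[OF zero(2)] by auto
  have "(lstep n)\<^sup>*\<^sup>* (idle \<sigma> r, l) ([Goto True r l'], l)"
    unfolding idle_def zero(3) using edge.zero_next[OF zero(2)] by (simp add: lstep.guard r_into_rtranclp)
  also have "lstep n \<dots> (idle \<sigma>' r, l')"
    using lstep.assign[OF edge.goto[OF r]] zero(3) by (simp add: zero(1) idle_def)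
  finally show ?thesis using r zero(1) by auto
qed

lemma ssteps_if_lsteps:
  assumes "(lstep n)\<^sup>*\<^sup>* (X, x) (X', x')"
  shows "(sstep n)\<^sup>*\<^sup>* (T1 @ X # T2, x) (T1 @ X' # T2, x')"
proof -
  have "(lstep n)\<^sup>*\<^sup>* (X, x) c \<Longrightarrow> (sstep n)\<^sup>*\<^sup>* (T1 @ X # T2, x) (T1 @ fst c # T2, snd c)" for c
  proof (induction rule: rtranclp_induct)
    case (step c c')
    from step.hyps(2) have "sstep n (T1 @ fst c # T2, snd c) (T1 @ fst c' # T2, snd c')"
      by (intro sstep.local) simp
    with step.IH show ?case by simp
  qed simp
  from this[OF assms] show ?thesis by simp
qed

lemma ssteps_mstep:
  assumes "mstep prog (l, \<sigma>) (l', \<sigma>')"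
  shows "(sstep n)\<^sup>*\<^sup>* (ms # map (idle \<sigma>) [0..<k], l) (ms # map (idle \<sigma>') [0..<k], l')"
proof -
  obtain r where r: "r < k" "(lstep n)\<^sup>*\<^sup>* (idle \<sigma> r, l) (idle \<sigma>' r, l')"
    "\<forall>r'. r' \<noteq> r \<longrightarrow> \<sigma>' r' = \<sigma> r'"
    using lsteps_idle[OF assms] by blast
  have "[0..<k] = [0..<r] @ r # [Suc r..<k]"
    using r(1) by (metis upt_add_eq_append upt_conv_Cons le_add_diff_inverse less_imp_le_nat zero_le)
  then have split: "ms # map (idle \<tau>) [0..<k] =
      (ms # map (idle \<tau>) [0..<r]) @ idle \<tau> r # map (idle \<tau>) [Suc r..<k]" for \<tau>
    by simp
  have same: "idle \<sigma>' r' = idle \<sigma> r'" if "r' \<noteq> r" for r'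
    using that r(3) by (simp add: idle_def)
  then have eq: "map (idle \<sigma>') [0..<r] = map (idle \<sigma>) [0..<r]"
    "map (idle \<sigma>') [Suc r..<k] = map (idle \<sigma>) [Suc r..<k]" by simp_all
  show ?thesis
    unfolding split eq by (rule ssteps_if_lsteps[OF r(2)])
qed

lemma ssteps_msteps:
  assumes "(mstep prog)\<^sup>*\<^sup>* (l, \<sigma>) (l', \<sigma>')"
  shows "(sstep n)\<^sup>*\<^sup>* (ms # map (idle \<sigma>) [0..<k], l) (ms # map (idle \<sigma>') [0..<k], l')"
proof -
  have "(mstep prog)\<^sup>*\<^sup>* (l, \<sigma>) c \<Longrightarrow>
    (sstep n)\<^sup>*\<^sup>* (ms # map (idle \<sigma>) [0..<k], l) (ms # map (idle (snd c)) [0..<k], fst c)" for c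
  proof (induction rule: rtranclp_induct)
    case (step c c')
    from ssteps_mstep[of "fst c" "snd c" "fst c'" "snd c'"] step.hyps(2)
    have "(sstep n)\<^sup>*\<^sup>* (ms # map (idle (snd c)) [0..<k], fst c) (ms # map (idle (snd c')) [0..<k], fst c')"
      by simp
    with step.IH show ?case by (rule rtranclp_trans)
  qed simp
  from this[OF assms] show ?thesis by simp
qed

lemma sstep_main: "lstep n (ms, x) (ms', x') \<Longrightarrow> sstep n (ms # S, x) (ms' # S, x')"
  using sstep.local[of n ms x ms' x' "[]" S] by simp

lemma covered_if_halts:
  assumes "(mstep prog)\<^sup>*\<^sup>* (1, input n) (2, \<sigma>)"
  shows "\<exists>S x. (sstep n)\<^sup>*\<^sup>* ([[Ctl (n + 3)]], 0) (S, x) \<and> Ctl (n + 2) \<in> set (concat S)"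
proof -
  let ?ch = "\<lambda>\<sigma>. map (idle \<sigma>) [0..<k]"
  have boot: "(sstep n)\<^sup>*\<^sup>* ([[Ctl (n + 3)]], 0) ([Boot j, Ctl 0] # map (idle (\<lambda>_. 0)) [0..<j], 0)"
    if "j \<le> k" for j
    using that
  proof (induction j)
    case 0
    show ?case using sstep_main[OF lstep.sync[OF edge.boot]] by (auto intro!: r_into_rtranclp)
  next
    case (Suc j)
    have "sstep n ([Boot j, Ctl 0] # map (idle (\<lambda>_. 0)) [0..<j], 0)
      ([Boot (Suc j), Ctl 0] # map (idle (\<lambda>_. 0)) [0..<Suc j], 0)"
      using sstep.async[OF edge.spawn[of j n], of "[]" "[Ctl 0]" "map (idle (\<lambda>_. 0)) [0..<j]" 0] Suc.prems
      by (simp add: idle_def)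
    with Suc show ?case by (meson Suc_leD rtranclp.rtrancl_into_rtrancl)
  qed
  have load: "(sstep n)\<^sup>*\<^sup>* ([[Ctl (n + 3)]], 0) ([Ctl m] # ?ch (input m), 0)" if "m \<le> n" for m
    using that
  proof (induction m)
    case 0
    have "sstep n ([Boot k, Ctl 0] # ?ch (\<lambda>_. 0), 0) ([Ctl 0] # ?ch (\<lambda>_. 0), 0)"
      by (intro sstep_main lstep.finish) simp
    moreover have "input 0 = (\<lambda>_. 0)" by (auto simp: input_def)
    ultimately show ?case using boot[of k] by simp
  next
    case (Suc m)
    have "(sstep n)\<^sup>*\<^sup>* ([[Ctl (n + 3)]], 0) ([Ctl m] # ?ch (input m), 0)"
      using Suc by simp
    also have "sstep n \<dots> ([LoadInit, Ctl (Suc m)] # ?ch (input m), 0)"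
      using sstep_main[OF lstep.sync[OF edge.load[of m n]]] Suc.prems by simp
    also have "sstep n \<dots> ([LoadWait, Ctl (Suc m)] # ?ch (input m), 3)"
      by (intro sstep_main lstep.assign edge.load_request)
    also have "(sstep n)\<^sup>*\<^sup>* \<dots> ([LoadWait, Ctl (Suc m)] # ?ch (input (Suc m)), 0)"
    proof (rule ssteps_mstep)
      show "mstep prog (3, input m) (0, input (Suc m))"
        using mstep.inc[where prog = prog and l = 3 and r = 0 and l' = 0 and \<sigma> = "input m", OF prog_3]
        by (simp add: input_def)
    qed
    also have "sstep n \<dots> ([LoadFin, Ctl (Suc m)] # ?ch (input (Suc m)), 0)"
      by (intro sstep_main lstep.guard edge.load_done)
    also have "sstep n \<dots> ([Ctl (Suc m)] # ?ch (input (Suc m)), 0)"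
      by (intro sstep_main lstep.finish) simp
    finally show ?case .
  qed
  have "(sstep n)\<^sup>*\<^sup>* ([[Ctl (n + 3)]], 0) ([Ctl n] # ?ch (input n), 0)"
    using load by simp
  also have "sstep n \<dots> ([Ctl (Suc n)] # ?ch (input n), 1)"
    by (intro sstep_main lstep.assign edge.start)
  also have "(sstep n)\<^sup>*\<^sup>* \<dots> ([Ctl (Suc n)] # ?ch \<sigma>, 2)"
    using assms by (rule ssteps_msteps)
  also have "sstep n \<dots> ([Ctl (n + 2)] # ?ch \<sigma>, 2)"
    by (intro sstep_main lstep.guard edge.halt)
  finally show ?thesis
    by (intro exI conjI) (assumption, simp)
qed

definition target :: "nat \<Rightarrow> nat \<Rightarrow> nat" where
  "target n = (\<lambda>u. if u = st_code (Ctl (n + 2)) then 1 else 0)"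

theorem coverable_iff_halts:
  "parikh_coverable (automaton n) (target n) \<longleftrightarrow> (\<exists>\<sigma>. (mstep prog)\<^sup>*\<^sup>* (1, input n) (2, \<sigma>))"
proof -
  have "st_code (Ctl (n + 2)) \<in> all_states (automaton n)"
    unfolding all_states_def by (rule UN_I[of 0]) (auto simp: automaton_def simp del: st_code.simps)
  note iff = parikh_coverable_single_iff[OF automaton_wf automaton_concurrent this]
  show ?thesis
    unfolding target_def iff tsteps_iff_ssteps using halts_if_covered covered_if_halts by blast
qed

end

section \<open>Loop programs as counter machines\<close>

text \<open>The control points of a loop program, comparable to the partial derivatives of a regular
  expression: a point inside a loop body is a remainder of the body followed by the loop itself.
  There are finitely many, and they serve as labels.\<close>

function conts :: "com list \<Rightarrow> com list set" where
  "conts [] = {[]}"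
| "conts (CInc r # K) = insert (CInc r # K) (conts K)"
| "conts (CLoop r P # K) = insert (CLoop r P # K) (conts K \<union> (\<lambda>X. X @ CLoop r P # K) ` conts P)"
  by pat_completeness auto
termination by (relation "measure (size_list size)") auto

lemma finite_conts: "finite (conts P)"
  by (induction P rule: conts.induct) auto

lemma self_in_conts: "P \<in> conts P"
  by (cases P rule: conts.cases) auto

lemma cstep_append:
  assumes "cstep (X @ R, \<sigma>) (Y, \<sigma>')" "X \<noteq> []"
  shows "\<exists>X'. Y = X' @ R \<and> cstep (X, \<sigma>) (X', \<sigma>')"
proof -
  obtain c K where X: "X = c # K" using assms(2) by (cases X) auto
  from assms(1) show ?thesis
    unfolding X by cases (auto intro: cstep.intros)
qed

lemma conts_closed: "\<lbrakk>X \<in> conts P; cstep (X, \<sigma>) (Y, \<sigma>')\<rbrakk> \<Longrightarrow> Y \<in> conts P"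
proof (induction P arbitrary: X Y rule: conts.induct)
  case 1
  then show ?case by (auto elim: cstep.cases)
next
  case (2 r K)
  then show ?case using self_in_conts[of K] by (auto elim: cstep.cases)
next
  case (3 r P K)
  have self: "Y' \<in> conts (CLoop r P # K)" if "cstep (CLoop r P # K, \<sigma>) (Y', \<sigma>')" for Y'
    using that self_in_conts[of K] self_in_conts[of P] by cases auto
  consider "X = CLoop r P # K" | "X \<in> conts K"
    | X' where "X' \<in> conts P" "X' \<noteq> []" "X = X' @ CLoop r P # K"
    using "3.prems"(1) by auto
  then show ?case
  proof cases
    case 1
    then show ?thesis using self "3.prems"(2) by simp
  next
    case 2
    then show ?thesis using "3.IH"(1) "3.prems"(2) by simp
  next
    case (3 X')
    with cstep_append[of X'] "3.prems"(2) obtain Z where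
      "Y = Z @ CLoop r P # K" "cstep (X', \<sigma>) (Z, \<sigma>')" by blast
    then show ?thesis using "3.IH"(2) 3(1) by auto
  qed
qed

instance com :: countable by countable_datatype

text \<open>The halting point and the start have the prescribed labels 2 and 1. The offset 4 keeps
  all other points clear of these and of 0 and 3, which belong to the loading phase.\<close>

definition label :: "com list \<Rightarrow> com list \<Rightarrow> nat" where
  "label P K = (if K = [] then 2 else if K = P then 1 else to_nat K + 4)"

lemma inj_label: "P \<noteq> [] \<Longrightarrow> inj (label P)"
  by (rule injI) (auto simp: label_def split: if_splits)

lemma label_neq [simp]: "label P K \<noteq> 0" "label P K \<noteq> 3"
  by (auto simp: label_def)

fun instr_of :: "(com list \<Rightarrow> nat) \<Rightarrow> com list \<Rightarrow> instr option" where
  "instr_of lab [] = None"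
| "instr_of lab (CInc r # K) = Some (IInc r (lab K))"
| "instr_of lab (CLoop r Q # K) = Some (IDec r (lab (Q @ CLoop r Q # K)) (lab K))"

definition flat :: "com list \<Rightarrow> nat \<Rightarrow> instr option" where
  "flat P l = (if l = 3 then Some (IInc 0 0)
     else if l \<in> label P ` conts P then instr_of (label P) (inv (label P) l) else None)"

context
  fixes P :: "com list"
  assumes P: "P \<noteq> []"
begin

lemma flat_label: "K \<in> conts P \<Longrightarrow> flat P (label P K) = instr_of (label P) K"
  using inj_label[OF P] by (simp add: flat_def)

lemma flat_cases:
  assumes "flat P l = Some i"
  obtains "l = 3" "i = IInc 0 0" | K where "K \<in> conts P" "l = label P K" "instr_of (label P) K = Some i"
  using assms flat_label unfolding flat_def by (auto split: if_splits)

lemma conts_succ: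
  "CInc r # K \<in> conts P \<Longrightarrow> K \<in> conts P"
  "CLoop r Q # K \<in> conts P \<Longrightarrow> K \<in> conts P"
  "CLoop r Q # K \<in> conts P \<Longrightarrow> Q @ CLoop r Q # K \<in> conts P"
  \<comment> \<open>Closure speaks of actual steps, so registers are chosen that enable them: all 0
    to exit a loop, all 1 to enter it.\<close>
  using conts_closed cstep.inc[of r K "\<lambda>_. 0"] cstep.exit[of "\<lambda>_. 0" r Q K]
    cstep.enter[of "\<lambda>_. 1" r 0 Q K] by auto

lemma counter_machine_flat: "\<exists>k. counter_machine (flat P) k ({0, 1, 2, 3} \<union> label P ` conts P)"
proof -
  define reg where "reg K = (case K of CInc r # _ \<Rightarrow> r | CLoop r _ # _ \<Rightarrow> r | [] \<Rightarrow> 0)" for K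
  \<comment> \<open>The extra 0 makes \<open>k\<close> positive and covers the register of the
    loading instruction.\<close>
  have "finite (insert 0 (reg ` conts P))" using finite_conts by simp
  then obtain k where k: "\<forall>r \<in> insert 0 (reg ` conts P). r < k"
    using finite_nat_set_iff_bounded by blast
  have inc: "reg (CInc r # K) = r" and dec: "reg (CLoop r Q # K) = r" for r Q K
    by (simp_all add: reg_def)
  show ?thesis
  proof (intro exI counter_machine.intro)
    let ?L = "{0, 1, 2, 3} \<union> label P ` conts P"
    show "l \<in> ?L \<and> l' \<in> ?L \<and> r < k" if "flat P l = Some (IInc r l')" for l r l'
      using that
    proof (cases rule: flat_cases)
      case (2 K)
      then obtain K' where "K = CInc r # K'" "l' = label P K'"
        by (cases K rule: conts.cases) auto
      with 2 k inc conts_succ show ?thesis by (metis UnCI imageI insertCI)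
    qed (use k in auto)
    show "l \<in> ?L \<and> l1 \<in> ?L \<and> l2 \<in> ?L \<and> r < k" if "flat P l = Some (IDec r l1 l2)" for l r l1 l2
      using that
    proof (cases rule: flat_cases)
      case (2 K)
      then obtain Q K' where "K = CLoop r Q # K'" "l1 = label P (Q @ CLoop r Q # K')" "l2 = label P K'"
        by (cases K rule: conts.cases) auto
      with 2 k dec conts_succ show ?thesis by (metis UnCI imageI insertCI)
    qed auto
    show "flat P 0 = None" by (auto simp: flat_def)
    have "label P [] = 2" by (simp add: label_def)
    then have "flat P 2 = None" if "2 \<in> label P ` conts P"
      using that flat_label injD[OF inj_label[OF P]] by (metis imageE instr_of.simps(1))
    then show "flat P 2 = None" by (auto simp: flat_def)
    show "flat P 3 = Some (IInc 0 0)" by (simp add: flat_def)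
  qed (use finite_conts k in auto)
qed

lemma mstep_flat_iff:
  assumes K: "K \<in> conts P"
  shows "mstep (flat P) (label P K, \<sigma>) (l, \<sigma>') \<longleftrightarrow> (\<exists>K'. l = label P K' \<and> cstep (K, \<sigma>) (K', \<sigma>'))"
proof
  assume "mstep (flat P) (label P K, \<sigma>) (l, \<sigma>')"
  then show "\<exists>K'. l = label P K' \<and> cstep (K, \<sigma>) (K', \<sigma>')"
    by cases (use flat_label[OF K] in \<open>cases K rule: conts.cases; auto intro: cstep.intros\<close>)+
next
  assume "\<exists>K'. l = label P K' \<and> cstep (K, \<sigma>) (K', \<sigma>')"
  then obtain K' where l: "l = label P K'" and "cstep (K, \<sigma>) (K', \<sigma>')" by blast
  from this(2) show "mstep (flat P) (label P K, \<sigma>) (l, \<sigma>')"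
    by cases (use flat_label[OF K] l in \<open>auto intro: mstep.intros\<close>)
qed

lemma msteps_flat_iff:
  "(\<exists>\<tau>. (mstep (flat P))\<^sup>*\<^sup>* (1, \<sigma>) (2, \<tau>)) \<longleftrightarrow> (\<exists>\<tau>. cstep\<^sup>*\<^sup>* (P, \<sigma>) ([], \<tau>))"
proof -
  have start: "label P P = 1" and stop: "label P [] = 2"
    using P by (simp_all add: label_def)
  have 1: "\<exists>K. fst c = label P K \<and> K \<in> conts P \<and> cstep\<^sup>*\<^sup>* (P, \<sigma>) (K, snd c)"
    if "(mstep (flat P))\<^sup>*\<^sup>* (1, \<sigma>) c" for c
    using that
  proof (induction rule: rtranclp_induct)
    case base
    show ?case using start self_in_conts by force
  next
    case (step c c')
    then obtain K where K: "fst c = label P K" "K \<in> conts P" "cstep\<^sup>*\<^sup>* (P, \<sigma>) (K, snd c)" by blast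
    have "mstep (flat P) (label P K, snd c) (fst c', snd c')"
      using step.hyps(2) by (simp flip: K(1))
    then obtain K' where "fst c' = label P K'" "cstep (K, snd c) (K', snd c')"
      unfolding mstep_flat_iff[OF K(2)] by blast
    with K conts_closed show ?case by (meson rtranclp.rtrancl_into_rtrancl)
  qed
  have 2: "fst c \<in> conts P \<and> (mstep (flat P))\<^sup>*\<^sup>* (1, \<sigma>) (label P (fst c), snd c)"
    if "cstep\<^sup>*\<^sup>* (P, \<sigma>) c" for c
    using that
  proof (induction rule: rtranclp_induct)
    case base
    show ?case using start self_in_conts by simp
  next
    case (step c c')
    have *: "cstep (fst c, snd c) (fst c', snd c')" using step.hyps(2) by simp
    then have "mstep (flat P) (label P (fst c), snd c) (label P (fst c'), snd c')"
      using mstep_flat_iff step.IH by blast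
    with * step.IH conts_closed show ?case by (meson rtranclp.rtrancl_into_rtrancl)
  qed
  show ?thesis
  proof
    assume "\<exists>\<tau>. (mstep (flat P))\<^sup>*\<^sup>* (1, \<sigma>) (2, \<tau>)"
    then obtain \<tau> where "(mstep (flat P))\<^sup>*\<^sup>* (1, \<sigma>) (2, \<tau>)" by blast
    from 1[OF this] stop injD[OF inj_label[OF P]] show "\<exists>\<tau>. cstep\<^sup>*\<^sup>* (P, \<sigma>) ([], \<tau>)"
      by (metis fst_conv snd_conv)
  next
    assume "\<exists>\<tau>. cstep\<^sup>*\<^sup>* (P, \<sigma>) ([], \<tau>)"
    then obtain \<tau> where "cstep\<^sup>*\<^sup>* (P, \<sigma>) ([], \<tau>)" by blast
    from 2[OF this] stop show "\<exists>\<tau>. (mstep (flat P))\<^sup>*\<^sup>* (1, \<sigma>) (2, \<tau>)" by auto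
  qed
qed

end

section \<open>Halting exactly on result 0\<close>

lemma cstep_deterministic: "cstep c d \<Longrightarrow> cstep c e \<Longrightarrow> d = e"
  by (induction rule: cstep.induct) (auto elim: cstep.cases)

text \<open>By determinism everything reached from \<open>c\<close> lies on the run to
  \<open>[]\<close>, which has no successor.\<close>

lemma csteps_confluent_Nil:
  assumes "cstep\<^sup>*\<^sup>* c d" "cstep\<^sup>*\<^sup>* c ([], \<tau>)"
  shows "cstep\<^sup>*\<^sup>* d ([], \<tau>)"
  using assms(1)
proof (induction rule: rtranclp_induct)
  case (step d e)
  from step.IH show ?case
  proof (cases rule: converse_rtranclpE)
    case base
    with step.hyps(2) show ?thesis by (auto elim: cstep.cases)
  next
    case (step d')
    then show ?thesis using cstep_deterministic \<open>cstep d e\<close> by blast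
  qed
qed (rule assms(2))

text \<open>The body undoes the decrement of the loop head, so a nonzero \<open>r\<close> never
  reaches 0.\<close>

definition loop_unless_zero :: "nat \<Rightarrow> com" where
  "loop_unless_zero r = CLoop r [CInc r]"

text \<open>Inside the body \<open>r\<close> may be 0, but the pending increment makes it nonzero
  before the next test.\<close>

lemma loop_unless_zero_diverges:
  assumes "cstep\<^sup>*\<^sup>* ([loop_unless_zero r], \<sigma>) c" "\<sigma> r \<noteq> 0"
  shows "fst c \<noteq> []"
proof -
  have "fst c = [loop_unless_zero r] \<and> snd c r \<noteq> 0 \<or> fst c = [CInc r, loop_unless_zero r]"
    using assms(1)
  proof (induction rule: rtranclp_induct)
    case (step c d)
    obtain K \<tau> K' \<tau>' where cd: "c = (K, \<tau>)" "d = (K', \<tau>')" by fastforce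
    from step.hyps(2) step.IH show ?case
      unfolding cd by cases (auto simp: loop_unless_zero_def)
  qed (simp add: assms(2))
  then show ?thesis by auto
qed

lemma halts_iff_zero:
  assumes Q: "computes g [0] 1 2 Q" and y: "rec_eval g [n] y"
  shows "(\<exists>\<tau>. cstep\<^sup>*\<^sup>* (Q @ [loop_unless_zero 1], input n) ([], \<tau>)) \<longleftrightarrow> y = 0"
proof -
  let ?\<sigma> = "(input n)(1 := y)"
  have "runs Q (input n) ?\<sigma>"
    by (rule computesD[OF Q]) (use y in \<open>auto simp: input_def\<close>)
  then have Q: "cstep\<^sup>*\<^sup>* (Q @ [loop_unless_zero 1], input n) ([loop_unless_zero 1], ?\<sigma>)"
    by (simp add: runs_def)
  show ?thesis
  proof
    assume "\<exists>\<tau>. cstep\<^sup>*\<^sup>* (Q @ [loop_unless_zero 1], input n) ([], \<tau>)"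
    then obtain \<tau> where "cstep\<^sup>*\<^sup>* ([loop_unless_zero 1], ?\<sigma>) ([], \<tau>)"
      using csteps_confluent_Nil[OF Q] by blast
    from loop_unless_zero_diverges[OF this] have "\<not> ?\<sigma> 1 \<noteq> 0" by auto
    then show "y = 0" by simp
  next
    assume "y = 0"
    then have "cstep ([loop_unless_zero 1], ?\<sigma>) ([], ?\<sigma>)"
      unfolding loop_unless_zero_def by (intro cstep.exit) simp
    with Q show "\<exists>\<tau>. cstep\<^sup>*\<^sup>* (Q @ [loop_unless_zero 1], input n) ([], \<tau>)"
      by (meson rtranclp.rtrancl_into_rtrancl)
  qed
qed

section \<open>Codes of the automata\<close>

lemma set_encode_image: "inj_on f X \<Longrightarrow> set_encode (f ` X) = (\<Sum>x \<in> X. 2 ^ f x)"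
  by (simp add: set_encode_def sum.reindex)

lemma set_encode_Un:
  "\<lbrakk>finite X; finite Y; X \<inter> Y = {}\<rbrakk> \<Longrightarrow> set_encode (X \<union> Y) = set_encode X + set_encode Y"
  by (simp add: set_encode_def sum.union_disjoint)

text \<open>\<open>j + j\<close> stands for \<open>2 * j\<close>, multiplication not being among the closure properties above.\<close>

definition ctl_transitions_code :: "nat \<Rightarrow> nat" where
  "ctl_transitions_code n =
     2 ^ list_encode [(n + 3) + (n + 3), action_code (DispatchS 0 1), 0] +
     (2 ^ list_encode [n + n, action_code (Assign 0 1), Suc n + Suc n] +
     (2 ^ list_encode [Suc n + Suc n, action_code (Guard [Eq 0 2]), (n + 2) + (n + 2)] +
     (\<Sum>j < n. 2 ^ list_encode [j + j, action_code (DispatchS 0 2), Suc j + Suc j])))"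

definition ctl_block_code :: "nat \<Rightarrow> nat" where
  "ctl_block_code n = list_encode
     [0, \<Sum>j < n + 4. 2 ^ (j + j), (n + 3) + (n + 3), (n + 2) + (n + 2), ctl_transitions_code n]"

text \<open>The demand is 1 at \<open>Ctl (n + 2)\<close> only. Splitting the sum there avoids a
  case distinction inside a recursive function.\<close>

definition ctl_target_code :: "nat \<Rightarrow> nat" where
  "ctl_target_code n = (\<Sum>j < n + 2. 2 ^ prod_encode (j + j, 0)) +
     (2 ^ prod_encode ((n + 2) + (n + 2), 1) + 2 ^ prod_encode ((n + 3) + (n + 3), 0))"

text \<open>The machine enters through \<open>a\<close> (its other blocks), \<open>b\<close> (the
  target on their states) and \<open>c\<close> (its labels). In the inner list, 1 is
  \<open>set_encode {0}\<close>, for the variables and for the concurrent queues, and the 0 after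
  these is \<open>set_encode {}\<close>, for the serial ones.\<close>

definition assemble :: "nat \<Rightarrow> nat \<Rightarrow> nat \<Rightarrow> nat \<Rightarrow> nat" where
  "assemble a b c n = list_encode
     [list_encode [c, 0, 1, 1, 0, 0, 2 ^ ctl_block_code n + a], ctl_target_code n + b]"

text \<open>The diagonal: \<open>n\<close> is used both as the description of a machine and as the
  input loaded into it.\<close>

definition assemble_index :: "nat \<Rightarrow> nat" where
  "assemble_index n = assemble (fst (prod_decode n)) (fst (prod_decode (snd (prod_decode n))))
     (snd (prod_decode (snd (prod_decode n)))) n"

lemma recfun_assemble_index: "recfun 1 (\<lambda>xs. assemble_index (xs ! 0))"
proof -
  have id: "recfun 1 (\<lambda>xs. xs ! 0)" by (rule recfun_proj) simp
  note I = recfun_intros recfun_sum id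
  have "recfun 1 (\<lambda>xs. ctl_transitions_code (xs ! 0))"
    unfolding ctl_transitions_code_def by (intro I)
  moreover have "recfun 1 (\<lambda>xs. \<Sum>j < xs ! 0 + 4. 2 ^ (j + j))"
    by (intro I)
  ultimately have "recfun 1 (\<lambda>xs. ctl_block_code (xs ! 0))"
    unfolding ctl_block_code_def by (intro I)
  moreover have "recfun 1 (\<lambda>xs. ctl_target_code (xs ! 0))"
    unfolding ctl_target_code_def by (intro I)
  ultimately show ?thesis
    unfolding assemble_index_def assemble_def by (intro I)
qed

context counter_machine
begin

section \<open>The instance code as a function of the input\<close>

lemma trans_of_ctl: "trans_of (automaton n) 0 =
  {(2 * (n + 3), DispatchS 0 1, 0), (2 * n, Assign 0 1, 2 * Suc n),
   (2 * Suc n, Guard [Eq 0 2], 2 * (n + 2))} \<union> (\<lambda>j. (2 * j, DispatchS 0 2, 2 * Suc j)) ` {..<n}"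
  (is "_ = ?T")
proof -
  have 1: "t \<in> ?T" if t: "t \<in> trans_of (automaton n) 0" for t
  proof -
    obtain s a s' where s: "t = (st_code s, a, st_code s')" "edge n s a s'" "block_of_st s = 0"
      using t by (auto simp: automaton_def)
    obtain j where "s = Ctl j" using s(3) by (cases s) auto
    with s show ?thesis by (auto simp: st_code.simps)
  qed
  have "edge n s a s' \<Longrightarrow> block_of_st s = 0 \<Longrightarrow> (st_code s, a, st_code s') \<in> trans_of (automaton n) 0"
    for s a s' by (simp add: trans_of_automaton)
  from this[OF edge.boot] this[OF edge.load] this[OF edge.start] this[OF edge.halt]
  have "t \<in> trans_of (automaton n) 0" if "t \<in> ?T" for t
    using that by (auto simp: st_code.simps)
  with 1 show ?thesis by blast
qed

lemma ctl_transitions_code: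
  "set_encode (transition_code ` trans_of (automaton n) 0) = ctl_transitions_code n"
proof -
  let ?load = "(\<lambda>j. (2 * j, DispatchS 0 2, 2 * Suc j)) ` {..<n} :: (nat \<times> (nat, nat, nat, nat) action \<times> nat) set"
  have "set_encode (transition_code ` trans_of (automaton n) 0) =
      (\<Sum>t \<in> trans_of (automaton n) 0. 2 ^ transition_code t)"
    by (intro set_encode_image inj_on_subset[OF inj_transition_code]) simp
  also have "\<dots> = 2 ^ transition_code (2 * (n + 3), DispatchS 0 1, 0) +
      (2 ^ transition_code (2 * n, Assign 0 1, 2 * Suc n) +
      (2 ^ transition_code (2 * Suc n, Guard [Eq 0 2], 2 * (n + 2)) +
      (\<Sum>t \<in> ?load. 2 ^ transition_code t)))"
    unfolding trans_of_ctl Un_insert_left Un_empty_left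
    by (subst sum.insert; (auto; fail)?)+
  also have "(\<Sum>t \<in> ?load. 2 ^ transition_code t) =
      (\<Sum>j < n. 2 ^ transition_code (2 * j, DispatchS 0 2, 2 * Suc j))"
    by (subst sum.reindex) (auto simp: inj_on_def)
  finally show ?thesis
    by (simp only: ctl_transitions_code_def transition_code.simps mult_2)
qed

lemma states_ctl: "states (automaton n) 0 = (\<lambda>j. 2 * j) ` {..<n + 4}"
proof -
  have "{s. ok_st n s \<and> block_of_st s = 0} = Ctl ` {..<n + 4}"
    by (auto elim: block_of_st.elims)
  then show ?thesis
    by (simp add: automaton_def image_image st_code.simps)
qed

lemma ctl_block_code: "block_code (automaton n) 0 = ctl_block_code n"
proof -
  have "set_encode (states (automaton n) 0) = (\<Sum>j < n + 4. 2 ^ (j + j))"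
    unfolding states_ctl by (subst set_encode_image) (auto simp: inj_on_def mult_2)
  moreover have "init_state (automaton n) 0 = (n + 3) + (n + 3)"
    "final_state (automaton n) 0 = (n + 2) + (n + 2)"
    by (simp_all add: automaton_def st_code.simps)
  ultimately show ?thesis
    by (simp only: block_code_def ctl_block_code_def ctl_transitions_code)
qed

definition other_states :: "nat set" where
  "other_states = st_code ` {s. ok_st 0 s \<and> block_of_st s \<noteq> 0}"

lemma ok_st_cong: "block_of_st s \<noteq> 0 \<Longrightarrow> ok_st n s \<longleftrightarrow> ok_st m s"
  by (cases s) auto

text \<open>The parameter \<open>n\<close> enters only through the edges that leave a
  \<open>Ctl\<close> state.\<close>

lemma edge_cong: "block_of_st s \<noteq> 0 \<Longrightarrow> edge n s a s' \<longleftrightarrow> edge m s a s'"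
  by (cases s) (auto intro: edge.intros)

lemma block_code_cong: "\<gamma> \<noteq> 0 \<Longrightarrow> block_code (automaton n) \<gamma> = block_code (automaton m) \<gamma>"
proof -
  assume \<gamma>: "\<gamma> \<noteq> 0"
  have "states (automaton n) \<gamma> = states (automaton m) \<gamma>"
    using \<gamma> ok_st_cong[of _ n m] by (auto simp: automaton_def)
  moreover have "trans_of (automaton n) \<gamma> = trans_of (automaton m) \<gamma>"
    using \<gamma> edge_cong[of _ n _ _ m] by (auto simp: automaton_def)
  moreover have "init_state (automaton n) \<gamma> = init_state (automaton m) \<gamma>"
    "final_state (automaton n) \<gamma> = final_state (automaton m) \<gamma>"
    using \<gamma> by (simp_all add: automaton_def init_st_def final_st_def)
  ultimately show ?thesis by (simp only: block_code_def)
qed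

definition other_blocks_code :: nat where
  "other_blocks_code = set_encode (block_code (automaton 0) ` {1..<2 * k + 3})"

text \<open>A block code contains the name of its block, so \<open>main\<close> contributes a
  separate power of 2 to the code of the block set; the remaining blocks do not vary with
  \<open>n\<close>.\<close>

lemma qdas_code_automaton:
  "qdas_code (automaton n) =
     list_encode [set_encode L, 0, 1, 1, 0, 0, 2 ^ ctl_block_code n + other_blocks_code]"
proof -
  have name: "\<gamma> = \<delta>" if "block_code A \<gamma> = block_code B \<delta>" for A B \<gamma> \<delta>
    using that by (simp del: list_encode.simps add: block_code_def list_encode_eq)
  have "{..<2 * k + 3} = {0} \<union> {1..<2 * k + 3}" by auto
  then have "block_code (automaton n) ` {..<2 * k + 3} =
      {block_code (automaton n) 0} \<union> block_code (automaton n) ` {1..<2 * k + 3}"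
    by (simp only: image_Un image_insert image_empty)
  also have "block_code (automaton n) ` {1..<2 * k + 3} = block_code (automaton 0) ` {1..<2 * k + 3}"
    by (intro image_cong block_code_cong) auto
  finally have "set_encode (block_code (automaton n) ` {..<2 * k + 3}) =
      set_encode {block_code (automaton n) 0} + other_blocks_code"
    unfolding other_blocks_code_def by (subst set_encode_Un[symmetric]) (auto dest!: name)
  then show ?thesis
    unfolding qdas_code_def
    by (simp del: list_encode.simps add: automaton_def set_encode_def flip: ctl_block_code)
qed

lemma all_states_automaton: "all_states (automaton n) = (\<lambda>j. 2 * j) ` {..<n + 4} \<union> other_states"
proof -
  have "block_of_st s < 2 * k + 3" if "ok_st n s" for s
    using that k_pos by (cases s) auto
  then have "all_states (automaton n) = st_code ` {s. ok_st n s}"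
    by (auto simp: all_states_def automaton_def)
  also have "{s. ok_st n s} = {s. ok_st n s \<and> block_of_st s = 0} \<union> {s. ok_st 0 s \<and> block_of_st s \<noteq> 0}"
    using ok_st_cong[of _ n 0] by blast
  also have "st_code ` \<dots> = states (automaton n) 0 \<union> other_states"
    unfolding image_Un by (simp add: automaton_def other_states_def)
  finally show ?thesis unfolding states_ctl .
qed

lemma other_states_odd: "u \<in> other_states \<Longrightarrow> odd u"
proof -
  have "odd (st_code s)" if "block_of_st s \<noteq> 0" for s
    using that by (cases s) (auto simp: st_code.simps)
  then show "odd u" if "u \<in> other_states"
    using that by (auto simp: other_states_def)
qed

lemma target_code:
  "set_encode ((\<lambda>s. prod_encode (s, target n s)) ` all_states (automaton n)) =
     ctl_target_code n + set_encode ((\<lambda>s. prod_encode (s, 0)) ` other_states)"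
proof -
  have target: "target n u = (if u = 2 * (n + 2) then 1 else 0)" for u
    by (simp add: target_def st_code.simps)
  have fin: "finite other_states"
    unfolding other_states_def using finite_ok_st[of 0] by simp
  \<comment> \<open>The demanded state has an even code, so the target vanishes on the odd
    ones.\<close>
  have "(\<lambda>s. prod_encode (s, target n s)) ` other_states = (\<lambda>s. prod_encode (s, 0)) ` other_states"
    by (intro image_cong) (auto simp: target dest!: other_states_odd)
  then have "(\<lambda>s. prod_encode (s, target n s)) ` all_states (automaton n) =
      (\<lambda>j. prod_encode (2 * j, target n (2 * j))) ` {..<n + 4} \<union> (\<lambda>s. prod_encode (s, 0)) ` other_states"
    unfolding all_states_automaton image_Un image_image by simp
  also have "set_encode \<dots> = set_encode ((\<lambda>j. prod_encode (2 * j, target n (2 * j))) ` {..<n + 4}) +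
      set_encode ((\<lambda>s. prod_encode (s, 0)) ` other_states)"
    \<comment> \<open>Parity separates the two sets, hence their codes add up.\<close>
    using fin by (intro set_encode_Un) (auto simp: prod_encode_eq dest: other_states_odd)
  also have "set_encode ((\<lambda>j. prod_encode (2 * j, target n (2 * j))) ` {..<n + 4}) =
      (\<Sum>j < n + 4. 2 ^ prod_encode (2 * j, target n (2 * j)))"
    by (intro set_encode_image) (auto simp: inj_on_def prod_encode_eq)
  also have "\<dots> = ctl_target_code n"
    by (simp add: ctl_target_code_def target mult_2 eval_nat_numeral)
  finally show ?thesis .
qed

text \<open>The number on which the machine is run: from it, and with itself as the loaded input, the whole
  instance can be reassembled.\<close>

definition index :: nat where
  "index = prod_encode (other_blocks_code,
     prod_encode (set_encode ((\<lambda>s. prod_encode (s, 0)) ` other_states), set_encode L))"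

lemma instance_code_index: "instance_code (automaton index, target index) = assemble_index index"
proof -
  have "instance_code (automaton n, target n) =
    assemble other_blocks_code (set_encode ((\<lambda>s. prod_encode (s, 0)) ` other_states)) (set_encode L) n" for n
    unfolding instance_code_def assemble_def prod.case qdas_code_automaton target_code ..
  then show ?thesis
    by (simp add: assemble_index_def index_def)
qed

end

theorem theorem5:
  shows "\<not> decidable_problem
    {(A :: nat_qdas, f :: nat \<Rightarrow> nat). qdas_wf A \<and> concurrent A \<and> uses_sync A \<and> uses_async A}
    instance_code
    (\<lambda>(A, f). parikh_coverable A f)"
proof
  assume "decidable_problem
    {(A :: nat_qdas, f :: nat \<Rightarrow> nat). qdas_wf A \<and> concurrent A \<and> uses_sync A \<and> uses_async A}
    instance_code
    (\<lambda>(A, f). parikh_coverable A f)"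
  then obtain p where dec:
    "\<forall>x \<in> {(A :: nat_qdas, f). qdas_wf A \<and> concurrent A \<and> uses_sync A \<and> uses_async A}.
      rec_eval p [instance_code x] (if case x of (A, f) \<Rightarrow> parikh_coverable A f then 1 else 0)"
    unfolding decidable_problem_def by blast
  have p: "rec_eval p [instance_code (A, f)] (if parikh_coverable A f then 1 else 0)"
    if "qdas_wf A" "concurrent A" "uses_sync A" "uses_async A" for A f
    using bspec[OF dec, of "(A, f)"] that by simp
  obtain q where q: "rec_eval q [n] (assemble_index n)" for n
  proof -
    obtain q where "\<And>xs. length xs = 1 \<Longrightarrow> rec_eval q xs (assemble_index (xs ! 0))"
      using recfun_assemble_index unfolding recfun_def by blast
    from this[of "[_]"] show thesis by (intro that) simp
  qed
  \<comment> \<open>On \<open>n\<close>, this asks the supposed procedure about the instance that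
    \<open>n\<close> describes, with \<open>n\<close> loaded.\<close>
  define g where "g = Comp p [q]"
  have g: "rec_eval g [n] y" if "rec_eval p [assemble_index n] y" for n y
    unfolding g_def by (rule rec_eval.comp[where ys = "[assemble_index n]"]) (use q that in auto)
  \<comment> \<open>Register 0 is where the automaton loads its input; the answer goes to register
    1, and scratch space starts at 2.\<close>
  obtain Q where Q: "computes g [0] 1 2 Q"
    using computes_ex[of "[0]" 2 1 g] by auto
  define P where "P = Q @ [loop_unless_zero 1]"
  have P: "P \<noteq> []" by (simp add: P_def)
  obtain k where "counter_machine (flat P) k ({0, 1, 2, 3} \<union> label P ` conts P)"
    using counter_machine_flat[OF P] by blast
  \<comment> \<open>With the program fixed, its constants are determined, and \<open>index\<close>
    packs them into the input on which it contradicts the procedure.\<close>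
  then interpret counter_machine "flat P" k "{0, 1, 2, 3} \<union> label P ` conts P" .
  let ?A = "automaton index" and ?f = "target index"
  have "rec_eval p [assemble_index index] (if parikh_coverable ?A ?f then 1 else 0)"
    using p[OF automaton_wf automaton_concurrent automaton_uses_sync automaton_uses_async]
    unfolding instance_code_index[symmetric] .
  from halts_iff_zero[OF Q g[OF this]]
  have "(\<exists>\<tau>. cstep\<^sup>*\<^sup>* (P, input index) ([], \<tau>)) \<longleftrightarrow> \<not> parikh_coverable ?A ?f"
    unfolding P_def by simp
  then show False
    unfolding coverable_iff_halts msteps_flat_iff[OF P] by blast
qed

end
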